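(* Let $p$ be any prime and let $P$ be the set of all primes different from $p$. The $P$-localization $L_P \mathcal{H}$ of the perfect group $\mathcal{H}$ is not a perfect group. In particular, $L_P \mathcal{F}$ is not perfect either.
   Context: For $P$ the set of all primes different from $p$, a group $K$ is called $P$-local if the map $K \to K$, $x \mapsto x^p$, is bijective. Every group $G$ admits a functorial $P$-localization: a homomorphism $\eta_G: G \to L_P G$ with $L_P G$ $P$-local such that for every homomorphism $\psi: G \to K$ into a $P$-local group $K$ there is a unique homomorphism $\tilde\psi: L_P G \to K$ with $\tilde\psi \circ \eta_G = \psi$. A group is perfect if it equals its commutator subgroup. The group $\mathcal{H}$ is given by the presentation with generators $x_1, x_2, x_3, \dots$ and relations $x_i = [x_{2i}, x_{2i+1}]$ for all $i \geq 1$. Equivalently, $\mathcal{H}$ is the colimit of $F_1 \to F_2 \to F_4 \to F_8 \to \cdots$, where $F_{2^n}$ is the free group on $x_{2^n}, x_{2^n+1}, \dots, x_{2^{n+1}-1}$ and the map $\varphi_n: F_{2^n} \to F_{2^{n+1}}$ sends $x_i$ to $[x_{2i}, x_{2i+1}]$. More generally, for a non-decreasing sequence $\mathbf{n} = (n_1, n_2, \dots)$ of positive integers, let $\mathcal{F}_{\mathbf{n}}$ be the colimit of a sequence of free groups $A_0 \to A_1 \to A_2 \to \cdots$, where $A_0$ is free on one generator and, for $k \geq 1$, $A_k$ is free on generators consisting of $2n_k$ new symbols $y_{x,1}, z_{x,1}, \dots, y_{x,n_k}, z_{x,n_k}$ for each free generator $x$ of $A_{k-1}$, the map $A_{k-1}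 \to A_k$ sending $x$ to $[y_{x,1}, z_{x,1}] \cdots [y_{x,n_k}, z_{x,n_k}]$. The group $\mathcal{F}$ (the universal acyclic group of Berrick and Casacuberta) is the free product of the groups $\mathcal{F}_{\mathbf{n}}$ over all non-decreasing sequences $\mathbf{n}$ of positive integers. Thus $\mathcal{H} = \mathcal{F}_{(1,1,1,\dots)}$ is a free factor of $\mathcal{F}$. *)

theory Defs
  imports "HOL-Algebra.Generated_Groups" "HOL-Computational_Algebra.Primes"
begin

section \<open>Perfect groups and presented groups\<close>

definition perfect :: "('a, 'm) monoid_scheme \<Rightarrow> bool" where
  "perfect G \<longleftrightarrow> group G \<and> derived G (carrier G) = carrier G"

text \<open>A word is a list of letters; \<open>(True, x)\<close> stands for the generator \<open>x\<close> and \<open>(False, x)\<close>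
  for its formal inverse.\<close>

type_synonym 'a word = "(bool \<times> 'a) list"

definition words :: "'a set \<Rightarrow> 'a word set" where
  "words X = {w. snd ` set w \<subseteq> X}"

definition comm_word :: "'a \<Rightarrow> 'a \<Rightarrow> 'a word" where
  "comm_word x y = [(True, x), (True, y), (False, x), (False, y)]"

text \<open>The congruence on words over \<open>X\<close> generated by free cancellation and by the relations
  \<open>l = r\<close> for \<open>(l, r) \<in> R\<close>.\<close>

inductive word_eq :: "'a set \<Rightarrow> ('a word \<times> 'a word) set \<Rightarrow> 'a word \<Rightarrow> 'a word \<Rightarrow> bool"
  for X R where
  refl: "w \<in> words X \<Longrightarrow> word_eq X R w w"
| sym: "word_eq X R v w \<Longrightarrow> word_eq X R w v"
| trans: "word_eq X R u v \<Longrightarrow> word_eq X R v w \<Longrightarrow> word_eq X R u w"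
| cancel: "u \<in> words X \<Longrightarrow> v \<in> words X \<Longrightarrow> x \<in> X \<Longrightarrow>
    word_eq X R (u @ [(b, x), (\<not> b, x)] @ v) (u @ v)"
| rel: "(l, r) \<in> R \<Longrightarrow> l \<in> words X \<Longrightarrow> r \<in> words X \<Longrightarrow> u \<in> words X \<Longrightarrow> v \<in> words X \<Longrightarrow>
    word_eq X R (u @ l @ v) (u @ r @ v)"

definition word_class :: "'a set \<Rightarrow> ('a word \<times> 'a word) set \<Rightarrow> 'a word \<Rightarrow> 'a word set" where
  "word_class X R w = {v. word_eq X R w v}"

definition presented_group :: "'a set \<Rightarrow> ('a word \<times> 'a word) set \<Rightarrow> 'a word set monoid" where
  "presented_group X R =
    \<lparr>carrier = word_class X R ` words X,
     monoid.mult = (\<lambda>A B. \<Union>a\<in>A. \<Union>b\<in>B. word_class X R (a @ b)),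
     one = word_class X R []\<rparr>"

definition free_group :: "'a set \<Rightarrow> 'a word set monoid" where
  "free_group X = presented_group X {}"

definition eval_word :: "('b, 'm) monoid_scheme \<Rightarrow> ('a \<Rightarrow> 'b) \<Rightarrow> 'a word \<Rightarrow> 'b" where
  "eval_word K f w =
    foldr (\<lambda>(b, x) a. (if b then f x else inv\<^bsub>K\<^esub> (f x)) \<otimes>\<^bsub>K\<^esub> a) w \<one>\<^bsub>K\<^esub>"

text \<open>The homomorphism into \<open>K\<close> which extends a map \<open>f\<close> defined on the generators (and which sends
  a class of words to the common value of its members).\<close>

definition pres_lift :: "('b, 'm) monoid_scheme \<Rightarrow> ('a \<Rightarrow> 'b) \<Rightarrow> 'a word set \<Rightarrow> 'b" where
  "pres_lift K f A = the_elem (eval_word K f ` A)"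

lemma words_simps [simp]:
  "[] \<in> words X"
  "l # w \<in> words X \<longleftrightarrow> snd l \<in> X \<and> w \<in> words X"
  "u @ v \<in> words X \<longleftrightarrow> u \<in> words X \<and> v \<in> words X"
  by (auto simp: words_def)

lemma word_eq_words: "word_eq X R v w \<Longrightarrow> v \<in> words X \<and> w \<in> words X"
  by (induction rule: word_eq.induct) auto

lemma word_eq_context:
  "word_eq X R v w \<Longrightarrow> a \<in> words X \<Longrightarrow> b \<in> words X \<Longrightarrow> word_eq X R (a @ v @ b) (a @ w @ b)"
proof (induction rule: word_eq.induct)
  case (refl w)
  then show ?case by (intro word_eq.refl) auto
next
  case (cancel u v x c)
  then show ?case using word_eq.cancel[of "a @ u" X "v @ b" x R c] by simp
next
  case (rel l r u v)
  then show ?case using word_eq.rel[of l r R X "a @ u" "v @ b"] by simp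
qed (blast intro: word_eq.sym word_eq.trans)+

lemma word_eq_append:
  assumes "word_eq X R u u'" "word_eq X R v v'"
  shows "word_eq X R (u @ v) (u' @ v')"
proof -
  have "word_eq X R (u @ v) (u' @ v)"
    using word_eq_context[OF assms(1), of "[]" v] word_eq_words[OF assms(2)] by simp
  moreover have "word_eq X R (u' @ v) (u' @ v')"
    using word_eq_context[OF assms(2), of u' "[]"] word_eq_words[OF assms(1)] by simp
  ultimately show ?thesis by (rule word_eq.trans)
qed

lemma word_class_eq_iff:
  "v \<in> words X \<Longrightarrow> word_class X R v = word_class X R w \<longleftrightarrow> word_eq X R v w"
  unfolding word_class_def using word_eq.refl word_eq.sym word_eq.trans by blast

lemma word_class_mult:
  assumes "u \<in> words X" "v \<in> words X"
  shows "word_class X R u \<otimes>\<^bsub>presented_group X R\<^esub> word_class X R v = word_class X R (u @ v)"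
proof -
  have *: "word_class X R (a @ b) = word_class X R (u @ v)"
    if "a \<in> word_class X R u" "b \<in> word_class X R v" for a b
  proof -
    from that have "word_eq X R (u @ v) (a @ b)"
      by (auto simp: word_class_def intro: word_eq_append)
    then show ?thesis using word_class_eq_iff assms by (metis words_simps(3))
  qed
  have "u \<in> word_class X R u" "v \<in> word_class X R v"
    using assms by (auto simp: word_class_def intro: word_eq.refl)
  then have "(\<Union>a\<in>word_class X R u. \<Union>b\<in>word_class X R v. word_class X R (a @ b))
      = word_class X R (u @ v)"
    using * by blast
  then show ?thesis by (simp add: presented_group_def)
qed

lemma carrier_presented_group: "carrier (presented_group X R) = word_class X R ` words X"
  by (simp add: presented_group_def)

lemma one_presented_group: "\<one>\<^bsub>presented_group X R\<^esub> = word_class X R []"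
  by (simp add: presented_group_def)

lemma word_eq_inverse:
  "w \<in> words X \<Longrightarrow> word_eq X R (rev (map (\<lambda>(b, x). (\<not> b, x)) w) @ w) []"
proof (induction w)
  case Nil
  then show ?case by (simp add: word_eq.refl)
next
  case (Cons l w)
  obtain b x where l: "l = (b, x)" by (cases l)
  have w: "w \<in> words X" "x \<in> X" using Cons.prems l by auto
  let ?v = "rev (map (\<lambda>(b, x). (\<not> b, x)) w)"
  have v: "?v \<in> words X" using w(1) by (induction w) auto
  have "word_eq X R (?v @ [(\<not> b, x), (b, x)] @ w) (?v @ w)"
    using word_eq.cancel[OF v w, of R "\<not> b"] by simp
  then show ?case using Cons.IH[OF w(1)] l by (auto intro: word_eq.trans)
qed

lemma group_presented_group: "group (presented_group X R)"
proof (rule groupI)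
  fix A assume "A \<in> carrier (presented_group X R)"
  then obtain w where w: "w \<in> words X" "A = word_class X R w"
    by (auto simp: carrier_presented_group)
  let ?v = "rev (map (\<lambda>(b, x). (\<not> b, x)) w)"
  have v: "?v \<in> words X" using w(1) by (induction w) auto
  have "word_class X R (?v @ w) = word_class X R []"
    using word_class_eq_iff[of "?v @ w"] word_eq_inverse w v by auto
  then show "\<exists>B\<in>carrier (presented_group X R). B \<otimes>\<^bsub>presented_group X R\<^esub> A = \<one>\<^bsub>presented_group X R\<^esub>"
    using v w by (auto simp: carrier_presented_group one_presented_group word_class_mult
        intro!: bexI[of _ ?v])
qed (auto simp: carrier_presented_group one_presented_group word_class_mult)

lemma group_free_group: "group (free_group X)"
  by (simp add: free_group_def group_presented_group)

lemma (in group) eval_word_closed: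
  "f \<in> X \<rightarrow> carrier G \<Longrightarrow> w \<in> words X \<Longrightarrow> eval_word G f w \<in> carrier G"
  by (induction w) (auto simp: eval_word_def Pi_iff)

lemma (in group) eval_word_append:
  "f \<in> X \<rightarrow> carrier G \<Longrightarrow> u \<in> words X \<Longrightarrow> v \<in> words X \<Longrightarrow>
    eval_word G f (u @ v) = eval_word G f u \<otimes> eval_word G f v"
proof (induction u)
  case Nil
  then show ?case using eval_word_closed[of f X v] by (simp add: eval_word_def)
next
  case (Cons l u)
  obtain b x where l: "l = (b, x)" by (cases l)
  have step: "eval_word G f ((b, x) # w) = (if b then f x else inv (f x)) \<otimes> eval_word G f w" for w
    by (simp add: eval_word_def)
  have x: "f x \<in> carrier G" using Cons.prems l by auto
  show ?case
    using Cons eval_word_closed[of f X u] eval_word_closed[of f X v] x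
    by (auto simp: l step m_assoc)
qed

lemma (in group) eval_word_cong:
  assumes f: "f \<in> X \<rightarrow> carrier G"
    and R: "\<And>l r. (l, r) \<in> R \<Longrightarrow> l \<in> words X \<Longrightarrow> r \<in> words X \<Longrightarrow> eval_word G f l = eval_word G f r"
  shows "word_eq X R v w \<Longrightarrow> eval_word G f v = eval_word G f w"
proof (induction rule: word_eq.induct)
  case (cancel u v x b)
  have x: "f x \<in> carrier G" using f cancel by auto
  have "eval_word G f [(b, x), (\<not> b, x)] = \<one>"
    using x by (auto simp: eval_word_def)
  then show ?case
    using cancel eval_word_append[OF f] eval_word_closed[OF f]
    by (simp add: eval_word_append[OF f, of _ "(b, x) # (\<not> b, x) # v"]
        eval_word_append[OF f, of "[(b, x), (\<not> b, x)]" v, simplified])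
next
  case (rel l r u v)
  then show ?case using R[of l r] by (simp add: eval_word_append[OF f])
qed auto

lemma (in group) pres_lift_class:
  assumes "f \<in> X \<rightarrow> carrier G"
    and "\<And>l r. (l, r) \<in> R \<Longrightarrow> l \<in> words X \<Longrightarrow> r \<in> words X \<Longrightarrow> eval_word G f l = eval_word G f r"
    and w: "w \<in> words X"
  shows "pres_lift G f (word_class X R w) = eval_word G f w"
proof -
  have "eval_word G f ` word_class X R w = {eval_word G f w}"
    using eval_word_cong[OF assms(1,2)] word_eq.refl[OF w] by (auto simp: word_class_def)
  then show ?thesis by (simp add: pres_lift_def)
qed

lemma (in group) pres_lift_hom:
  assumes "f \<in> X \<rightarrow> carrier G"
    and "\<And>l r. (l, r) \<in> R \<Longrightarrow> l \<in> words X \<Longrightarrow> r \<in> words X \<Longrightarrow> eval_word G f l = eval_word G f r"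
  shows "pres_lift G f \<in> hom (presented_group X R) G"
  using assms
  by (auto simp: hom_def carrier_presented_group word_class_mult pres_lift_class[OF assms]
      eval_word_append eval_word_closed)

lemma (in group) pres_lift_generator:
  assumes "f \<in> X \<rightarrow> carrier G"
    and "\<And>l r. (l, r) \<in> R \<Longrightarrow> l \<in> words X \<Longrightarrow> r \<in> words X \<Longrightarrow> eval_word G f l = eval_word G f r"
    and "x \<in> X"
  shows "pres_lift G f (word_class X R [(True, x)]) = f x"
proof -
  have "f x \<in> carrier G" using assms by auto
  then show ?thesis
    using assms(3) by (simp add: pres_lift_class[OF assms(1,2)] eval_word_def)
qed


section \<open>Free products and sequential colimits\<close>

definition free_product :: "'i set \<Rightarrow> ('i \<Rightarrow> 'a monoid) \<Rightarrow> ('i \<times> 'a) word set monoid" where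
  "free_product I G = presented_group (SIGMA i:I. carrier (G i))
     {([(True, i, a), (True, i, b)], [(True, i, a \<otimes>\<^bsub>G i\<^esub> b)]) | i a b.
        i \<in> I \<and> a \<in> carrier (G i) \<and> b \<in> carrier (G i)}"

text \<open>The colimit of \<open>G 0 \<longrightarrow> G 1 \<longrightarrow> G 2 \<longrightarrow> \<dots>\<close> along \<open>f k : G k \<longrightarrow> G (k + 1)\<close>. The composite
  \<open>G k \<longrightarrow> G m\<close> is \<open>fold f [k..<m]\<close>.\<close>

definition colim_class :: "(nat \<Rightarrow> 'a monoid) \<Rightarrow> (nat \<Rightarrow> 'a \<Rightarrow> 'a) \<Rightarrow> nat \<Rightarrow> 'a \<Rightarrow> (nat \<times> 'a) set" where
  "colim_class G f k a = {(l, b). b \<in> carrier (G l) \<and>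
     (\<exists>m \<ge> max k l. fold f [k..<m] a = fold f [l..<m] b)}"

definition seq_colimit :: "(nat \<Rightarrow> 'a monoid) \<Rightarrow> (nat \<Rightarrow> 'a \<Rightarrow> 'a) \<Rightarrow> (nat \<times> 'a) set monoid" where
  "seq_colimit G f =
    \<lparr>carrier = {colim_class G f k a | k a. a \<in> carrier (G k)},
     monoid.mult = (\<lambda>A B. \<Union>(k, a)\<in>A. \<Union>(l, b)\<in>B.
       let m = max k l in colim_class G f m (fold f [k..<m] a \<otimes>\<^bsub>G m\<^esub> fold f [l..<m] b)),
     one = colim_class G f 0 \<one>\<^bsub>G 0\<^esub>\<rparr>"

lemma fold_upt_split: "k \<le> l \<Longrightarrow> l \<le> m \<Longrightarrow> fold f [l..<m] (fold f [k..<l] a) = fold f [k..<m] a"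
  by (metis fold_append comp_apply upt_add_eq_append le_add_diff_inverse)

context
  fixes G :: "nat \<Rightarrow> 'a monoid" and f :: "nat \<Rightarrow> 'a \<Rightarrow> 'a"
  assumes G: "\<And>k. group (G k)" and f: "\<And>k. f k \<in> hom (G k) (G (Suc k))"
begin

lemma colim_bond_hom: "k \<le> m \<Longrightarrow> fold f [k..<m] \<in> hom (G k) (G m)"
proof (induction m rule: dec_induct)
  case base
  then show ?case by (auto simp: hom_def)
next
  case (step m)
  then have "fold f [k..<Suc m] = f m \<circ> fold f [k..<m]" by simp
  then show ?case using step f Group.hom_compose by metis
qed

lemma colim_bond_closed: "k \<le> m \<Longrightarrow> a \<in> carrier (G k) \<Longrightarrow> fold f [k..<m] a \<in> carrier (G m)"
  using colim_bond_hom by (meson hom_in_carrier)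

lemma colim_class_eqI:
  assumes "k \<le> m" "l \<le> m" "fold f [k..<m] a = fold f [l..<m] b"
  shows "colim_class G f k a = colim_class G f l b"
proof -
  have *: "colim_class G f k a \<subseteq> colim_class G f l b"
    if kl: "k \<le> m" "l \<le> m" "fold f [k..<m] a = fold f [l..<m] b" for k l a b
  proof (clarsimp simp: colim_class_def)
    fix i c n
    assume n: "k \<le> n" "i \<le> n" "fold f [k..<n] a = fold f [i..<n] c"
    let ?N = "max m n"
    have "fold f [l..<?N] b = fold f [m..<?N] (fold f [l..<m] b)"
      using kl by (simp add: fold_upt_split)
    also have "\<dots> = fold f [k..<?N] a" using kl by (simp add: fold_upt_split flip: kl(3))
    also have "\<dots> = fold f [n..<?N] (fold f [k..<n] a)"
      using fold_upt_split[of k n ?N f a] n by simp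
    also have "\<dots> = fold f [i..<?N] c" using fold_upt_split[of i n ?N f c] n by simp
    finally show "\<exists>N\<ge>l. i \<le> N \<and> fold f [l..<N] b = fold f [i..<N] c"
      using kl n by (intro exI[of _ ?N]) auto
  qed
  show ?thesis using *[OF assms] *[OF assms(2,1) assms(3)[symmetric]] by auto
qed

lemma colim_class_eq_iff:
  assumes "b \<in> carrier (G l)"
  shows "colim_class G f k a = colim_class G f l b \<longleftrightarrow>
    (\<exists>m \<ge> max k l. fold f [k..<m] a = fold f [l..<m] b)"
proof
  assume eq: "colim_class G f k a = colim_class G f l b"
  have "(l, b) \<in> colim_class G f l b" using assms by (auto simp: colim_class_def)
  then show "\<exists>m \<ge> max k l. fold f [k..<m] a = fold f [l..<m] b"
    unfolding eq[symmetric] by (auto simp: colim_class_def)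
next
  assume "\<exists>m \<ge> max k l. fold f [k..<m] a = fold f [l..<m] b"
  then obtain m where "k \<le> m" "l \<le> m" "fold f [k..<m] a = fold f [l..<m] b" by auto
  then show "colim_class G f k a = colim_class G f l b" by (rule colim_class_eqI)
qed

lemma colim_class_bond: "k \<le> m \<Longrightarrow> colim_class G f m (fold f [k..<m] a) = colim_class G f k a"
  by (rule colim_class_eqI[of _ m]) auto

lemma colim_class_mult_max:
  assumes "a \<in> carrier (G k)" "b \<in> carrier (G l)"
  shows "colim_class G f k a \<otimes>\<^bsub>seq_colimit G f\<^esub> colim_class G f l b =
    colim_class G f (max k l)
      (fold f [k..<max k l] a \<otimes>\<^bsub>G (max k l)\<^esub> fold f [l..<max k l] b)"
    (is "_ = ?C k a l b")
proof -
  have up: "?C k a l b = colim_class G f m (fold f [k..<m] a \<otimes>\<^bsub>G m\<^esub> fold f [l..<m] b)"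
    if "a \<in> carrier (G k)" "b \<in> carrier (G l)" "k \<le> m" "l \<le> m" for k l m a b
  proof -
    let ?i = "max k l"
    have i: "?i \<le> m" using that by simp
    have "fold f [?i..<m] (fold f [k..<?i] a \<otimes>\<^bsub>G ?i\<^esub> fold f [l..<?i] b) =
        fold f [k..<m] a \<otimes>\<^bsub>G m\<^esub> fold f [l..<m] b"
      using that i hom_mult[OF colim_bond_hom[OF i]] colim_bond_closed
      by (simp add: fold_upt_split)
    then show ?thesis using colim_class_bond[OF i] by metis
  qed
  have *: "?C k' a' l' b' = ?C k a l b"
    if "(k', a') \<in> colim_class G f k a" "(l', b') \<in> colim_class G f l b" for k' a' l' b'
  proof -
    from that obtain m n where m: "k \<le> m" "k' \<le> m" "fold f [k..<m] a = fold f [k'..<m] a'"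
      and n: "l \<le> n" "l' \<le> n" "fold f [l..<n] b = fold f [l'..<n] b'"
      and ab: "a' \<in> carrier (G k')" "b' \<in> carrier (G l')"
      by (auto simp: colim_class_def)
    let ?N = "max m n"
    have "fold f [k..<?N] a = fold f [k'..<?N] a'"
      using m fold_upt_split[of k m ?N f a] fold_upt_split[of k' m ?N f a'] by simp
    moreover have "fold f [l..<?N] b = fold f [l'..<?N] b'"
      using n fold_upt_split[of l n ?N f b] fold_upt_split[of l' n ?N f b'] by simp
    ultimately show ?thesis
      using up[OF assms, of ?N] up[OF ab, of ?N] m n by simp
  qed
  have ne: "colim_class G f k a \<noteq> {}" "colim_class G f l b \<noteq> {}"
    using assms by (auto simp: colim_class_def)
  have "(\<Union>(k', a')\<in>colim_class G f k a. \<Union>(l', b')\<in>colim_class G f l b. ?C k' a' l' b')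
      = (\<Union>_\<in>colim_class G f k a. \<Union>_\<in>colim_class G f l b. ?C k a l b)"
    by (intro SUP_cong refl) (auto simp: * split_def intro!: SUP_cong)
  also have "\<dots> = ?C k a l b" using ne by simp
  finally have "(\<Union>(k', a')\<in>colim_class G f k a. \<Union>(l', b')\<in>colim_class G f l b. ?C k' a' l' b')
      = ?C k a l b" .
  then show ?thesis by (simp add: seq_colimit_def Let_def)
qed

lemma colim_class_mult:
  assumes "a \<in> carrier (G k)" "b \<in> carrier (G k)"
  shows "colim_class G f k a \<otimes>\<^bsub>seq_colimit G f\<^esub> colim_class G f k b = colim_class G f k (a \<otimes>\<^bsub>G k\<^esub> b)"
  using colim_class_mult_max[OF assms] by simp

lemma carrier_seq_colimit: "carrier (seq_colimit G f) = {colim_class G f k a | k a. a \<in> carrier (G k)}"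
  by (simp add: seq_colimit_def)

lemma one_seq_colimit: "\<one>\<^bsub>seq_colimit G f\<^esub> = colim_class G f k \<one>\<^bsub>G k\<^esub>"
proof -
  have "fold f [0..<k] \<one>\<^bsub>G 0\<^esub> = \<one>\<^bsub>G k\<^esub>"
    using hom_one[OF colim_bond_hom[of 0 k] G G] by simp
  then show ?thesis using colim_class_bond[of 0 k "\<one>\<^bsub>G 0\<^esub>"] by (simp add: seq_colimit_def)
qed

lemma colim_class_lift:
  "A \<in> carrier (seq_colimit G f) \<Longrightarrow> \<exists>k0. \<forall>k\<ge>k0. \<exists>a\<in>carrier (G k). A = colim_class G f k a"
proof -
  assume "A \<in> carrier (seq_colimit G f)"
  then obtain k a where a: "a \<in> carrier (G k)" "A = colim_class G f k a"
    by (auto simp: carrier_seq_colimit)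
  show ?thesis
  proof (intro exI[of _ k] allI impI)
    fix m assume "k \<le> m"
    then show "\<exists>b\<in>carrier (G m). A = colim_class G f m b"
      using a by (intro bexI[of _ "fold f [k..<m] a"]) (simp_all add: colim_class_bond colim_bond_closed)
  qed
qed

lemma colim_class_hom: "colim_class G f k \<in> hom (G k) (seq_colimit G f)"
  by (auto simp: hom_def colim_class_mult carrier_seq_colimit)

lemma group_seq_colimit: "group (seq_colimit G f)"
proof (rule groupI)
  fix A B assume AB: "A \<in> carrier (seq_colimit G f)" "B \<in> carrier (seq_colimit G f)"
  obtain k1 where k1: "\<forall>k\<ge>k1. \<exists>a\<in>carrier (G k). A = colim_class G f k a"
    using colim_class_lift[OF AB(1)] ..
  obtain k2 where k2: "\<forall>k\<ge>k2. \<exists>a\<in>carrier (G k). B = colim_class G f k a"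
    using colim_class_lift[OF AB(2)] ..
  define k where "k = max k1 k2"
  have k: "k1 \<le> k" "k2 \<le> k" by (auto simp: k_def)
  obtain a b where "a \<in> carrier (G k)" "A = colim_class G f k a"
      "b \<in> carrier (G k)" "B = colim_class G f k b"
    using k1[rule_format, of k] k2[rule_format, of k] k by blast
  then show "A \<otimes>\<^bsub>seq_colimit G f\<^esub> B \<in> carrier (seq_colimit G f)"
    using group.is_monoid[OF G] by (auto simp: colim_class_mult carrier_seq_colimit intro!: monoid.m_closed)
next
  fix A B C assume ABC: "A \<in> carrier (seq_colimit G f)" "B \<in> carrier (seq_colimit G f)"
    "C \<in> carrier (seq_colimit G f)"
  obtain k1 where k1: "\<forall>k\<ge>k1. \<exists>a\<in>carrier (G k). A = colim_class G f k a"
    using colim_class_lift[OF ABC(1)] ..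
  obtain k2 where k2: "\<forall>k\<ge>k2. \<exists>a\<in>carrier (G k). B = colim_class G f k a"
    using colim_class_lift[OF ABC(2)] ..
  obtain k3 where k3: "\<forall>k\<ge>k3. \<exists>a\<in>carrier (G k). C = colim_class G f k a"
    using colim_class_lift[OF ABC(3)] ..
  define k where "k = max k1 (max k2 k3)"
  have k: "k1 \<le> k" "k2 \<le> k" "k3 \<le> k" by (auto simp: k_def)
  obtain a b c where "a \<in> carrier (G k)" "A = colim_class G f k a"
      "b \<in> carrier (G k)" "B = colim_class G f k b"
      "c \<in> carrier (G k)" "C = colim_class G f k c"
    using k1[rule_format, of k] k2[rule_format, of k] k3[rule_format, of k] k
    by blast
  then show "A \<otimes>\<^bsub>seq_colimit G f\<^esub> B \<otimes>\<^bsub>seq_colimit G f\<^esub> C =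
      A \<otimes>\<^bsub>seq_colimit G f\<^esub> (B \<otimes>\<^bsub>seq_colimit G f\<^esub> C)"
    using group.is_monoid[OF G] by (simp add: colim_class_mult monoid.m_closed monoid.m_assoc)
next
  show "\<one>\<^bsub>seq_colimit G f\<^esub> \<in> carrier (seq_colimit G f)"
    using group.is_monoid[OF G] unfolding one_seq_colimit[of 0] carrier_seq_colimit
    by (auto intro!: monoid.one_closed)
next
  fix A assume "A \<in> carrier (seq_colimit G f)"
  then obtain k a where a: "a \<in> carrier (G k)" "A = colim_class G f k a"
    by (auto simp: carrier_seq_colimit)
  show "\<one>\<^bsub>seq_colimit G f\<^esub> \<otimes>\<^bsub>seq_colimit G f\<^esub> A = A"
    unfolding one_seq_colimit[of k] using a group.is_monoid[OF G]
    by (simp add: colim_class_mult monoid.one_closed monoid.l_one)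
  show "\<exists>B\<in>carrier (seq_colimit G f). B \<otimes>\<^bsub>seq_colimit G f\<^esub> A = \<one>\<^bsub>seq_colimit G f\<^esub>"
    unfolding one_seq_colimit[of k] using a group.inv_closed[OF G a(1)] group.l_inv[OF G a(1)]
    by (intro bexI[of _ "colim_class G f k (inv\<^bsub>G k\<^esub> a)"])
      (auto simp: colim_class_mult carrier_seq_colimit)
qed

end


section \<open>The groups \<open>\<H>\<close> and \<open>\<F>\<close>\<close>

definition group_H :: "nat word set monoid" where
  "group_H = presented_group {i. 1 \<le> i}
     {([(True, i)], comm_word (2 * i) (2 * i + 1)) | i. 1 \<le> i}"

text \<open>\<open>Y x j\<close> and \<open>Z x j\<close> are the new symbols \<open>y\<^bsub>x,j\<^esub>\<close> and \<open>z\<^bsub>x,j\<^esub>\<close> belonging to the generator \<open>x\<close> of the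
  previous stage. Sequences \<open>(n\<^sub>1, n\<^sub>2, \<dots>)\<close> are indexed from 0, so that \<open>n k\<close> is \<open>n\<^bsub>k+1\<^esub>\<close>.\<close>

datatype symb = Base | Y symb nat | Z symb nat

primrec stage_gens :: "(nat \<Rightarrow> nat) \<Rightarrow> nat \<Rightarrow> symb set" where
  "stage_gens n 0 = {Base}"
| "stage_gens n (Suc k) = (\<Union>x\<in>stage_gens n k. \<Union>j\<in>{1..n k}. {Y x j, Z x j})"

definition stage :: "(nat \<Rightarrow> nat) \<Rightarrow> nat \<Rightarrow> symb word set monoid" where
  "stage n k = free_group (stage_gens n k)"

definition stage_map :: "(nat \<Rightarrow> nat) \<Rightarrow> nat \<Rightarrow> symb word set \<Rightarrow> symb word set" where
  "stage_map n k = pres_lift (stage n (Suc k))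
     (\<lambda>x. word_class (stage_gens n (Suc k)) {}
        (concat (map (\<lambda>j. comm_word (Y x j) (Z x j)) [1..<Suc (n k)])))"

definition group_F_seq :: "(nat \<Rightarrow> nat) \<Rightarrow> (nat \<times> symb word set) set monoid" where
  "group_F_seq n = seq_colimit (stage n) (stage_map n)"

definition group_F :: "((nat \<Rightarrow> nat) \<times> (nat \<times> symb word set) set) word set monoid" where
  "group_F = free_product {n. mono n \<and> (\<forall>k. 1 \<le> n k)} group_F_seq"

lemma stage_relator_words:
  assumes "x \<in> stage_gens n k"
  shows "concat (map (\<lambda>j. comm_word (Y x j) (Z x j)) [1..<Suc (n k)]) \<in> words (stage_gens n (Suc k))"
proof -
  have "concat (map (\<lambda>j. comm_word (Y x j) (Z x j)) js) \<in> words (stage_gens n (Suc k))"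
    if "set js \<subseteq> {1..n k}" for js
    using that assms by (induction js) (auto simp: comm_word_def)
  moreover have "set [1..<Suc (n k)] \<subseteq> {1..n k}" by auto
  ultimately show ?thesis by blast
qed

lemma group_stage: "group (stage n k)"
  by (simp add: stage_def group_free_group)

lemma stage_map_hom: "stage_map n k \<in> hom (stage n k) (stage n (Suc k))"
  unfolding stage_map_def stage_def[of n k] free_group_def
  by (rule group.pres_lift_hom[OF group_stage])
    (use stage_relator_words in \<open>auto simp: stage_def free_group_def carrier_presented_group simp del: stage_gens.simps\<close>)

lemma stage_map_generator:
  "x \<in> stage_gens n k \<Longrightarrow> stage_map n k (word_class (stage_gens n k) {} [(True, x)]) =
    word_class (stage_gens n (Suc k)) {}
      (concat (map (\<lambda>j. comm_word (Y x j) (Z x j)) [1..<Suc (n k)]))"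
  unfolding stage_map_def
  by (rule group.pres_lift_generator[OF group_stage])
    (use stage_relator_words in \<open>auto simp: stage_def free_group_def carrier_presented_group simp del: stage_gens.simps\<close>)

lemma group_group_H: "group group_H"
  by (simp add: group_H_def group_presented_group)

lemma group_group_F_seq: "group (group_F_seq n)"
  unfolding group_F_seq_def by (rule group_seq_colimit[of "stage n" "stage_map n", OF group_stage stage_map_hom])

lemma group_group_F: "group group_F"
  by (simp add: group_F_def free_product_def group_presented_group)


section \<open>Localization\<close>

text \<open>For a prime \<open>p\<close>, this is being \<open>P\<close>-local for the set \<open>P\<close> of all primes other than \<open>p\<close>.\<close>

definition P_local :: "nat \<Rightarrow> ('a, 'm) monoid_scheme \<Rightarrow> bool" where
  "P_local p K \<longleftrightarrow> group K \<and> bij_betw (\<lambda>x. x [^]\<^bsub>K\<^esub> p) (carrier K) (carrier K)"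

definition uniquely_factors ::
    "('g, 'm) monoid_scheme \<Rightarrow> ('l, 'n) monoid_scheme \<Rightarrow> ('g \<Rightarrow> 'l) \<Rightarrow> ('k, 'o) monoid_scheme \<Rightarrow> bool" where
  "uniquely_factors G L \<eta> K \<longleftrightarrow>
    (\<forall>\<psi>\<in>hom G K. \<exists>!\<phi>. \<phi> \<in> hom L K \<and> \<phi> \<in> extensional (carrier L) \<and>
       (\<forall>g\<in>carrier G. \<phi> (\<eta> g) = \<psi> g))"

datatype 'g pterm = Elem 'g | Mult "'g pterm" "'g pterm" | Inv "'g pterm" | Root "'g pterm"

text \<open>The universal property. HOL cannot quantify over all types inside a definition, so the
  test groups \<open>K\<close> range over the type of \<open>L\<close> itself and over a type that is large enough to carry some
  \<open>P\<close>-localization of \<open>G\<close> (formal terms in elements of \<open>G\<close> and \<open>p\<close>-th roots, modulo an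
  equivalence). This loses nothing: the lemmas \<open>P_localization_universal\<close> and
  \<open>P_localization_exists\<close> below show that the property then holds for groups \<open>K\<close> of any type, and
  that every group has a localization in this sense.\<close>

definition P_localization ::
    "nat \<Rightarrow> ('g, 'm) monoid_scheme \<Rightarrow> 'l monoid \<Rightarrow> ('g \<Rightarrow> 'l) \<Rightarrow> bool" where
  "P_localization p G L \<eta> \<longleftrightarrow> P_local p L \<and> \<eta> \<in> hom G L \<and>
    (\<forall>K :: 'l monoid. P_local p K \<longrightarrow> uniquely_factors G L \<eta> K) \<and>
    (\<forall>K :: 'g pterm set monoid. P_local p K \<longrightarrow> uniquely_factors G L \<eta> K)"


subsection \<open>Existence, and the universal property for arbitrary types\<close>

inductive_set pterms :: "('g, 'm) monoid_scheme \<Rightarrow> 'g pterm set" for G where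
  "g \<in> carrier G \<Longrightarrow> Elem g \<in> pterms G"
| "s \<in> pterms G \<Longrightarrow> t \<in> pterms G \<Longrightarrow> Mult s t \<in> pterms G"
| "t \<in> pterms G \<Longrightarrow> Inv t \<in> pterms G"
| "t \<in> pterms G \<Longrightarrow> Root t \<in> pterms G"

primrec tpow :: "('g, 'm) monoid_scheme \<Rightarrow> 'g pterm \<Rightarrow> nat \<Rightarrow> 'g pterm" where
  "tpow G t 0 = Elem \<one>\<^bsub>G\<^esub>"
| "tpow G t (Suc n) = Mult (tpow G t n) t"

inductive pterm_eq :: "nat \<Rightarrow> ('g, 'm) monoid_scheme \<Rightarrow> 'g pterm \<Rightarrow> 'g pterm \<Rightarrow> bool"
  for p G where
  refl: "t \<in> pterms G \<Longrightarrow> pterm_eq p G t t"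
| sym: "pterm_eq p G s t \<Longrightarrow> pterm_eq p G t s"
| trans: "pterm_eq p G s t \<Longrightarrow> pterm_eq p G t u \<Longrightarrow> pterm_eq p G s u"
| Mult: "pterm_eq p G s s' \<Longrightarrow> pterm_eq p G t t' \<Longrightarrow> pterm_eq p G (Mult s t) (Mult s' t')"
| Inv: "pterm_eq p G t t' \<Longrightarrow> pterm_eq p G (Inv t) (Inv t')"
| Root: "pterm_eq p G t t' \<Longrightarrow> pterm_eq p G (Root t) (Root t')"
| assoc: "s \<in> pterms G \<Longrightarrow> t \<in> pterms G \<Longrightarrow> u \<in> pterms G \<Longrightarrow>
    pterm_eq p G (Mult (Mult s t) u) (Mult s (Mult t u))"
| one: "t \<in> pterms G \<Longrightarrow> pterm_eq p G (Mult (Elem \<one>\<^bsub>G\<^esub>) t) t"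
| inv: "t \<in> pterms G \<Longrightarrow> pterm_eq p G (Mult (Inv t) t) (Elem \<one>\<^bsub>G\<^esub>)"
| Elem: "g \<in> carrier G \<Longrightarrow> h \<in> carrier G \<Longrightarrow> pterm_eq p G (Mult (Elem g) (Elem h)) (Elem (g \<otimes>\<^bsub>G\<^esub> h))"
| pow_Root: "t \<in> pterms G \<Longrightarrow> pterm_eq p G (tpow G (Root t) p) t"
| Root_pow: "t \<in> pterms G \<Longrightarrow> pterm_eq p G (Root (tpow G t p)) t"

definition pterm_class :: "nat \<Rightarrow> ('g, 'm) monoid_scheme \<Rightarrow> 'g pterm \<Rightarrow> 'g pterm set" where
  "pterm_class p G t = {s. pterm_eq p G t s}"

definition free_localization :: "nat \<Rightarrow> ('g, 'm) monoid_scheme \<Rightarrow> 'g pterm set monoid" where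
  "free_localization p G =
    \<lparr>carrier = pterm_class p G ` pterms G,
     monoid.mult = (\<lambda>A B. \<Union>a\<in>A. \<Union>b\<in>B. pterm_class p G (Mult a b)),
     one = pterm_class p G (Elem \<one>\<^bsub>G\<^esub>)\<rparr>"

primrec pterm_eval :: "nat \<Rightarrow> ('k, 'n) monoid_scheme \<Rightarrow> ('g \<Rightarrow> 'k) \<Rightarrow> 'g pterm \<Rightarrow> 'k" where
  "pterm_eval p K \<psi> (Elem g) = \<psi> g"
| "pterm_eval p K \<psi> (Mult s t) = pterm_eval p K \<psi> s \<otimes>\<^bsub>K\<^esub> pterm_eval p K \<psi> t"
| "pterm_eval p K \<psi> (Inv t) = inv\<^bsub>K\<^esub> (pterm_eval p K \<psi> t)"
| "pterm_eval p K \<psi> (Root t) = inv_into (carrier K) (\<lambda>x. x [^]\<^bsub>K\<^esub> p) (pterm_eval p K \<psi> t)"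

context
  fixes G :: "('g, 'm) monoid_scheme" and p :: nat
  assumes G: "group G"
begin

interpretation G: group G by (rule G)

lemma tpow_pterms: "t \<in> pterms G \<Longrightarrow> tpow G t n \<in> pterms G"
  by (induction n) (auto intro: pterms.intros)

lemma pterm_eq_pterms: "pterm_eq p G s t \<Longrightarrow> s \<in> pterms G \<and> t \<in> pterms G"
  by (induction rule: pterm_eq.induct) (auto intro: pterms.intros tpow_pterms)

lemma pterm_class_eq_iff:
  "s \<in> pterms G \<Longrightarrow> pterm_class p G s = pterm_class p G t \<longleftrightarrow> pterm_eq p G s t"
  unfolding pterm_class_def using pterm_eq.refl pterm_eq.sym pterm_eq.trans by blast

lemma pterm_class_mult:
  assumes "s \<in> pterms G" "t \<in> pterms G"
  shows "pterm_class p G s \<otimes>\<^bsub>free_localization p G\<^esub> pterm_class p G t = pterm_class p G (Mult s t)"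
proof -
  have *: "pterm_class p G (Mult a b) = pterm_class p G (Mult s t)"
    if "a \<in> pterm_class p G s" "b \<in> pterm_class p G t" for a b
  proof -
    from that have "pterm_eq p G (Mult s t) (Mult a b)"
      by (auto simp: pterm_class_def intro: pterm_eq.Mult)
    then show ?thesis using pterm_class_eq_iff assms by (metis pterms.intros(2))
  qed
  have "s \<in> pterm_class p G s" "t \<in> pterm_class p G t"
    using assms by (auto simp: pterm_class_def intro: pterm_eq.refl)
  then have "(\<Union>a\<in>pterm_class p G s. \<Union>b\<in>pterm_class p G t. pterm_class p G (Mult a b))
      = pterm_class p G (Mult s t)"
    using * by blast
  then show ?thesis by (simp add: free_localization_def)
qed

lemma carrier_free_localization: "carrier (free_localization p G) = pterm_class p G ` pterms G"
  by (simp add: free_localization_def)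

lemma one_free_localization: "\<one>\<^bsub>free_localization p G\<^esub> = pterm_class p G (Elem \<one>\<^bsub>G\<^esub>)"
  by (simp add: free_localization_def)

lemma group_free_localization: "group (free_localization p G)"
proof (rule groupI)
  fix A assume "A \<in> carrier (free_localization p G)"
  then obtain t where t: "t \<in> pterms G" "A = pterm_class p G t"
    by (auto simp: carrier_free_localization)
  show "\<one>\<^bsub>free_localization p G\<^esub> \<otimes>\<^bsub>free_localization p G\<^esub> A = A"
    using t by (simp add: one_free_localization pterm_class_mult pterm_class_eq_iff
        pterms.intros pterm_eq.one)
  show "\<exists>B\<in>carrier (free_localization p G). B \<otimes>\<^bsub>free_localization p G\<^esub> A = \<one>\<^bsub>free_localization p G\<^esub>"
    using t by (auto simp: one_free_localization carrier_free_localization pterm_class_mult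
        pterm_class_eq_iff pterms.intros pterm_eq.inv intro!: bexI[of _ "Inv t"])
next
  fix A B C
  assume "A \<in> carrier (free_localization p G)" "B \<in> carrier (free_localization p G)"
    "C \<in> carrier (free_localization p G)"
  then obtain s t u where "s \<in> pterms G" "A = pterm_class p G s" "t \<in> pterms G" "B = pterm_class p G t"
    "u \<in> pterms G" "C = pterm_class p G u"
    by (auto simp: carrier_free_localization)
  then show "A \<otimes>\<^bsub>free_localization p G\<^esub> B \<otimes>\<^bsub>free_localization p G\<^esub> C =
      A \<otimes>\<^bsub>free_localization p G\<^esub> (B \<otimes>\<^bsub>free_localization p G\<^esub> C)"
    by (simp add: pterm_class_mult pterm_class_eq_iff pterms.intros pterm_eq.assoc)
qed (auto simp: carrier_free_localization one_free_localization pterm_class_mult pterms.intros)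

lemma pterm_class_pow:
  "t \<in> pterms G \<Longrightarrow> pterm_class p G t [^]\<^bsub>free_localization p G\<^esub> (n::nat) = pterm_class p G (tpow G t n)"
  by (induction n) (auto simp: one_free_localization pterm_class_mult tpow_pterms nat_pow_def)

lemma tpow_cong: "pterm_eq p G s t \<Longrightarrow> pterm_eq p G (tpow G s n) (tpow G t n)"
  by (induction n) (auto intro: pterm_eq.refl pterm_eq.Mult pterms.intros)

lemma P_local_free_localization: "P_local p (free_localization p G)"
  unfolding P_local_def bij_betw_def
proof (intro conjI group_free_localization)
  show "inj_on (\<lambda>x. x [^]\<^bsub>free_localization p G\<^esub> p) (carrier (free_localization p G))"
  proof (rule inj_onI, clarsimp simp: carrier_free_localization pterm_class_pow pterm_class_eq_iff tpow_pterms)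
    fix s t assume st: "s \<in> pterms G" "t \<in> pterms G" "pterm_eq p G (tpow G s p) (tpow G t p)"
    then have "pterm_eq p G (Root (tpow G s p)) (Root (tpow G t p))" by (rule_tac pterm_eq.Root)
    then show "pterm_eq p G s t" using st pterm_eq.Root_pow pterm_eq.sym pterm_eq.trans by meson
  qed
  have "\<exists>s\<in>pterms G. pterm_class p G t = pterm_class p G (tpow G s p)" if "t \<in> pterms G" for t
    using that by (intro bexI[of _ "Root t"])
      (auto simp: pterm_class_eq_iff pterms.intros intro: pterm_eq.sym[OF pterm_eq.pow_Root])
  then show "(\<lambda>x. x [^]\<^bsub>free_localization p G\<^esub> p) ` carrier (free_localization p G)
      = carrier (free_localization p G)"
    by (auto simp: carrier_free_localization pterm_class_pow tpow_pterms image_iff)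
qed

lemma free_localization_unit_hom: "(\<lambda>g. pterm_class p G (Elem g)) \<in> hom G (free_localization p G)"
  by (auto simp: hom_def carrier_free_localization pterm_class_mult pterm_class_eq_iff
      pterms.intros intro!: pterm_eq.sym[OF pterm_eq.Elem])

lemma P_local_root:
  assumes "P_local p K" "x \<in> carrier K"
  defines "y \<equiv> inv_into (carrier K) (\<lambda>x. x [^]\<^bsub>K\<^esub> p) x"
  shows "y \<in> carrier K" "y [^]\<^bsub>K\<^esub> p = x"
  using assms(1,2) inv_into_into[of x "\<lambda>x. x [^]\<^bsub>K\<^esub> p" "carrier K"]
    f_inv_into_f[of x "\<lambda>x. x [^]\<^bsub>K\<^esub> p" "carrier K"]
  by (auto simp: P_local_def bij_betw_def y_def)

lemma P_local_root_pow:
  assumes "P_local p K" "x \<in> carrier K"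
  shows "inv_into (carrier K) (\<lambda>x. x [^]\<^bsub>K\<^esub> p) (x [^]\<^bsub>K\<^esub> p) = x"
  using assms inv_into_f_f[of "\<lambda>x. x [^]\<^bsub>K\<^esub> p" "carrier K" x]
  by (auto simp: P_local_def bij_betw_def)

lemma pterm_eval_closed:
  assumes K: "P_local p K" and \<psi>: "\<psi> \<in> hom G K"
  shows "t \<in> pterms G \<Longrightarrow> pterm_eval p K \<psi> t \<in> carrier K"
proof -
  interpret K: group K using K by (simp add: P_local_def)
  show "t \<in> pterms G \<Longrightarrow> pterm_eval p K \<psi> t \<in> carrier K"
    by (induction rule: pterms.induct) (use \<psi> P_local_root[OF K] in \<open>auto simp: hom_def\<close>)
qed

lemma pterm_eval_tpow:
  assumes K: "P_local p K" and \<psi>: "\<psi> \<in> hom G K"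
  shows "pterm_eval p K \<psi> (tpow G t n) = pterm_eval p K \<psi> t [^]\<^bsub>K\<^esub> n"
proof -
  interpret K: group K using K by (simp add: P_local_def)
  show ?thesis by (induction n) (use hom_one[OF \<psi> G K.is_group] in auto)
qed

lemma pterm_eval_cong:
  assumes K: "P_local p K" and \<psi>: "\<psi> \<in> hom G K"
  shows "pterm_eq p G s t \<Longrightarrow> pterm_eval p K \<psi> s = pterm_eval p K \<psi> t"
proof -
  interpret K: group K using K by (simp add: P_local_def)
  have \<psi>1: "\<psi> \<one>\<^bsub>G\<^esub> = \<one>\<^bsub>K\<^esub>" using hom_one[OF \<psi> G K.is_group] .
  show "pterm_eq p G s t \<Longrightarrow> pterm_eval p K \<psi> s = pterm_eval p K \<psi> t"
  proof (induction rule: pterm_eq.induct)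
    case (pow_Root t)
    then show ?case
      using P_local_root[OF K pterm_eval_closed[OF K \<psi>]] by (simp add: pterm_eval_tpow[OF K \<psi>])
  next
    case (Root_pow t)
    then show ?case
      using P_local_root_pow[OF K pterm_eval_closed[OF K \<psi>]] by (simp add: pterm_eval_tpow[OF K \<psi>])
  qed (use \<psi> pterm_eval_closed[OF K \<psi>] in \<open>auto simp: \<psi>1 hom_mult K.m_assoc\<close>)
qed

lemma hom_free_localization_unique:
  assumes K: "P_local p K" and \<phi>: "\<phi> \<in> hom (free_localization p G) K" "\<phi>' \<in> hom (free_localization p G) K"
    and eq: "\<And>g. g \<in> carrier G \<Longrightarrow> \<phi> (pterm_class p G (Elem g)) = \<phi>' (pterm_class p G (Elem g))"
    and A: "A \<in> carrier (free_localization p G)"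
  shows "\<phi> A = \<phi>' A"
proof -
  let ?L = "free_localization p G"
  interpret K: group K using K by (simp add: P_local_def)
  interpret L: group ?L by (rule group_free_localization)
  interpret h: group_hom ?L K \<phi> by unfold_locales (rule \<phi>)
  interpret h': group_hom ?L K \<phi>' by unfold_locales (rule \<phi>)
  have "\<phi> (pterm_class p G t) = \<phi>' (pterm_class p G t)" if "t \<in> pterms G" for t
    using that
  proof (induction rule: pterms.induct)
    case (2 s t)
    then have "pterm_class p G s \<in> carrier ?L" "pterm_class p G t \<in> carrier ?L"
      by (auto simp: carrier_free_localization)
    then show ?case using 2 by (simp flip: pterm_class_mult)
  next
    case (3 t)
    then have t: "pterm_class p G t \<in> carrier ?L" "pterm_class p G (Inv t) \<in> carrier ?L"
      by (auto simp: carrier_free_localization intro: pterms.intros)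
    have "pterm_class p G (Inv t) \<otimes>\<^bsub>?L\<^esub> pterm_class p G t = \<one>\<^bsub>?L\<^esub>"
      using 3 by (simp add: pterm_class_mult pterm_class_eq_iff one_free_localization
          pterms.intros pterm_eq.inv)
    then have "pterm_class p G (Inv t) = inv\<^bsub>?L\<^esub> pterm_class p G t"
      using t L.inv_equality by metis
    then show ?case using 3 t by simp
  next
    case (4 t)
    let ?r = "pterm_class p G (Root t)"
    have r: "?r \<in> carrier ?L" using 4 by (auto simp: carrier_free_localization intro: pterms.intros)
    have "?r [^]\<^bsub>?L\<^esub> p = pterm_class p G t"
      using 4 by (simp add: pterm_class_pow pterm_class_eq_iff pterms.intros tpow_pterms pterm_eq.pow_Root)
    then have "\<phi> ?r [^]\<^bsub>K\<^esub> p = \<phi>' ?r [^]\<^bsub>K\<^esub> p"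
      using 4 r by (metis h.hom_nat_pow h'.hom_nat_pow)
    moreover have "inj_on (\<lambda>x. x [^]\<^bsub>K\<^esub> p) (carrier K)"
      using K by (simp add: P_local_def bij_betw_def)
    ultimately show ?case
      using h.hom_closed[OF r] h'.hom_closed[OF r] by (rule_tac inj_onD)
  qed (use eq in auto)
  then show ?thesis using A by (auto simp: carrier_free_localization)
qed

lemma free_localization_uniquely_factors:
  assumes K: "P_local p K"
  shows "uniquely_factors G (free_localization p G) (\<lambda>g. pterm_class p G (Elem g)) K"
  unfolding uniquely_factors_def
proof
  fix \<psi> assume \<psi>: "\<psi> \<in> hom G K"
  let ?L = "free_localization p G"
  interpret L: group ?L by (rule group_free_localization)
  define \<phi>0 where "\<phi>0 A = the_elem (pterm_eval p K \<psi> ` A)" for A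
  define \<phi> where "\<phi> = restrict \<phi>0 (carrier ?L)"
  have \<phi>0: "\<phi>0 (pterm_class p G t) = pterm_eval p K \<psi> t" if t: "t \<in> pterms G" for t
  proof -
    have "pterm_eval p K \<psi> ` pterm_class p G t = {pterm_eval p K \<psi> t}"
      using pterm_eval_cong[OF K \<psi>] pterm_eq.refl[OF t] by (auto simp: pterm_class_def)
    then show ?thesis by (simp add: \<phi>0_def)
  qed
  have "\<phi>0 \<in> hom ?L K"
    using pterm_eval_closed[OF K \<psi>]
    by (auto simp: hom_def carrier_free_localization pterm_class_mult \<phi>0 pterms.intros)
  then have hom: "\<phi> \<in> hom ?L K" by (rule L.hom_restrict) (simp add: \<phi>_def)
  have unit: "\<phi> (pterm_class p G (Elem g)) = \<psi> g" if "g \<in> carrier G" for g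
    using that by (simp add: \<phi>_def carrier_free_localization \<phi>0 pterms.intros)
  show "\<exists>!\<phi>. \<phi> \<in> hom ?L K \<and> \<phi> \<in> extensional (carrier ?L) \<and>
      (\<forall>g\<in>carrier G. \<phi> (pterm_class p G (Elem g)) = \<psi> g)"
  proof (rule ex1I[of _ \<phi>])
    fix \<phi>' assume \<phi>': "\<phi>' \<in> hom ?L K \<and> \<phi>' \<in> extensional (carrier ?L) \<and>
      (\<forall>g\<in>carrier G. \<phi>' (pterm_class p G (Elem g)) = \<psi> g)"
    show "\<phi>' = \<phi>"
    proof (rule extensionalityI)
      show "\<phi>' \<in> extensional (carrier ?L)" using \<phi>' by simp
      show "\<phi> \<in> extensional (carrier ?L)" by (simp add: \<phi>_def)
      show "\<phi>' A = \<phi> A" if "A \<in> carrier ?L" for A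
        by (rule hom_free_localization_unique[OF K _ hom _ that]) (simp_all add: \<phi>' unit)
    qed
  qed (use hom unit in \<open>auto simp: \<phi>_def\<close>)
qed

end

lemma P_localization_exists:
  "group G \<Longrightarrow> P_localization p G (free_localization p G) (\<lambda>g. pterm_class p G (Elem g))"
  unfolding P_localization_def
  by (auto intro: P_local_free_localization free_localization_unit_hom free_localization_uniquely_factors)

lemma ex1_unique_eq: "\<exists>!x. P x \<Longrightarrow> P a \<Longrightarrow> P b \<Longrightarrow> a = b"
  by blast

lemma uniquely_factorsE:
  assumes "uniquely_factors G L \<eta> K" "\<psi> \<in> hom G K"
  obtains \<phi> where "\<phi> \<in> hom L K" "\<And>g. g \<in> carrier G \<Longrightarrow> \<phi> (\<eta> g) = \<psi> g"
  using ex1_implies_ex[OF bspec[OF assms(1)[unfolded uniquely_factors_def] assms(2)]] by auto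

lemma uniquely_factorsD:
  assumes "uniquely_factors G L \<eta> K" "group L" "\<phi> \<in> hom L K" "\<phi>' \<in> hom L K" "\<eta> \<in> hom G L"
    and eq: "\<And>g. g \<in> carrier G \<Longrightarrow> \<phi> (\<eta> g) = \<phi>' (\<eta> g)" and x: "x \<in> carrier L"
  shows "\<phi> x = \<phi>' x"
proof -
  interpret L: group L by fact
  let ?\<psi> = "\<phi> \<circ> \<eta>"
  have \<psi>: "?\<psi> \<in> hom G K" by (rule Group.hom_compose[OF assms(5,3)])
  have r: "restrict \<phi> (carrier L) \<in> hom L K" "restrict \<phi>' (carrier L) \<in> hom L K"
    using L.hom_restrict[OF assms(3)] L.hom_restrict[OF assms(4)] by simp_all
  have \<eta>: "\<eta> g \<in> carrier L" if "g \<in> carrier G" for g using assms(5) that by (rule hom_in_carrier)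
  let ?P = "\<lambda>\<chi>. \<chi> \<in> hom L K \<and> \<chi> \<in> extensional (carrier L) \<and> (\<forall>g\<in>carrier G. \<chi> (\<eta> g) = ?\<psi> g)"
  have "\<exists>!\<chi>. ?P \<chi>" using assms(1) \<psi> unfolding uniquely_factors_def by (rule bspec)
  moreover have "?P (restrict \<phi> (carrier L))" using r \<eta> by simp
  moreover have "?P (restrict \<phi>' (carrier L))" using r \<eta> eq by simp
  ultimately have "restrict \<phi> (carrier L) = restrict \<phi>' (carrier L)" by (rule ex1_unique_eq[of ?P])
  then show ?thesis using x by (metis restrict_apply')
qed

lemma P_localization_universal:
  assumes G: "group G" and loc: "P_localization p G L \<eta>" and K: "P_local p K"
  shows "uniquely_factors G L \<eta> K"
proof -
  let ?M = "free_localization p G" and ?\<mu> = "\<lambda>g. pterm_class p G (Elem g)"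
  have L1: "P_local p L" and \<eta>: "\<eta> \<in> hom G L"
    using loc by (simp_all add: P_localization_def)
  have uL: "uniquely_factors G L \<eta> L" and uM: "uniquely_factors G L \<eta> ?M"
    using loc L1 P_local_free_localization[OF G, of p] unfolding P_localization_def by blast+
  have L: "group L" using L1 by (simp add: P_local_def)
  interpret L: group L by (rule L)
  interpret M: group ?M by (rule group_free_localization[OF G])
  note \<mu> = free_localization_unit_hom[OF G, of p]
  obtain a where a: "a \<in> hom L ?M" "\<And>g. g \<in> carrier G \<Longrightarrow> a (\<eta> g) = ?\<mu> g"
    by (rule uniquely_factorsE[OF uM \<mu>]) blast
  obtain b where b: "b \<in> hom ?M L" "\<And>g. g \<in> carrier G \<Longrightarrow> b (?\<mu> g) = \<eta> g"
    by (rule uniquely_factorsE[OF free_localization_uniquely_factors[OF G L1] \<eta>]) blast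
  have id: "id \<in> hom L L" by (auto simp: hom_def)
  have "(b \<circ> a) x = id x" if "x \<in> carrier L" for x
    by (rule uniquely_factorsD[OF uL L Group.hom_compose[OF a(1) b(1)] id \<eta> _ that]) (simp add: a b)
  then have ba: "b (a x) = x" if "x \<in> carrier L" for x using that by simp
  show ?thesis
    unfolding uniquely_factors_def
  proof
    fix \<psi> assume \<psi>: "\<psi> \<in> hom G K"
    obtain c where c: "c \<in> hom ?M K" "\<And>g. g \<in> carrier G \<Longrightarrow> c (?\<mu> g) = \<psi> g"
      by (rule uniquely_factorsE[OF free_localization_uniquely_factors[OF G K] \<psi>]) blast
    let ?\<phi> = "restrict (c \<circ> a) (carrier L)"
    have h: "?\<phi> \<in> hom L K" by (rule L.hom_restrict[OF Group.hom_compose[OF a(1) c(1)]]) simp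
    have u: "?\<phi> (\<eta> g) = \<psi> g" if "g \<in> carrier G" for g
      using that a c hom_in_carrier[OF \<eta> that] by simp
    show "\<exists>!\<phi>. \<phi> \<in> hom L K \<and> \<phi> \<in> extensional (carrier L) \<and> (\<forall>g\<in>carrier G. \<phi> (\<eta> g) = \<psi> g)"
    proof (rule ex1I[of _ ?\<phi>])
      fix \<phi>' assume \<phi>': "\<phi>' \<in> hom L K \<and> \<phi>' \<in> extensional (carrier L) \<and> (\<forall>g\<in>carrier G. \<phi>' (\<eta> g) = \<psi> g)"
      have "(\<phi>' \<circ> b) y = c y" if "y \<in> carrier ?M" for y
        by (rule hom_free_localization_unique[OF G K Group.hom_compose[OF b(1)] c(1) _ that])
          (simp_all add: \<phi>' b c)
      then have "\<phi>' x = ?\<phi> x" if "x \<in> carrier L" for x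
        using ba[OF that] hom_in_carrier[OF a(1) that] that by (metis comp_apply restrict_apply')
      then show "\<phi>' = ?\<phi>"
        using \<phi>' by (intro extensionalityI[of _ "carrier L"]) simp_all
    qed (simp add: h a c hom_in_carrier[OF \<eta>])
  qed
qed

end

(* Let K be a P-local group with a homomorphism chi from K to the nonzero complex numbers, and let H -> K
   send x_1 to an element whose p-th root r in K has chi r ~= 1. A homomorphism from a perfect group to an abelian
   group is trivial, so L_P H cannot be perfect: the map from L_P H to K sends the p-th root of x_1 to r.

   Such a K is built from H, mapped to the colimit of free groups under x_i |-> [x_2i, x_2i+1], by adjoining roots.
   If c has no p-th root in G, the amalgam of G and C<r>, r^p = c, over the centralizer C of c contains a root of c,
   and chi extends to it with chi r equal to any p-th root of chi c; for the first root r this leaves room for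
   chi r ~= 1, because x_1 is not a p-th power in the colimit. Countably many such steps give all roots in the limit.
   The roots stay unique because every group involved is torsion-free and CSA (maximal abelian subgroups
   are malnormal), and this property passes from G to the amalgam by way of its action on a tree. *)

theory Submission
  imports Defs Complex_Main "HOL-Algebra.Weak_Morphisms" "HOL-Library.Countable_Set"
begin

section \<open>Torsion-free CSA groups\<close>

text \<open>Uniqueness of roots alone need not be inherited by an amalgam; this is why the stronger
  CSA property is carried along. Amalgamating over the whole centralizer \<open>C\<close> keeps the
  new centralizer of \<open>c\<close> abelian, which the cyclic group of \<open>c\<close> would not
  do in general. Malnormality of \<open>C\<close> bounds the subtree fixed by a nontrivial element
  to diameter 2. So only the identity fixes the base vertex and commutes with a hyperbolic element
  whose axis passes through it; the centralizer of such an element embeds in the integers by its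
  Busemann function, and torsion-freeness rules out that its axis is inverted. No tree is built: the
  group itself carries the distances between the translates of one base vertex, with the four-point
  inequality as the only tree axiom. One argument then covers free groups and amalgams. The nonzero
  complex numbers have all roots, so a character extends at every step. Of H only the images of the
  generators are kept, a sequence with y_i = [y_2i, y_2i+1]. The factor of F for (1, 1, ...) maps to
  K by the same sequence, so one K serves both groups.\<close>

definition conj_centralizer :: "('a, 'm) monoid_scheme \<Rightarrow> 'a \<Rightarrow> 'a set" where
  "conj_centralizer G x = {g \<in> carrier G.
     (g \<otimes>\<^bsub>G\<^esub> x \<otimes>\<^bsub>G\<^esub> inv\<^bsub>G\<^esub> g) \<otimes>\<^bsub>G\<^esub> x = x \<otimes>\<^bsub>G\<^esub> (g \<otimes>\<^bsub>G\<^esub> x \<otimes>\<^bsub>G\<^esub> inv\<^bsub>G\<^esub> g)}"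

text \<open>A group is CSA if its maximal abelian subgroups are malnormal. The second clause amounts to this:
  the conjugating centralizer of \<open>x\<close> contains \<open>x\<close> and the centralizer of \<open>x\<close>, so it is an abelian group
  equal to the latter. Torsion-freeness is included.\<close>

definition csa :: "('a, 'm) monoid_scheme \<Rightarrow> bool" where
  "csa G \<longleftrightarrow> group G \<and>
     (\<forall>x\<in>carrier G. \<forall>n::nat. 0 < n \<longrightarrow> x [^]\<^bsub>G\<^esub> n = \<one>\<^bsub>G\<^esub> \<longrightarrow> x = \<one>\<^bsub>G\<^esub>) \<and>
     (\<forall>x\<in>carrier G - {\<one>\<^bsub>G\<^esub>}. \<forall>g\<in>conj_centralizer G x. \<forall>h\<in>conj_centralizer G x.
        g \<otimes>\<^bsub>G\<^esub> h = h \<otimes>\<^bsub>G\<^esub> g)"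

lemma csa_group: "csa G \<Longrightarrow> group G"
  by (simp add: csa_def)

lemma csa_torsion_free:
  "csa G \<Longrightarrow> x \<in> carrier G \<Longrightarrow> 0 < n \<Longrightarrow> x [^]\<^bsub>G\<^esub> (n::nat) = \<one>\<^bsub>G\<^esub> \<Longrightarrow> x = \<one>\<^bsub>G\<^esub>"
  by (simp add: csa_def)

lemma csa_commute:
  "csa G \<Longrightarrow> x \<in> carrier G \<Longrightarrow> x \<noteq> \<one>\<^bsub>G\<^esub> \<Longrightarrow> g \<in> conj_centralizer G x \<Longrightarrow>
    h \<in> conj_centralizer G x \<Longrightarrow> g \<otimes>\<^bsub>G\<^esub> h = h \<otimes>\<^bsub>G\<^esub> g"
  by (simp add: csa_def)

lemma (in group) centralizer_conj_centralizer:
  assumes "g \<in> carrier G" "x \<in> carrier G" "g \<otimes> x = x \<otimes> g"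
  shows "g \<in> conj_centralizer G x"
  using assms by (simp add: conj_centralizer_def m_assoc)

lemma (in group) csa_centralizer_commute:
  assumes "csa G" "x \<in> carrier G" "x \<noteq> \<one>" "g \<in> carrier G" "h \<in> carrier G"
    "g \<otimes> x = x \<otimes> g" "h \<otimes> x = x \<otimes> h"
  shows "g \<otimes> h = h \<otimes> g"
  using assms csa_commute centralizer_conj_centralizer by metis

lemma (in group) nat_pow_conj:
  assumes "g \<in> carrier G" "x \<in> carrier G"
  shows "(g \<otimes> x \<otimes> inv g) [^] (n::nat) = g \<otimes> x [^] n \<otimes> inv g"
proof (induction n)
  case (Suc n)
  have "inv g \<otimes> (g \<otimes> (x \<otimes> inv g)) = x \<otimes> inv g" using assms by (simp flip: m_assoc)
  then show ?case using assms Suc by (simp add: m_assoc)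
qed (use assms in simp)

lemma (in group) commutes_nat_pow:
  assumes "x \<in> carrier G" "y \<in> carrier G" "x \<otimes> y = y \<otimes> x"
  shows "x \<otimes> y [^] (n::nat) = y [^] n \<otimes> x"
proof (induction n)
  case (Suc n)
  then show ?case using assms by (metis m_assoc nat_pow_Suc nat_pow_closed)
qed (use assms in simp)

lemma (in group) commutes_inv:
  assumes "x \<in> carrier G" "y \<in> carrier G" "x \<otimes> y = y \<otimes> x"
  shows "x \<otimes> inv y = inv y \<otimes> x"
  using assms by (metis inv_solve_left inv_solve_right m_assoc m_closed inv_closed)

text \<open>Elements with equal powers commute, since both commute with the power.\<close>

lemma (in group) csa_unique_root:
  assumes "csa G" "0 < n" "x \<in> carrier G" "y \<in> carrier G" "x [^] (n::nat) = y [^] n"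
  shows "x = y"
proof (cases "x [^] n = \<one>")
  case True
  then show ?thesis using assms csa_torsion_free by metis
next
  case False
  have xy: "x \<otimes> y = y \<otimes> x"
    by (rule csa_centralizer_commute[OF assms(1) _ False])
      (use assms commutes_nat_pow[of x x n] commutes_nat_pow[of y y n] in auto)
  have "(x \<otimes> inv y) [^] n = x [^] n \<otimes> inv y [^] n"
    by (rule pow_mult_distrib) (simp_all add: assms(3,4) commutes_inv[OF assms(3,4) xy])
  also have "\<dots> = \<one>" using assms by (simp add: nat_pow_inv)
  finally have "x \<otimes> inv y = \<one>" using csa_torsion_free[OF assms(1) _ assms(2)] assms(3,4) by simp
  moreover have "x = (x \<otimes> inv y) \<otimes> y" using assms by (simp add: m_assoc)
  ultimately show ?thesis using assms by simp
qed


section \<open>Groups with a tree-like metric\<close>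

text \<open>An isometric action on a tree, seen from one vertex: \<open>d x y\<close> is the
  distance between the translates of the base vertex by \<open>x\<close> and \<open>y\<close>. It
  may vanish for distinct elements, which then differ by an element of the vertex stabilizer. The
  last axiom is Gromov's four-point condition, that is, 0-hyperbolicity.\<close>

locale tree_group = group G for G (structure) +
  fixes d :: "'a \<Rightarrow> 'a \<Rightarrow> int"
  assumes d_sym: "x \<in> carrier G \<Longrightarrow> y \<in> carrier G \<Longrightarrow> d x y = d y x"
    and d_self: "x \<in> carrier G \<Longrightarrow> d x x = 0"
    and d_left: "g \<in> carrier G \<Longrightarrow> x \<in> carrier G \<Longrightarrow> y \<in> carrier G \<Longrightarrow> d (g \<otimes> x) (g \<otimes> y) = d x y"
    and four_point: "w \<in> carrier G \<Longrightarrow> x \<in> carrier G \<Longrightarrow> y \<in> carrier G \<Longrightarrow> z \<in> carrier G \<Longrightarrow>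
      d w x + d y z \<le> max (d w y + d x z) (d w z + d x y)"
begin

lemma d_nonneg: "x \<in> carrier G \<Longrightarrow> y \<in> carrier G \<Longrightarrow> 0 \<le> d x y"
  using four_point[of x x y y] d_self by auto

lemma d_triangle:
  "x \<in> carrier G \<Longrightarrow> y \<in> carrier G \<Longrightarrow> z \<in> carrier G \<Longrightarrow> d x z \<le> d x y + d y z"
  using four_point[of x z y y] d_self d_sym by auto

text \<open>The four-point inequality holds for each of the three ways to pair up the points, so the
  largest of the three sums is attained at least twice.\<close>

lemma isosceles:
  assumes "w \<in> carrier G" "x \<in> carrier G" "y \<in> carrier G" "z \<in> carrier G"
    and "d w x + d y z < d w y + d x z"
  shows "d w y + d x z = d w z + d x y"
  using four_point[of w y x z] four_point[of w z x y] assms d_sym[of x y] d_sym[of y z] d_sym[of x z]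
  by linarith

lemma d_inv: "x \<in> carrier G \<Longrightarrow> d \<one> (inv x) = d \<one> x"
  using d_left[of x \<one> "inv x"] d_sym by auto

lemma d_mult: "x \<in> carrier G \<Longrightarrow> y \<in> carrier G \<Longrightarrow> d \<one> (x \<otimes> y) \<le> d \<one> x + d \<one> y"
  using d_triangle[of \<one> x "x \<otimes> y"] d_left[of x \<one> y] by auto

end

text \<open>By \<open>pow\<close> the base vertex lies on the axis of \<open>x\<close>, along which
  \<open>x\<close> translates by \<open>m\<close>. The last assumption says that the centralizer of
  \<open>x\<close> meets the vertex stabilizer trivially, which the bound on fixed subtrees will
  provide.\<close>

locale hyperbolic_element = tree_group +
  fixes x and m :: int
  assumes x [simp]: "x \<in> carrier G" and m: "0 < m"
    and pow: "\<And>n. d \<one> (x [^] (n::nat)) = int n * m"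
    and stab: "\<And>e. e \<in> carrier G \<Longrightarrow> e \<otimes> x = x \<otimes> e \<Longrightarrow> d \<one> e = 0 \<Longrightarrow> e = \<one>"
begin

lemma d_x_Suc: "d (x [^] n) (x [^] Suc n) = m"
  using d_left[of "x [^] n" \<one> x] pow[of 1] by simp

text \<open>The projection of \<open>u\<close> to the axis is within \<open>d \<one> u\<close> of
  the base vertex, while \<open>x [^] n\<close> is at distance \<open>n * m\<close> and hence beyond
  it. From there on the distance to \<open>u\<close> grows linearly along the axis.\<close>

lemma d_pow_Suc:
  assumes u: "u \<in> carrier G" and n: "d \<one> u < int n"
  shows "d u (x [^] Suc n) = d u (x [^] n) + m"
proof -
  have q: "int n \<le> int n * m" using m by (simp add: mult_le_cancel_left1)
  have e: "d \<one> (x [^] n) = int n * m" "d \<one> (x [^] Suc n) = int n * m + m"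
    using pow[of n] pow[of "Suc n"] by (auto simp: algebra_simps)
  have c: "x [^] n \<in> carrier G" "x [^] Suc n \<in> carrier G" "\<one> \<in> carrier G" by auto
  have "d u \<one> + d (x [^] n) (x [^] Suc n) < d u (x [^] n) + d \<one> (x [^] Suc n)"
    using d_triangle[OF c(3) u c(1)] d_sym[OF u c(3)] e q n d_x_Suc[of n] m by linarith
  then have "d u (x [^] n) + d \<one> (x [^] Suc n) = d u (x [^] Suc n) + d \<one> (x [^] n)"
    by (rule isosceles[OF u c(3,1,2)])
  then show ?thesis using e by linarith
qed

text \<open>The eventually constant value of \<open>d u (x [^] n) - n * m\<close>, that is, the Busemann function of the end of
  the tree towards which \<open>x\<close> translates.\<close>

definition busemann :: "'a \<Rightarrow> int" where
  "busemann u = d u (x [^] (nat (d \<one> u) + 1)) - int (nat (d \<one> u) + 1) * m"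

lemma busemann:
  assumes u: "u \<in> carrier G" and n: "d \<one> u < int n"
  shows "d u (x [^] n) = int n * m + busemann u"
proof -
  have "nat (d \<one> u) + 1 \<le> n" using n d_nonneg[OF one_closed u] by linarith
  then show ?thesis
  proof (induction n rule: dec_induct)
    case base
    then show ?case by (simp add: busemann_def)
  next
    case (step n)
    then have "d \<one> u < int n" by linarith
    then show ?case using d_pow_Suc[OF u, of n] step by (simp add: algebra_simps)
  qed
qed

lemma busemann_le: "u \<in> carrier G \<Longrightarrow> \<bar>busemann u\<bar> \<le> d \<one> u"
proof -
  assume u: "u \<in> carrier G"
  define n where "n = nat (d \<one> u) + 1"
  have n: "d \<one> u < int n" by (simp add: n_def)
  have c: "x [^] n \<in> carrier G" "\<one> \<in> carrier G" by auto
  show ?thesis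
    using busemann[OF u n] pow[of n] d_triangle[OF u c(2,1)] d_triangle[OF c(2) u c(1)] d_sym[OF c(2) u]
    by auto
qed

text \<open>An element that commutes with \<open>x\<close> maps the ray of powers of
  \<open>x\<close> to a ray with the same end, so it shifts the Busemann function by a constant. On
  the centralizer of \<open>x\<close> the function is therefore a homomorphism to the
  integers.\<close>

lemma busemann_mult:
  assumes y: "y \<in> carrier G" "y \<otimes> x = x \<otimes> y" and w: "w \<in> carrier G"
  shows "busemann (y \<otimes> w) = busemann y + busemann w"
proof -
  define n where "n = nat (d \<one> y + d \<one> w) + 1"
  have nn: "0 \<le> d \<one> y" "0 \<le> d \<one> w" using d_nonneg y w by auto
  then have n: "d \<one> y < int n" "d \<one> w < int n" "d \<one> (y \<otimes> w) < int n" "d \<one> y + d \<one> w < int n"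
    using d_mult[OF y(1) w] by (auto simp: n_def)
  have q: "int n \<le> int n * m" using m by (simp add: mult_le_cancel_left1)
  define a where "a = x [^] n"
  have a: "a \<in> carrier G" by (simp add: a_def)
  have "inv y \<otimes> x = x \<otimes> inv y" using commutes_inv[of x y] y by simp
  then have ya: "inv y \<otimes> a = a \<otimes> inv y" using commutes_nat_pow[of "inv y" x n] y by (simp add: a_def)
  define b where "b = a \<otimes> inv y"
  have b: "b \<in> carrier G" using a y by (simp add: b_def)
  have d1: "d (y \<otimes> w) a = d w b"
    using d_left[of y w b] y w a by (simp add: b_def ya[symmetric] m_assoc[symmetric])
  have d2: "d \<one> b = d y a"
    using d_left[of y \<one> b] y a by (simp add: b_def ya[symmetric] m_assoc[symmetric])
  have d3: "d a b = d \<one> y"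
    using d_left[of a \<one> "inv y"] y a d_inv by (simp add: b_def)
  have d4: "d \<one> a = int n * m" by (simp add: a_def pow)
  have d5: "d w a = int n * m + busemann w" "d y a = int n * m + busemann y"
      "d (y \<otimes> w) a = int n * m + busemann (y \<otimes> w)"
    using busemann w y n by (auto simp: a_def)
  note o = one_closed
  have "- d \<one> w \<le> busemann w" "- d \<one> y \<le> busemann y"
    using busemann_le[OF w] busemann_le[OF y(1)] by auto
  \<comment> \<open>The points \<open>w\<close> and \<open>\<one>\<close> are close to each other,
    and so are \<open>a\<close> and \<open>b\<close>; the two pairs are far apart because
    \<open>n\<close> exceeds \<open>d \<one> y + d \<one> w\<close>. So the two cross sums
    agree.\<close>
  then have "d w \<one> + d a b < d w a + d \<one> b"
    using d_sym[OF w o] d2 d3 d5 n(4) q by linarith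
  then have "d w a + d \<one> b = d w b + d \<one> a" by (rule isosceles[OF w o a b])
  then show ?thesis using d1 d2 d4 d5 by linarith
qed

lemma busemann_one: "busemann \<one> = 0"
  using busemann_le[of \<one>] d_self[of \<one>] by auto

lemma busemann_inv:
  assumes "y \<in> carrier G" "y \<otimes> x = x \<otimes> y"
  shows "busemann (inv y) = - busemann y"
  using busemann_mult[OF assms, of "inv y"] assms busemann_one by auto

lemma hyperbolic_inverse: "hyperbolic_element G d (inv x) m"
proof unfold_locales
  show "d \<one> (inv x [^] n) = int n * m" for n :: nat
    using d_inv[of "x [^] n"] pow[of n] by (simp add: nat_pow_inv)
  show "e = \<one>" if "e \<in> carrier G" "e \<otimes> inv x = inv x \<otimes> e" "d \<one> e = 0" for e
    using stab[of e] that commutes_inv[of e "inv x"] by simp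
qed (auto simp: m)

text \<open>The Busemann functions of the two ends of the axis add up to twice the distance from the
  axis. The sum is nonnegative and changes sign when \<open>y\<close> is replaced by its inverse, so
  it vanishes: \<open>y\<close> moves the base vertex along the axis.\<close>

lemma d_eq_abs_busemann:
  assumes y: "y \<in> carrier G" "y \<otimes> x = x \<otimes> y"
  shows "d \<one> y = \<bar>busemann y\<bar>"
proof -
  interpret I: hyperbolic_element G d "inv x" m by (rule hyperbolic_inverse)
  have ge: "0 \<le> busemann u + I.busemann u" if u: "u \<in> carrier G" for u
  proof -
    define n where "n = nat (d \<one> u) + 1"
    have n: "d \<one> u < int n" by (simp add: n_def)
    have c: "inv x [^] n \<in> carrier G" "x [^] n \<in> carrier G" by auto
    have "d (inv x [^] n) (x [^] n) = d \<one> (x [^] n \<otimes> x [^] n)"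
      using d_left[OF c(2) c(1) c(2)] by (simp add: nat_pow_inv)
    also have "\<dots> = int (n + n) * m" using pow[of "n + n"] by (simp add: nat_pow_mult)
    finally have "d (inv x [^] n) (x [^] n) = int n * m + int n * m" by (simp add: algebra_simps)
    then show ?thesis
      using busemann[OF u n] I.busemann[OF u n] d_triangle[OF c(1) u c(2)] d_sym[OF u c(1)] by linarith
  qed
  have y': "y \<otimes> inv x = inv x \<otimes> y" using commutes_inv y by simp
  have opp: "I.busemann y = - busemann y"
    using ge[of y] ge[of "inv y"] y y' busemann_inv I.busemann_inv by auto
  define n where "n = nat (d \<one> y) + 1"
  have n: "d \<one> y < int n" by (simp add: n_def)
  define a b where "a = x [^] n" and "b = inv x [^] n"
  have c: "a \<in> carrier G" "b \<in> carrier G" by (auto simp: a_def b_def)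
  have "d b a = d \<one> (x [^] n \<otimes> x [^] n)"
    using d_left[OF c(1) c(2) c(1)] by (simp add: nat_pow_inv a_def b_def)
  also have "\<dots> = int (n + n) * m" using pow[of "n + n"] by (simp add: nat_pow_mult)
  finally have ba: "d b a = int n * m + int n * m" by (simp add: algebra_simps)
  have e: "d y a = int n * m + busemann y" "d y b = int n * m - busemann y" 
     "d \<one> a = int n * m" "d \<one> b = int n * m"
    using busemann[OF y(1) n] I.busemann[OF y(1) n] opp pow I.pow by (auto simp: a_def b_def)
  have "d \<one> y \<le> \<bar>busemann y\<bar>"
    using four_point[OF c(2,1) one_closed y(1)] ba e d_sym[OF c(1) one_closed] d_sym[OF c(2) one_closed]
       d_sym[OF c(1) y(1)] d_sym[OF c(2) y(1)] by linarith
  then show ?thesis using busemann_le[OF y(1)] by simp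
qed

lemma busemann_eq_0:
  assumes "y \<in> carrier G" "y \<otimes> x = x \<otimes> y" "busemann y = 0"
  shows "y = \<one>"
  using d_eq_abs_busemann[OF assms(1,2)] assms stab by simp

lemma commutes_mult:
  assumes "y \<in> carrier G" "y \<otimes> x = x \<otimes> y" "z \<in> carrier G" "z \<otimes> x = x \<otimes> z"
  shows "(y \<otimes> z) \<otimes> x = x \<otimes> (y \<otimes> z)"
  using assms x by (metis m_assoc)

text \<open>A homomorphism on the centralizer whose kernel is trivial, because an element of the
  kernel fixes the base vertex. So the centralizer of \<open>x\<close> embeds in the
  integers.\<close>

lemma busemann_inj:
  assumes y: "y \<in> carrier G" "y \<otimes> x = x \<otimes> y" and z: "z \<in> carrier G" "z \<otimes> x = x \<otimes> z"
    and eq: "busemann y = busemann z"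
  shows "y = z"
proof -
  have z': "inv z \<otimes> x = x \<otimes> inv z" using commutes_inv[of x z] z by simp
  have "y \<otimes> inv z = \<one>"
    by (rule busemann_eq_0)
      (use y z z' eq busemann_mult[OF y, of "inv z"] busemann_inv[OF z] commutes_mult[OF y _ z'] in auto)
  moreover have "y = (y \<otimes> inv z) \<otimes> z" using y z by (simp add: m_assoc)
  ultimately show ?thesis using z by simp
qed

lemma centralizer_commute:
  assumes y: "y \<in> carrier G" "y \<otimes> x = x \<otimes> y" and z: "z \<in> carrier G" "z \<otimes> x = x \<otimes> z"
  shows "y \<otimes> z = z \<otimes> y"
  by (rule busemann_inj)
    (use y z commutes_mult busemann_mult in auto)

lemma busemann_pow:
  assumes y: "y \<in> carrier G" "y \<otimes> x = x \<otimes> y"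
  shows "busemann (y [^] (n::nat)) = int n * busemann y"
proof (induction n)
  case 0
  then show ?case by (simp add: busemann_one)
next
  case (Suc n)
  have "y [^] n \<otimes> x = x \<otimes> y [^] n" using commutes_nat_pow[of x y n] y by simp
  then show ?case using Suc busemann_mult[of "y [^] n" y] y by (simp add: algebra_simps)
qed

lemma busemann_x: "busemann x = - m"
proof -
  define n where "n = nat m + 2"
  have "d x (x [^] n) = d \<one> (x [^] (n - 1))"
    using d_left[of x \<one> "x [^] (n - 1)"] nat_pow_Suc2[of x "n - 1"] by (simp add: n_def)
  also have "\<dots> = int (n - 1) * m" by (rule pow)
  also have "\<dots> = int n * m - m" by (simp add: n_def algebra_simps)
  finally have "d x (x [^] n) = int n * m - m" .
  moreover have "d \<one> x < int n" using pow[of 1] m by (simp add: n_def)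
  ultimately show ?thesis using busemann[of x n] by simp
qed

text \<open>If \<open>g\<close> inverts \<open>x\<close>, then \<open>g\<^sup>2\<close> centralizes \<open>x\<close> and so has a power which is also a power of \<open>x\<close>; this power
  is both fixed and inverted by \<open>g\<close>.\<close>

lemma conj_eq_inverse:
  assumes tf: "\<forall>y\<in>carrier G. \<forall>n::nat. 0 < n \<longrightarrow> y [^] n = \<one> \<longrightarrow> y = \<one>"
    and g: "g \<in> carrier G" "g \<otimes> x \<otimes> inv g = inv x"
  shows False
proof -
  have gx: "g \<otimes> x = inv x \<otimes> g" using g by (metis inv_solve_right' inv_closed m_closed x)
  have gix: "g \<otimes> inv x = x \<otimes> g"
    by (metis g(1) gx inv_closed inv_solve_left inv_solve_right m_assoc m_closed x)
  have gg: "g \<otimes> g \<in> carrier G" "(g \<otimes> g) \<otimes> x = x \<otimes> (g \<otimes> g)"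
    using g(1) gx gix by (simp_all add: m_assoc) (simp flip: m_assoc)
  define b where "b = busemann (g \<otimes> g)"
  define k where "k = nat \<bar>b\<bar>"
  \<comment> \<open>Since \<open>busemann x = - m\<close>, this power of \<open>x\<close> has the
    value \<open>b * m\<close>, the same as the \<open>m\<close>-th power of
    \<open>g \<otimes> g\<close>.\<close>
  define y where "y = (if b \<le> 0 then x else inv x) [^] k"
  define h where "h = (g \<otimes> g) [^] nat m"
  have x': "inv x \<otimes> x = x \<otimes> inv x" by simp
  have iv: "busemann (inv x) = m" using busemann_inv[of x] busemann_x by simp
  have y: "y \<in> carrier G" "y \<otimes> x = x \<otimes> y" "busemann y = b * m"
    using busemann_pow[of x k] busemann_pow[of "inv x" k] iv busemann_x
      commutes_nat_pow[of x x k] commutes_nat_pow[of x "inv x" k]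
    by (auto simp: y_def k_def)
  have h: "h \<in> carrier G" "h \<otimes> x = x \<otimes> h" "busemann h = b * m"
    using commutes_nat_pow[of x "g \<otimes> g" "nat m"] busemann_pow[OF gg, of "nat m"] gg m
    by (auto simp: h_def b_def)
  have hy: "h = y" by (rule busemann_inj[OF h(1,2) y(1,2)]) (simp add: h y)
  have "g \<otimes> h = h \<otimes> g" unfolding h_def
    by (rule commutes_nat_pow) (use g(1) in \<open>auto simp: m_assoc\<close>)
  moreover have "g \<otimes> y \<otimes> inv g = inv y"
  proof -
    have "g \<otimes> inv x \<otimes> inv g = x" using gix g(1) by (simp add: m_assoc)
    then show ?thesis
      using g by (cases "b \<le> 0") (simp_all add: y_def nat_pow_conj[symmetric] nat_pow_inv[symmetric])
  qed
  ultimately have "h = inv h" using hy h(1) g(1) by (metis inv_solve_right' m_closed)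
  then have "h \<otimes> h = \<one>" using h(1) by (metis r_inv)
  then have "h [^] (2::nat) = \<one>" using h(1) by (simp add: numeral_2_eq_2)
  then have "h = \<one>" using tf h(1) by (metis zero_less_numeral)
  then have "g \<otimes> g = \<one>" using tf gg(1) m unfolding h_def by (metis zero_less_nat_eq)
  then have "g [^] (2::nat) = \<one>" using g(1) by (simp add: numeral_2_eq_2)
  then have "g = \<one>" using tf g(1) by (metis zero_less_numeral)
  then have "x = inv x" using g by simp
  then show False using iv busemann_x m by simp
qed

text \<open>Conjugation by \<open>g\<close> changes the displacement of the base vertex by at most
  \<open>2 * d \<one> g\<close>, whatever the exponent \<open>n\<close>. So the conjugate
  \<open>y\<close> of \<open>x\<close>, which translates along the same axis, has the same
  translation length and equals \<open>x\<close> or its inverse; the latter has been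
  excluded.\<close>

lemma conj_centralizer_commute:
  assumes tf: "\<forall>y\<in>carrier G. \<forall>n::nat. 0 < n \<longrightarrow> y [^] n = \<one> \<longrightarrow> y = \<one>"
    and g: "g \<in> conj_centralizer G x"
  shows "g \<otimes> x = x \<otimes> g"
proof -
  define y where "y = g \<otimes> x \<otimes> inv g"
  have gc: "g \<in> carrier G" and y: "y \<in> carrier G" "y \<otimes> x = x \<otimes> y"
    using g by (auto simp: y_def conj_centralizer_def)
  have *: "\<bar>int n * \<bar>busemann y\<bar> - int n * m\<bar> \<le> 2 * d \<one> g" for n
  proof -
    have yn: "y [^] n \<in> carrier G" "y [^] n \<otimes> x = x \<otimes> y [^] n"
      using y commutes_nat_pow[of x y n] by simp_all
    have "d \<one> (y [^] n) = \<bar>int n * busemann y\<bar>"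
      using d_eq_abs_busemann[OF yn] busemann_pow[OF y] by simp
    then have l: "d \<one> (y [^] n) = int n * \<bar>busemann y\<bar>" by (simp add: abs_mult)
    have e: "y [^] n = g \<otimes> x [^] n \<otimes> inv g" using nat_pow_conj[OF gc] by (simp add: y_def)
    have "x [^] n = inv g \<otimes> y [^] n \<otimes> g" using gc by (simp add: e m_assoc inv_solve_left)
    then have "d \<one> (x [^] n) \<le> 2 * d \<one> g + d \<one> (y [^] n)"
      using d_mult[of "inv g \<otimes> y [^] n" g] d_mult[of "inv g" "y [^] n"] gc yn d_inv by simp
    moreover have "d \<one> (y [^] n) \<le> 2 * d \<one> g + d \<one> (x [^] n)"
      using d_mult[of "g \<otimes> x [^] n" "inv g"] d_mult[of g "x [^] n"] gc d_inv by (simp add: e)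
    ultimately show ?thesis using l pow[of n] by linarith
  qed
  have "\<bar>busemann y\<bar> = m"
  proof (rule ccontr)
    assume "\<bar>busemann y\<bar> \<noteq> m"
    then have "1 \<le> \<bar>\<bar>busemann y\<bar> - m\<bar>" by linarith
    define n where "n = nat (2 * d \<one> g) + 1"
    have "int n * 1 \<le> int n * \<bar>\<bar>busemann y\<bar> - m\<bar>"
      by (rule mult_left_mono) (use \<open>1 \<le> _\<close> in auto)
    also have "\<dots> = \<bar>int n * \<bar>busemann y\<bar> - int n * m\<bar>" by (simp add: abs_mult flip: right_diff_distrib)
    finally show False using *[of n] d_nonneg[OF one_closed gc] by (simp add: n_def)
  qed
  then consider "busemann y = busemann x" | "busemann y = busemann (inv x)"
    using busemann_inv[of x] busemann_x by (auto simp: abs_if split: if_splits)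
  then show ?thesis
  proof cases
    case 1
    then have "y = x" by (rule busemann_inj[OF y x HOL.refl])
    moreover have "y \<otimes> g = g \<otimes> x" using gc by (simp add: y_def m_assoc)
    ultimately show ?thesis by simp
  next
    case 2
    have "y = inv x" by (rule busemann_inj[OF y _ _ 2]) auto
    then show ?thesis using conj_eq_inverse[OF tf gc] by (simp add: y_def)
  qed
qed

end

section \<open>Conjugation and a criterion for CSA\<close>

lemma (in group) conj_mult:
  assumes "g \<in> carrier G" "x \<in> carrier G" "y \<in> carrier G"
  shows "(g \<otimes> x \<otimes> inv g) \<otimes> (g \<otimes> y \<otimes> inv g) = g \<otimes> (x \<otimes> y) \<otimes> inv g"
proof -
  have "inv g \<otimes> (g \<otimes> (y \<otimes> inv g)) = y \<otimes> inv g" using assms by (simp flip: m_assoc)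
  then show ?thesis using assms by (simp add: m_assoc)
qed

lemma (in group) conj_eq_iff:
  assumes "g \<in> carrier G" "x \<in> carrier G" "y \<in> carrier G"
  shows "g \<otimes> x \<otimes> inv g = g \<otimes> y \<otimes> inv g \<longleftrightarrow> x = y"
  using assms by simp

lemma (in group) conj_eq_one:
  "g \<in> carrier G \<Longrightarrow> y \<in> carrier G \<Longrightarrow> g \<otimes> y \<otimes> inv g = \<one> \<Longrightarrow> y = \<one>"
  using conj_eq_iff[of g y \<one>] by simp

lemma (in group) conj_inv:
  assumes "g \<in> carrier G" "x \<in> carrier G"
  shows "inv (g \<otimes> x \<otimes> inv g) = g \<otimes> inv x \<otimes> inv g"
  using assms by (simp add: inv_mult_group m_assoc)

lemma (in group) conj_centralizer_conj:
  assumes "g \<in> carrier G" "x \<in> carrier G" "h \<in> conj_centralizer G x"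
  shows "g \<otimes> h \<otimes> inv g \<in> conj_centralizer G (g \<otimes> x \<otimes> inv g)"
proof -
  have h: "h \<in> carrier G" "(h \<otimes> x \<otimes> inv h) \<otimes> x = x \<otimes> (h \<otimes> x \<otimes> inv h)"
    using assms(3) by (auto simp: conj_centralizer_def)
  define y where "y = h \<otimes> x \<otimes> inv h"
  have y: "y \<in> carrier G" "y \<otimes> x = x \<otimes> y" using h assms by (auto simp: y_def)
  have "(g \<otimes> h \<otimes> inv g) \<otimes> (g \<otimes> x \<otimes> inv g) \<otimes> inv (g \<otimes> h \<otimes> inv g) = g \<otimes> y \<otimes> inv g"
    using assms h by (simp add: conj_mult conj_inv y_def)
  then show ?thesis
    using assms h y by (simp add: conj_centralizer_def conj_mult)
qed

lemma (in group) conj_inv_conj: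
  assumes "g \<in> carrier G" "y \<in> carrier G"
  shows "inv g \<otimes> (g \<otimes> y \<otimes> inv g) \<otimes> inv (inv g) = y"
proof -
  have "inv g \<otimes> (g \<otimes> (y \<otimes> (inv g \<otimes> g))) = y" using assms by (simp flip: m_assoc)
  then show ?thesis using assms by (simp add: m_assoc)
qed

text \<open>Conjugation by \<open>g\<close> carries the conjugating centralizer of \<open>y\<close>
  to that of the conjugate of \<open>y\<close>, so one representative of each conjugacy class is
  enough.\<close>

lemma (in group) csaI:
  assumes tf: "\<And>x n. x \<in> carrier G \<Longrightarrow> 0 < n \<Longrightarrow> x [^] (n::nat) = \<one> \<Longrightarrow> x = \<one>"
    and comm: "\<And>x. x \<in> carrier G \<Longrightarrow> x \<noteq> \<one> \<Longrightarrow>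
      \<exists>g\<in>carrier G. \<exists>y\<in>carrier G. x = g \<otimes> y \<otimes> inv g \<and>
        (\<forall>h\<in>conj_centralizer G y. \<forall>k\<in>conj_centralizer G y. h \<otimes> k = k \<otimes> h)"
  shows "csa G"
  unfolding csa_def
proof (intro conjI ballI allI impI is_group)
  fix x n assume "x \<in> carrier G" "0 < (n::nat)" "x [^] n = \<one>"
  then show "x = \<one>" by (rule tf)
next
  fix x h k assume x: "x \<in> carrier G - {\<one>}" and h: "h \<in> conj_centralizer G x" and k: "k \<in> conj_centralizer G x"
  obtain g y where gy: "g \<in> carrier G" "y \<in> carrier G" "x = g \<otimes> y \<otimes> inv g"
    and y: "\<forall>h\<in>conj_centralizer G y. \<forall>k\<in>conj_centralizer G y. h \<otimes> k = k \<otimes> h"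
    using comm[of x] x by auto
  define f where "f = inv g"
  have f: "f \<in> carrier G" "f \<otimes> x \<otimes> inv f = y"
    unfolding gy(3) f_def by (simp_all only: conj_inv_conj[OF gy(1,2)] inv_closed[OF gy(1)])
  have hk: "h \<in> carrier G" "k \<in> carrier G" and xc: "x \<in> carrier G"
    using h k x by (auto simp: conj_centralizer_def)
  have "(f \<otimes> h \<otimes> inv f) \<otimes> (f \<otimes> k \<otimes> inv f) = (f \<otimes> k \<otimes> inv f) \<otimes> (f \<otimes> h \<otimes> inv f)"
    using y conj_centralizer_conj[OF f(1) xc h] conj_centralizer_conj[OF f(1) xc k] unfolding f(2) by blast
  then show "h \<otimes> k = k \<otimes> h" using f(1) hk by (simp add: conj_mult)
qed

section \<open>Common prefixes and the tree of finite lists\<close>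

fun lcp :: "'a list \<Rightarrow> 'a list \<Rightarrow> nat" where
  "lcp (x # xs) (y # ys) = (if x = y then Suc (lcp xs ys) else 0)"
| "lcp [] ys = 0"
| "lcp xs [] = 0"

lemma lcp_Nil [simp]: "lcp xs [] = 0"
  by (cases xs) auto

lemma lcp_hd: "xs = [] \<or> ys = [] \<or> hd xs \<noteq> hd ys \<Longrightarrow> lcp xs ys = 0"
  by (cases xs; cases ys) auto

lemma lcp_commute: "lcp xs ys = lcp ys xs"
  by (induction xs ys rule: lcp.induct) auto

lemma lcp_self: "lcp xs xs = length xs"
  by (induction xs) auto

lemma lcp_ultrametric: "min (lcp xs ys) (lcp ys zs) \<le> lcp xs zs"
proof (induction xs zs arbitrary: ys rule: lcp.induct)
  case (1 x xs z zs)
  show ?case by (cases ys) (use 1 in auto)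
qed auto

text \<open>\<open>lcp\<close> is the Gromov product based at the empty list, and the ultrametric
  inequality for this product amounts to 0-hyperbolicity.\<close>

lemma lcp_four_point: "min (lcp w y + lcp x z) (lcp w z + lcp x y) \<le> lcp w x + lcp y z"
  using lcp_ultrametric[of w y x] lcp_ultrametric[of w z x] lcp_ultrametric[of y w z] lcp_ultrametric[of y x z]
    lcp_commute[of x y] lcp_commute[of x z] lcp_commute[of y w]
    lcp_commute[of x w] lcp_commute[of y z] lcp_commute[of z w]
  by linarith

text \<open>Path length in the tree of lists ordered by prefix: back from \<open>u\<close> to the
  longest common prefix, then forward to \<open>v\<close>.\<close>

definition tree_dist :: "'a list \<Rightarrow> 'a list \<Rightarrow> int" where
  "tree_dist u v = int (length u) + int (length v) - 2 * int (lcp u v)"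

lemma tree_dist_commute: "tree_dist u v = tree_dist v u"
  by (simp add: tree_dist_def lcp_commute)

lemma tree_dist_self: "tree_dist u u = 0"
  by (simp add: tree_dist_def lcp_self)

lemma tree_dist_four_point:
  "tree_dist w x + tree_dist y z \<le> max (tree_dist w y + tree_dist x z) (tree_dist w z + tree_dist x y)"
  using lcp_four_point[of w y x z] by (simp add: tree_dist_def min_def max_def split: if_splits)


section \<open>Free groups\<close>

definition flip :: "bool \<times> 'a \<Rightarrow> bool \<times> 'a" where
  "flip a = (\<not> fst a, snd a)"

lemma flip_simps [simp]: "flip (flip a) = a" "flip (b, x) = (\<not> b, x)" "flip a \<noteq> a" "a \<noteq> flip a"
  "flip a = flip c \<longleftrightarrow> a = c"
  by (cases a; cases c; auto simp: flip_def)+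

abbreviation reduced :: "'a word \<Rightarrow> bool" where
  "reduced \<equiv> successively (\<lambda>a b. b \<noteq> flip a)"

definition push :: "bool \<times> 'a \<Rightarrow> 'a word \<Rightarrow> 'a word" where
  "push a w = (if w \<noteq> [] \<and> hd w = flip a then tl w else a # w)"

text \<open>The free group by van der Waerden's method: the letters of \<open>u\<close> act on the
  reduced word \<open>v\<close> by \<open>push\<close>. Associativity follows from this action,
  without an analysis of reduction sequences.\<close>

definition reduced_words :: "'a word monoid" where
  "reduced_words = \<lparr>carrier = {w. reduced w}, monoid.mult = (\<lambda>u v. foldr push u v), one = []\<rparr>"

lemma reduced_words_simps [simp]:
  "carrier reduced_words = {w. reduced w}"
  "u \<otimes>\<^bsub>reduced_words\<^esub> v = foldr push u v"
  "\<one>\<^bsub>reduced_words\<^esub> = []"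
  by (simp_all add: reduced_words_def)

lemma reduced_push: "reduced w \<Longrightarrow> reduced (push a w)"
  by (cases w) (auto simp: push_def successively_Cons)

lemma push_flip: "reduced w \<Longrightarrow> push a (push (flip a) w) = w"
  by (cases w; cases "tl w") (auto simp: push_def successively_Cons)

lemma reduced_foldr_push: "reduced w \<Longrightarrow> reduced (foldr push u w)"
  by (induction u) (auto intro: reduced_push)

lemma foldr_push_push:
  assumes "reduced w"
  shows "foldr push (push a v) w = push a (foldr push v w)"
proof (cases "v \<noteq> [] \<and> hd v = flip a")
  case True
  then obtain v' where v: "v = flip a # v'" by (cases v) auto
  then show ?thesis using push_flip[OF reduced_foldr_push[OF assms]] by (simp add: push_def)
next
  case False
  then show ?thesis by (auto simp: push_def[of a v])
qed

lemma foldr_push_assoc: "reduced w \<Longrightarrow> foldr push (foldr push u v) w = foldr push u (foldr push v w)"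
  by (induction u) (auto simp: foldr_push_push)

lemma foldr_push_append: "reduced (u @ v) \<Longrightarrow> foldr push u v = u @ v"
  by (induction u) (auto simp: push_def successively_Cons)

definition winv :: "'a word \<Rightarrow> 'a word" where
  "winv w = rev (map flip w)"

lemma winv_simps [simp]: "winv [] = []" "winv (a # w) = winv w @ [flip a]" "winv (u @ v) = winv v @ winv u"
  "length (winv w) = length w" "winv w = [] \<longleftrightarrow> w = []"
  by (auto simp: winv_def)

lemma last_winv: "w \<noteq> [] \<Longrightarrow> last (winv w) = flip (hd w)"
  by (cases w) auto

lemma reduced_winv: "reduced (winv w) = reduced w"
proof -
  have "(\<lambda>x y :: bool \<times> 'a. flip x \<noteq> flip (flip y)) = (\<lambda>x y. y \<noteq> flip x)"
    by (auto simp: fun_eq_iff)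
  then show ?thesis by (simp only: winv_def successively_rev successively_map)
qed

lemma foldr_push_winv: "foldr push (winv w) w = []"
  by (induction w) (auto simp: push_def)

lemma group_reduced_words: "group (reduced_words :: 'a word monoid)"
proof (rule groupI)
  fix x :: "'a word" assume "x \<in> carrier reduced_words"
  then show "\<exists>y\<in>carrier reduced_words. y \<otimes>\<^bsub>reduced_words\<^esub> x = \<one>\<^bsub>reduced_words\<^esub>"
    by (intro bexI[of _ "winv x"]) (auto simp: foldr_push_winv reduced_winv)
qed (auto simp: foldr_push_assoc reduced_foldr_push)

lemma inv_reduced_words: "reduced w \<Longrightarrow> inv\<^bsub>reduced_words\<^esub> w = winv w"
  by (rule group.inv_equality[OF group_reduced_words]) (auto simp: foldr_push_winv reduced_winv)

text \<open>Left multiplication by a letter is an isometry of the Cayley tree. In the mixed case one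
  word loses its first letter and the other gains one, and they have no common prefix before or
  after.\<close>

lemma tree_dist_push:
  assumes "reduced u" "reduced v"
  shows "tree_dist (push a u) (push a v) = tree_dist u v"
proof -
  have one: "tree_dist (push a u) (push a v) = tree_dist u v"
    if h: "reduced u" "u \<noteq> []" "hd u = flip a" "v = [] \<or> hd v \<noteq> flip a" for u v
  proof -
    obtain u' where u: "u = flip a # u'" using h by (cases u) auto
    have "u' = [] \<or> hd u' \<noteq> a" using h(1) u by (cases u') auto
    then have "lcp u' (a # v) = 0" "lcp u v = 0" using h u by (auto intro!: lcp_hd)
    then show ?thesis using h u by (auto simp: tree_dist_def push_def)
  qed
  consider "u \<noteq> []" "hd u = flip a" "v \<noteq> []" "hd v = flip a" | "u \<noteq> []" "hd u = flip a" "v = [] \<or> hd v \<noteq> flip a"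
    | "v \<noteq> []" "hd v = flip a" "u = [] \<or> hd u \<noteq> flip a" | "u = [] \<or> hd u \<noteq> flip a" "v = [] \<or> hd v \<noteq> flip a"
    by blast
  then show ?thesis
  proof cases
    case 1
    then show ?thesis by (cases u; cases v) (auto simp: tree_dist_def push_def)
  next
    case 2
    then show ?thesis using one assms by blast
  next
    case 3
    then show ?thesis using one[of v u] assms by (simp add: tree_dist_commute)
  next
    case 4
    then show ?thesis by (auto simp: tree_dist_def push_def)
  qed
qed

lemma tree_dist_foldr_push:
  assumes "reduced u" "reduced v"
  shows "tree_dist (foldr push w u) (foldr push w v) = tree_dist u v"
  by (induction w) (use assms in \<open>auto simp: tree_dist_push reduced_foldr_push\<close>)

lemma tree_group_reduced_words: "tree_group (reduced_words :: 'a word monoid) tree_dist"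
proof -
  interpret group "reduced_words :: 'a word monoid" by (rule group_reduced_words)
  show ?thesis
    by unfold_locales
      (auto simp: tree_dist_foldr_push tree_dist_self intro: tree_dist_commute tree_dist_four_point)
qed

lemma cyclically_reduced_decomposition:
  assumes "reduced x" "x \<noteq> []"
  shows "\<exists>h y. x = h @ y @ winv h \<and> y \<noteq> [] \<and> hd y \<noteq> flip (last y)"
  using assms
proof (induction "length x" arbitrary: x rule: less_induct)
  case less
  show ?case
  proof (cases "hd x = flip (last x)")
    case False
    then show ?thesis using less by (intro exI[of _ "[]"] exI[of _ x]) auto
  next
    case True
    obtain a u where u: "x = a # u" using less by (cases x) auto
    have "u \<noteq> []" using u True by auto
    then obtain v b where v: "u = v @ [b]" by (cases u rule: rev_cases) auto
    have b: "b = flip a" using True u v by auto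
    have "v \<noteq> []" using less.prems u v b by auto
    moreover have "reduced v" using less.prems u v by (auto simp: successively_Cons successively_append_iff)
    ultimately obtain h y where "v = h @ y @ winv h" "y \<noteq> []" "hd y \<noteq> flip (last y)"
      using less.hyps[of v] u v by auto
    then show ?thesis using u v b by (intro exI[of _ "a # h"] exI[of _ y]) auto
  qed
qed

lemma reduced_power:
  assumes "reduced y" "y \<noteq> []" "hd y \<noteq> flip (last y)"
  shows "y [^]\<^bsub>reduced_words\<^esub> n = concat (replicate n y)" "reduced (concat (replicate n y))"
    "0 < n \<Longrightarrow> hd (concat (replicate n y)) = hd y \<and> last (concat (replicate n y)) = last y"
proof -
  interpret group "reduced_words :: 'a word monoid" by (rule group_reduced_words)
  have *: "reduced (concat (replicate n y)) \<and>
    (0 < n \<longrightarrow> hd (concat (replicate n y)) = hd y \<and> last (concat (replicate n y)) = last y)" for n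
  proof (induction n)
    case (Suc n)
    then show ?case using assms by (cases n) (auto simp: successively_append_iff)
  qed simp
  then show "reduced (concat (replicate n y))"
    "0 < n \<Longrightarrow> hd (concat (replicate n y)) = hd y \<and> last (concat (replicate n y)) = last y" by auto
  show "y [^]\<^bsub>reduced_words\<^esub> n = concat (replicate n y)"
  proof (induction n)
    case (Suc n)
    have "y [^]\<^bsub>reduced_words\<^esub> Suc n = y \<otimes>\<^bsub>reduced_words\<^esub> y [^]\<^bsub>reduced_words\<^esub> n"
      using assms by (intro nat_pow_Suc2) simp
    also have "\<dots> = concat (replicate (Suc n) y)"
      using Suc *[of "Suc n"] by (simp add: foldr_push_append)
    finally show ?case .
  qed simp
qed

lemma cyclically_reduced_hyperbolic:
  assumes "reduced y" "y \<noteq> []" "hd y \<noteq> flip (last y)"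
  shows "hyperbolic_element reduced_words tree_dist y (int (length y))"
proof -
  interpret tree_group "reduced_words :: 'a word monoid" tree_dist by (rule tree_group_reduced_words)
  show ?thesis
    by unfold_locales (use assms in \<open>auto simp: reduced_power tree_dist_def length_concat sum_list_replicate\<close>)
qed

text \<open>Every nontrivial element is conjugate to a cyclically reduced word \<open>y\<close>. Its
  powers are concatenations without cancellation, so it is hyperbolic with translation length
  \<open>length y\<close>.\<close>

lemma csa_reduced_words: "csa (reduced_words :: 'a word monoid)"
proof -
  let ?F = "reduced_words :: 'a word monoid"
  interpret tree_group ?F tree_dist by (rule tree_group_reduced_words)
  have dec: "\<exists>g\<in>carrier ?F. \<exists>y\<in>carrier ?F. x = g \<otimes>\<^bsub>?F\<^esub> y \<otimes>\<^bsub>?F\<^esub> inv\<^bsub>?F\<^esub> g \<and>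
      hyperbolic_element ?F tree_dist y (int (length y))" if x: "x \<in> carrier ?F" "x \<noteq> \<one>\<^bsub>?F\<^esub>" for x
  proof -
    obtain h y where y: "x = h @ y @ winv h" "y \<noteq> []" "hd y \<noteq> flip (last y)"
      using cyclically_reduced_decomposition[of x] x by auto
    have r: "reduced h" "reduced (y @ winv h)" "reduced y" "reduced (h @ y)" "reduced ((h @ y) @ winv h)"
      using x y by (auto simp: successively_append_iff)
    have "x = h \<otimes>\<^bsub>?F\<^esub> y \<otimes>\<^bsub>?F\<^esub> inv\<^bsub>?F\<^esub> h"
      using y r foldr_push_append[OF r(4)] foldr_push_append[OF r(5)] inv_reduced_words[OF r(1)] by simp
    then show ?thesis using r y cyclically_reduced_hyperbolic[of y] by auto
  qed
  have tf: "x = \<one>\<^bsub>?F\<^esub>" if xn: "x \<in> carrier ?F" "0 < n" "x [^]\<^bsub>?F\<^esub> n = \<one>\<^bsub>?F\<^esub>" for x and n :: nat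
  proof (rule ccontr)
    assume "x \<noteq> \<one>\<^bsub>?F\<^esub>"
    then obtain g y where gy: "g \<in> carrier ?F" "y \<in> carrier ?F" "x = g \<otimes>\<^bsub>?F\<^esub> y \<otimes>\<^bsub>?F\<^esub> inv\<^bsub>?F\<^esub> g"
      "hyperbolic_element ?F tree_dist y (int (length y))" using dec[OF xn(1)] by blast
    interpret hyperbolic_element ?F tree_dist y "int (length y)" by (rule gy)
    have "y [^]\<^bsub>?F\<^esub> n = \<one>\<^bsub>?F\<^esub>"
      using xn(3) unfolding gy(3) nat_pow_conj[OF gy(1,2)] by (rule conj_eq_one[OF gy(1) nat_pow_closed[OF gy(2)]])
    then have "int n * int (length y) = 0" using pow[of n] d_self[OF one_closed] by simp
    then show False using m xn(2) by simp
  qed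
  show ?thesis
  proof (rule csaI[OF tf])
    fix x assume x: "x \<in> carrier ?F" "x \<noteq> \<one>\<^bsub>?F\<^esub>"
    obtain g y where gy: "g \<in> carrier ?F" "y \<in> carrier ?F" "x = g \<otimes>\<^bsub>?F\<^esub> y \<otimes>\<^bsub>?F\<^esub> inv\<^bsub>?F\<^esub> g"
      "hyperbolic_element ?F tree_dist y (int (length y))" using dec[OF x] by blast
    interpret hyperbolic_element ?F tree_dist y "int (length y)" by (rule gy)
    have c: "h \<in> carrier ?F \<and> h \<otimes>\<^bsub>?F\<^esub> y = y \<otimes>\<^bsub>?F\<^esub> h" if "h \<in> conj_centralizer ?F y" for h
      using conj_centralizer_commute[OF _ that] tf that by (simp add: conj_centralizer_def)
    have "\<forall>h\<in>conj_centralizer ?F y. \<forall>k\<in>conj_centralizer ?F y. h \<otimes>\<^bsub>?F\<^esub> k = k \<otimes>\<^bsub>?F\<^esub> h"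
      using centralizer_commute c by blast
    with gy(1-3) show "\<exists>g\<in>carrier ?F. \<exists>y\<in>carrier ?F. x = g \<otimes>\<^bsub>?F\<^esub> y \<otimes>\<^bsub>?F\<^esub> inv\<^bsub>?F\<^esub> g \<and>
        (\<forall>h\<in>conj_centralizer ?F y. \<forall>k\<in>conj_centralizer ?F y. h \<otimes>\<^bsub>?F\<^esub> k = k \<otimes>\<^bsub>?F\<^esub> h)"
      by blast
  qed
qed

subsection \<open>Iterated commutators\<close>

text \<open>The inverse of a commutator is the commutator in the opposite order, so inverse letters
  also go to reduced words of length 4.\<close>

fun comm_letter :: "bool \<times> nat \<Rightarrow> nat word" where
  "comm_letter (True, i) = comm_word (2 * i) (2 * i + 1)"
| "comm_letter (False, i) = comm_word (2 * i + 1) (2 * i)"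

definition comm_subst :: "nat word \<Rightarrow> nat word" where
  "comm_subst w = concat (map comm_letter w)"

lemma comm_subst_simps [simp]:
  "comm_subst [] = []" "comm_subst (a # w) = comm_letter a @ comm_subst w"
  "comm_subst (u @ v) = comm_subst u @ comm_subst v"
  by (simp_all add: comm_subst_def)

lemma comm_letter_ne [simp]: "comm_letter a \<noteq> []"
  by (cases a rule: comm_letter.cases) (auto simp: comm_word_def)

lemma length_comm_letter [simp]: "length (comm_letter a) = 4"
  by (cases a rule: comm_letter.cases) (auto simp: comm_word_def)

lemma length_comm_subst: "length (comm_subst w) = 4 * length w"
  by (induction w) auto

lemma hd_comm_letter: "hd (comm_letter (b, i)) = (True, if b then 2 * i else 2 * i + 1)"
  by (cases b) (auto simp: comm_word_def)

lemma last_comm_letter: "last (comm_letter (b, i)) = (False, if b then 2 * i + 1 else 2 * i)"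
  by (cases b) (auto simp: comm_word_def)

lemma hd_comm_subst: "w \<noteq> [] \<Longrightarrow> hd (comm_subst w) = hd (comm_letter (hd w))"
  by (cases w) auto

lemma last_comm_subst: "w \<noteq> [] \<Longrightarrow> last (comm_subst w) = last (comm_letter (last w))"
  by (cases w rule: rev_cases) auto

lemma comm_subst_eq_Nil [simp]: "comm_subst w = [] \<longleftrightarrow> w = []"
  by (cases w) auto

lemma reduced_comm_letter: "reduced (comm_letter a)"
  by (cases a rule: comm_letter.cases) (auto simp: comm_word_def)

text \<open>Each \<open>comm_letter\<close> begins with a positive and ends with a negative letter,
  and the parities of their indices reveal the sign of the original letter. A cancellation at a
  junction would thus force two adjacent letters of \<open>w\<close> to be mutually inverse.\<close>

lemma reduced_comm_subst: "reduced w \<Longrightarrow> reduced (comm_subst w)"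
proof (induction w)
  case (Cons a w)
  show ?case
  proof (cases "w = []")
    case False
    then have h: "hd w \<noteq> flip a" "reduced w" using Cons.prems by (auto simp: successively_Cons)
    obtain b i where a: "a = (b, i)" by (cases a)
    obtain c j where w: "hd w = (c, j)" by (cases "hd w")
    have "hd (comm_letter (hd w)) \<noteq> flip (last (comm_letter a))"
      using h unfolding a w hd_comm_letter last_comm_letter by (cases b; cases c) (auto, presburger+)
    then show ?thesis
      using Cons.IH h False by (simp add: successively_append_iff reduced_comm_letter hd_comm_subst)
  qed (simp add: reduced_comm_letter)
qed simp

lemma comm_letter_flip: "reduced w \<Longrightarrow> foldr push (comm_letter a) (comm_letter (flip a) @ w) = w"
  by (cases a rule: comm_letter.cases) (auto simp: comm_word_def push_def)

lemma comm_subst_push: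
  assumes "reduced w"
  shows "comm_subst (push a w) = foldr push (comm_letter a) (comm_subst w)"
proof (cases "w \<noteq> [] \<and> hd w = flip a")
  case True
  then obtain v where w: "w = flip a # v" by (cases w) auto
  have "reduced (comm_subst v)" using assms w by (auto simp: successively_Cons intro!: reduced_comm_subst)
  then show ?thesis using w by (simp add: push_def comm_letter_flip)
next
  case False
  then have "reduced (a # w)" using assms by (auto simp: successively_Cons)
  then have "reduced (comm_letter a @ comm_subst w)" using reduced_comm_subst by fastforce
  then show ?thesis using False by (auto simp: push_def foldr_push_append)
qed

lemma comm_subst_foldr_push:
  "reduced v \<Longrightarrow> comm_subst (foldr push u v) = foldr push (comm_subst u) (comm_subst v)"
  by (induction u) (auto simp: comm_subst_push reduced_foldr_push)

lemma comm_subst_hom: "comm_subst \<in> hom reduced_words reduced_words"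
  by (auto simp: hom_def reduced_comm_subst comm_subst_foldr_push)

lemma comm_subst_pow_append: "(comm_subst ^^ n) (u @ v) = (comm_subst ^^ n) u @ (comm_subst ^^ n) v"
  by (induction n) auto

lemma length_comm_subst_pow: "length ((comm_subst ^^ n) w) = 4 ^ n * length w"
  by (induction n) (auto simp: length_comm_subst)

lemma comm_subst_pow_ne: "w \<noteq> [] \<Longrightarrow> (comm_subst ^^ n) w \<noteq> []"
  by (induction n) auto

lemma hd_comm_subst_pow:
  "w \<noteq> [] \<Longrightarrow> hd w = (True, i) \<Longrightarrow> hd ((comm_subst ^^ n) w) = (True, 2 ^ n * i)"
  by (induction n) (auto simp: hd_comm_subst comm_subst_pow_ne hd_comm_letter simp del: comm_letter.simps)

lemma last_comm_subst_pow:
  "w \<noteq> [] \<Longrightarrow> last w = (False, i) \<Longrightarrow> last ((comm_subst ^^ n) w) = (False, 2 ^ n * i)"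
  by (induction n) (auto simp: last_comm_subst comm_subst_pow_ne last_comm_letter simp del: comm_letter.simps)

text \<open>A \<open>p\<close>-th root would be cyclically reduced and its length would be \<open>4 ^ n div p\<close>; so \<open>p = 2\<close>,
  and the two halves of the word would coincide.\<close>

lemma iterated_commutator_not_power:
  assumes p: "prime (p::nat)" and z: "reduced z" "z [^]\<^bsub>reduced_words\<^esub> p = (comm_subst ^^ n) [(True, 1)]"
  shows False
proof -
  interpret group "reduced_words :: nat word monoid" by (rule group_reduced_words)
  define c where "c = (comm_subst ^^ n) [(True, 1)]"
  have c: "c \<noteq> []" "length c = 4 ^ n" "hd c = (True, 2 ^ n)"
    by (simp_all add: c_def comm_subst_pow_ne length_comm_subst_pow hd_comm_subst_pow)
  have p2: "2 \<le> p" using p by (rule prime_ge_2_nat)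
  have lc: "last c \<noteq> flip (hd c)"
  proof (cases n)
    case (Suc k)
    have "c = (comm_subst ^^ k) (comm_word 2 3)"
      unfolding c_def Suc funpow_Suc_right by simp
    then have "last c = (False, 2 ^ k * 3)"
      using last_comm_subst_pow[of "comm_word 2 3" 3 k] by (simp add: comm_word_def)
    then show ?thesis using c(3) Suc by simp
  qed (simp add: c_def)
  have "z \<noteq> []"
  proof
    assume "z = []"
    then have "c = []" using z(2) nat_pow_one[of p] by (simp add: c_def)
    then show False using c(1) by simp
  qed
  then obtain h y where y: "z = h @ y @ winv h" "y \<noteq> []" "hd y \<noteq> flip (last y)"
    using cyclically_reduced_decomposition z(1) by blast
  have r: "reduced h" "reduced (y @ winv h)" "reduced y" "reduced (h @ y)" "reduced ((h @ y) @ winv h)"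
    using z y by (auto simp: successively_append_iff)
  define q where "q = concat (replicate p y)"
  have q: "reduced q" "hd q = hd y" "last q = last y" "q \<noteq> []" "y [^]\<^bsub>reduced_words\<^esub> p = q"
    using reduced_power[OF r(3) y(2,3)] p2 y(2) by (auto simp: q_def)
  have hq: "reduced (h @ q)" "reduced ((h @ q) @ winv h)"
    using r q y(2) by (auto simp: successively_append_iff)
  have "z = h \<otimes>\<^bsub>reduced_words\<^esub> y \<otimes>\<^bsub>reduced_words\<^esub> inv\<^bsub>reduced_words\<^esub> h"
    using y r foldr_push_append[OF r(4)] foldr_push_append[OF r(5)] inv_reduced_words[OF r(1)] by simp
  then have "c = h \<otimes>\<^bsub>reduced_words\<^esub> q \<otimes>\<^bsub>reduced_words\<^esub> inv\<^bsub>reduced_words\<^esub> h"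
    using z(2) nat_pow_conj[of h y p] r q(5) by (simp add: c_def)
  then have "c = h @ q @ winv h"
    using foldr_push_append[OF hq(1)] foldr_push_append[OF hq(2)] inv_reduced_words[OF r(1)] by simp
  moreover have "h = []"
  proof (rule ccontr)
    assume "h \<noteq> []"
    then have "hd c = hd h" "last c = flip (hd h)" using calculation by (auto simp: last_winv)
    then show False using lc by simp
  qed
  ultimately have cq: "c = q" by simp
  have len: "p * length y = 4 ^ n" using c(2) by (simp add: cq q_def length_concat sum_list_replicate)
  then have "p dvd 4 ^ n" by (metis dvd_triv_left)
  then have "p dvd 4" by (rule prime_dvd_power[OF p])
  then have "p dvd 2 * 2" by simp
  then have "p dvd 2" using prime_dvd_multD[OF p] by blast
  then have peq: "p = 2" using p2 by (simp add: dvd_imp_le le_antisym)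
  then obtain k where k: "n = Suc k" using len by (cases n) auto
  \<comment> \<open>\<open>comm_subst [(True, 1)]\<close> consists of the letters
    \<open>(True, 2)\<close>, \<open>(True, 3)\<close>, \<open>(False, 2)\<close>,
    \<open>(False, 3)\<close>; \<open>a\<close> and \<open>b\<close> are the images of its two
    halves.\<close>
  define a b where "a = (comm_subst ^^ k) [(True, 2), (True, 3)]" and "b = (comm_subst ^^ k) [(False, 2), (False, 3)]"
  have cab: "c = a @ b"
    unfolding c_def k funpow_Suc_right a_def b_def by (simp add: comm_word_def flip: comm_subst_pow_append)
  have "length a = length y" using len peq k by (simp add: a_def length_comm_subst_pow)
  moreover have "c = y @ y" using cq peq by (simp add: q_def numeral_2_eq_2)
  ultimately have ab: "a = b" using cab by simp
  have ha: "hd a = (True, 2 ^ k * 2)" by (simp add: a_def hd_comm_subst_pow)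
  show False
  proof (cases k)
    case 0
    then show ?thesis using ab by (simp add: a_def b_def)
  next
    case (Suc j)
    \<comment> \<open>The letter \<open>(False, 2)\<close> goes to \<open>comm_word 5 4\<close>,
      whose first index 5 is odd, while the first index of \<open>a\<close> is a power of 2.\<close>
    have "hd b = (True, 2 ^ j * 5)"
      unfolding b_def Suc funpow_Suc_right
      using hd_comm_subst_pow[of "comm_subst [(False, 2), (False, 3)]" 5 j] by (simp add: comm_word_def)
    then show ?thesis using ha ab Suc by simp
  qed
qed

text \<open>By Bezout there are \<open>a\<close> and \<open>b\<close> with
  \<open>i * a = p * b + 1\<close>, and the \<open>a\<close>-th power of \<open>k\<close> times the
  \<open>b\<close>-th power of the inverse of \<open>c\<close> is the root. This will exclude
  torsion in the group that \<open>C\<close> and the new root generate.\<close>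

lemma prime_coprime_power_root:
  assumes "group G" "prime (p::nat)" "\<not> p dvd i" "c \<in> carrier G" "k \<in> carrier G" "k \<otimes>\<^bsub>G\<^esub> c = c \<otimes>\<^bsub>G\<^esub> k"
    and eq: "k [^]\<^bsub>G\<^esub> p = c [^]\<^bsub>G\<^esub> (i::nat)"
  shows "\<exists>y\<in>carrier G. y [^]\<^bsub>G\<^esub> p = c"
proof -
  interpret group G by fact
  have "coprime i p" using prime_imp_coprime[OF assms(2,3)] by (simp add: coprime_commute)
  moreover have "i \<noteq> 0" using assms(3) by (metis dvd_0_right)
  ultimately obtain a b where ab: "i * a = p * b + 1" using bezout_nat[of i p] by (metis coprime_imp_gcd_eq_1)
  define y where "y = k [^]\<^bsub>G\<^esub> a \<otimes>\<^bsub>G\<^esub> inv\<^bsub>G\<^esub> c [^]\<^bsub>G\<^esub> b"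
  have kc: "k \<otimes>\<^bsub>G\<^esub> inv\<^bsub>G\<^esub> c [^]\<^bsub>G\<^esub> b = inv\<^bsub>G\<^esub> c [^]\<^bsub>G\<^esub> b \<otimes>\<^bsub>G\<^esub> k"
    by (intro commutes_nat_pow commutes_inv) (use assms in auto)
  have kac: "k [^]\<^bsub>G\<^esub> a \<otimes>\<^bsub>G\<^esub> inv\<^bsub>G\<^esub> c [^]\<^bsub>G\<^esub> b = inv\<^bsub>G\<^esub> c [^]\<^bsub>G\<^esub> b \<otimes>\<^bsub>G\<^esub> k [^]\<^bsub>G\<^esub> a"
    by (rule commutes_nat_pow[symmetric]) (use assms kc in auto)
  have "y [^]\<^bsub>G\<^esub> p = (k [^]\<^bsub>G\<^esub> a) [^]\<^bsub>G\<^esub> p \<otimes>\<^bsub>G\<^esub> (inv\<^bsub>G\<^esub> c [^]\<^bsub>G\<^esub> b) [^]\<^bsub>G\<^esub> p"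
    unfolding y_def by (rule pow_mult_distrib[OF kac]) (use assms in auto)
  also have "(k [^]\<^bsub>G\<^esub> a) [^]\<^bsub>G\<^esub> p = (k [^]\<^bsub>G\<^esub> p) [^]\<^bsub>G\<^esub> a" using assms(5) by (simp add: nat_pow_pow mult.commute)
  also have "\<dots> = c [^]\<^bsub>G\<^esub> (p * b + 1)" unfolding eq using assms by (simp only: nat_pow_pow ab)
  also have "\<dots> = c \<otimes>\<^bsub>G\<^esub> c [^]\<^bsub>G\<^esub> (b * p)" using assms nat_pow_Suc2 by (simp add: mult.commute)
  also have "(inv\<^bsub>G\<^esub> c [^]\<^bsub>G\<^esub> b) [^]\<^bsub>G\<^esub> p = inv\<^bsub>G\<^esub> (c [^]\<^bsub>G\<^esub> (b * p))" using assms by (simp add: nat_pow_pow nat_pow_inv)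
  finally have "y [^]\<^bsub>G\<^esub> p = c" using assms by (simp add: m_assoc)
  then show ?thesis using assms by (intro bexI[of _ y]) (auto simp: y_def)
qed

section \<open>Adjoining a root\<close>

locale rootless_element = group G for G (structure) +
  fixes p :: nat and c :: 'a
  assumes csa: "csa G" and p: "prime p" and c: "c \<in> carrier G"
    and no_root: "y \<in> carrier G \<Longrightarrow> y [^] p \<noteq> c"
begin

lemma p_pos: "0 < p"
  using p prime_gt_0_nat by blast

definition C :: "'a set" where "C = {k \<in> carrier G. k \<otimes> c = c \<otimes> k}"

lemma C_carrier: "k \<in> C \<Longrightarrow> k \<in> carrier G"
  by (simp add: C_def)

lemma c_ne: "c \<noteq> \<one>"
  using no_root[of "\<one>"] by auto

lemma c_C: "c \<in> C"
  using c by (simp add: C_def)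

lemma C_mult: "k \<in> C \<Longrightarrow> l \<in> C \<Longrightarrow> k \<otimes> l \<in> C"
  using c by (auto simp: C_def) (metis m_assoc)

lemma C_pow: "k \<in> C \<Longrightarrow> k [^] (n::nat) \<in> C"
  using commutes_nat_pow[of c k n] c by (auto simp: C_def)

lemma C_comm: "k \<in> C \<Longrightarrow> l \<in> C \<Longrightarrow> k \<otimes> l = l \<otimes> k"
  using csa_centralizer_commute[OF csa c c_ne] by (auto simp: C_def)

lemma centralizer_C:
  assumes "k \<in> C" "k \<noteq> \<one>" "g \<in> carrier G" "g \<otimes> k = k \<otimes> g"
  shows "g \<in> C"
  using csa_centralizer_commute[OF csa _ assms(2,3) c assms(4)] assms by (auto simp: C_def)

lemma conj_centralizer_C:
  assumes "k \<in> C" "k \<noteq> \<one>" "g \<in> conj_centralizer G k"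
  shows "g \<in> C"
proof -
  have "k \<in> conj_centralizer G k"
    using assms(1) by (intro centralizer_conj_centralizer) (auto simp: C_def)
  then have "g \<otimes> k = k \<otimes> g"
    using csa_commute[OF csa _ assms(2,3)] assms(1) by (simp add: C_def)
  then show ?thesis using centralizer_C assms by (simp add: conj_centralizer_def)
qed

text \<open>The conjugate lies in the abelian group \<open>C\<close> and so commutes with
  \<open>k\<close>; this places \<open>inv t\<close> in the conjugating centralizer of
  \<open>k\<close>, which is contained in \<open>C\<close>. The lemma is what keeps fixed subtrees
  of the amalgam small.\<close>

lemma malnormal_C:
  assumes k: "k \<in> C" "k \<noteq> \<one>" and t: "t \<in> carrier G" "inv t \<otimes> k \<otimes> t \<in> C"
  shows "t \<in> C"
proof -
  have "inv t \<in> conj_centralizer G k"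
    using C_comm[OF t(2) k(1)] t k by (simp add: conj_centralizer_def C_def)
  then have "inv t \<in> C" by (rule conj_centralizer_C[OF k])
  then show ?thesis using commutes_inv[of c "inv t"] t c by (simp add: C_def)
qed

end

text \<open>The situation of the amalgam of \<open>G\<close> and \<open>C \<langle>r\<rangle>\<close> over the centralizer \<open>C\<close> of \<open>c = r\<^sup>p\<close>, acting
  on its tree: \<open>len g\<close> is half the distance between the vertex with stabilizer \<open>E ` carrier G\<close> and its
  translate by \<open>g\<close>.\<close>

locale root_extension = tree_group K d for K (structure) and d +
  fixes G :: "('g, 'n) monoid_scheme" and E :: "'g \<Rightarrow> 'a" and p :: nat and c :: 'g and r :: 'a
    and len :: "'a \<Rightarrow> nat"
  assumes G: "rootless_element G p c"
    and E: "E \<in> hom G K" and E_inj: "inj_on E (carrier G)"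
    and r: "r \<in> carrier K" and r_pow: "r [^] p = E c"
    and r_comm: "k \<in> carrier G \<Longrightarrow> k \<otimes>\<^bsub>G\<^esub> c = c \<otimes>\<^bsub>G\<^esub> k \<Longrightarrow> r \<otimes> E k = E k \<otimes> r"
    and d_len: "x \<in> carrier K \<Longrightarrow> d \<one> x = 2 * int (len x)"
    and len_0: "x \<in> carrier K \<Longrightarrow> len x = 0 \<longleftrightarrow> x \<in> E ` carrier G"
    and fixes_vertex: "e \<in> carrier G \<Longrightarrow> e \<noteq> \<one>\<^bsub>G\<^esub> \<Longrightarrow> x \<in> carrier K \<Longrightarrow> e' \<in> carrier G \<Longrightarrow> E e \<otimes> x = x \<otimes> E e' \<Longrightarrow>
      x \<notin> E ` carrier G \<Longrightarrow>
      len x \<le> 1 \<and> (\<exists>t\<in>carrier G. \<exists>i. \<exists>h\<in>carrier G. x = E t \<otimes> r [^] (i::nat) \<otimes> E h \<and>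
        (inv\<^bsub>G\<^esub> t \<otimes>\<^bsub>G\<^esub> e \<otimes>\<^bsub>G\<^esub> t) \<otimes>\<^bsub>G\<^esub> c = c \<otimes>\<^bsub>G\<^esub> (inv\<^bsub>G\<^esub> t \<otimes>\<^bsub>G\<^esub> e \<otimes>\<^bsub>G\<^esub> t))"
    and classification: "x \<in> carrier K \<Longrightarrow> \<exists>g\<in>carrier K. \<exists>y\<in>carrier K. x = g \<otimes> y \<otimes> inv g \<and>
      (y \<in> E ` carrier G \<or>
       (\<exists>i. \<exists>k\<in>carrier G. k \<otimes>\<^bsub>G\<^esub> c = c \<otimes>\<^bsub>G\<^esub> k \<and> y = r [^] (i::nat) \<otimes> E k) \<or>
       0 < len y \<and> (\<forall>n. len (y [^] n) = n * len y))"
begin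

section \<open>The abelian vertex group and the fixed vertices in a root extension\<close>

sublocale G: rootless_element G p c by (rule G)

sublocale E: group_hom G K E by unfold_locales (rule E)

text \<open>The vertex group \<open>C \<langle>r\<rangle>\<close>. Natural exponents suffice because
  \<open>r [^] p = E c\<close> provides the inverse of \<open>r\<close>.\<close>

definition D :: "'a set" where "D = {r [^] (i::nat) \<otimes> E k | i k. k \<in> G.C}"

lemma r_pow_comm: "k \<in> G.C \<Longrightarrow> E k \<otimes> r [^] (i::nat) = r [^] i \<otimes> E k"
  by (rule commutes_nat_pow) (use r r_comm in \<open>auto simp: G.C_def\<close>)

lemma D_carrier: "x \<in> D \<Longrightarrow> x \<in> carrier K"
  using r by (auto simp: D_def G.C_def)

lemma D_mult:
  assumes "k \<in> G.C" "l \<in> G.C"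
  shows "(r [^] (i::nat) \<otimes> E k) \<otimes> (r [^] (j::nat) \<otimes> E l) = r [^] (i + j) \<otimes> E (k \<otimes>\<^bsub>G\<^esub> l)"
proof -
  have kl: "k \<in> carrier G" "l \<in> carrier G" using assms G.C_carrier by auto
  have "E k \<otimes> (r [^] j \<otimes> E l) = r [^] j \<otimes> (E k \<otimes> E l)"
    using r_pow_comm[OF assms(1), of j] kl r by (simp flip: m_assoc)
  then show ?thesis using kl r by (simp add: m_assoc flip: nat_pow_mult)
qed

lemma D_comm: "x \<in> D \<Longrightarrow> y \<in> D \<Longrightarrow> x \<otimes> y = y \<otimes> x"
  using D_mult G.C_comm by (fastforce simp: D_def add.commute)

lemma E_C_D: "k \<in> G.C \<Longrightarrow> E k \<in> D"
  unfolding D_def by (intro CollectI exI[of _ 0] exI[of _ k]) (simp add: G.C_def)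

lemma D_pow:
  assumes "k \<in> G.C"
  shows "(r [^] (i::nat) \<otimes> E k) [^] (n::nat) = r [^] (i * n) \<otimes> E (k [^]\<^bsub>G\<^esub> n)"
proof (induction n)
  case (Suc n)
  then show ?case using D_mult[OF G.C_pow[OF assms] assms] by (simp add: add.commute)
qed simp

lemma D_pow_p:
  assumes "k \<in> G.C"
  shows "(r [^] (i::nat) \<otimes> E k) [^] p = E (c [^]\<^bsub>G\<^esub> i \<otimes>\<^bsub>G\<^esub> k [^]\<^bsub>G\<^esub> p)"
proof -
  have "r [^] (i * p) = E (c [^]\<^bsub>G\<^esub> i)"
  proof -
    have "r [^] (i * p) = (r [^] p) [^] i" using r by (simp add: nat_pow_pow mult.commute)
    then show ?thesis using r_pow G.c by (simp add: E.hom_nat_pow)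
  qed
  then show ?thesis using D_pow[OF assms] G.C_carrier[OF assms] G.c by simp
qed

lemma D_pow_p_C: "y \<in> D \<Longrightarrow> \<exists>k\<in>G.C. y [^] p = E k"
  unfolding D_def using D_pow_p G.C_mult G.C_pow G.c_C by blast

lemma E_eq_one: "e \<in> carrier G \<Longrightarrow> E e = \<one> \<Longrightarrow> e = \<one>\<^bsub>G\<^esub>"
  using inj_onD[OF E_inj, of e "\<one>\<^bsub>G\<^esub>"] by simp

lemma E_torsion_free:
  assumes "e \<in> carrier G" "0 < n" "E e [^] (n::nat) = \<one>"
  shows "E e = \<one>"
proof -
  have "E (e [^]\<^bsub>G\<^esub> n) = \<one>" using assms by (simp add: E.hom_nat_pow)
  then have "e [^]\<^bsub>G\<^esub> n = \<one>\<^bsub>G\<^esub>" using assms(1) by (simp add: E_eq_one)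
  then show ?thesis using csa_torsion_free[OF G.csa assms(1,2)] by simp
qed

text \<open>The \<open>p\<close>-th power of \<open>y\<close> lies in the torsion-free group
  \<open>E\<close>
  C\<open>and is therefore trivial. If\<close>p\<open>did not divide\<close>i\<open>, the resulting equation between powers of\<close>k\<open>and\<close>c\<open>would yield a\<close>p\<open>-th root of\<close>c\<open>in\<close>G\<open>; so\<close>p\<open>divides\<close>i\<open>, and\<close>y\<open>itself lies in\<close>E
  \<open>C\<close>.\<close>

lemma D_torsion_free:
  assumes y: "y \<in> D" "0 < n" "y [^] (n::nat) = \<one>"
  shows "y = \<one>"
proof -
  obtain i k where k: "k \<in> G.C" "y = r [^] (i::nat) \<otimes> E k" using y by (auto simp: D_def)
  have kc: "k \<in> carrier G" using k G.C_carrier by auto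
  let ?e = "c [^]\<^bsub>G\<^esub> i \<otimes>\<^bsub>G\<^esub> k [^]\<^bsub>G\<^esub> p"
  have e: "y [^] p = E ?e" "?e \<in> carrier G" using D_pow_p k kc G.c by auto
  have "E ?e [^] n = (y [^] n) [^] p"
    using D_carrier[OF y(1)] by (simp add: nat_pow_pow mult.commute flip: e(1))
  then have "E ?e = \<one>" using E_torsion_free[OF e(2) y(2)] y by simp
  then have "?e = \<one>\<^bsub>G\<^esub>" using e(2) by (simp add: E_eq_one)
  then have ck: "inv\<^bsub>G\<^esub> k [^]\<^bsub>G\<^esub> p = c [^]\<^bsub>G\<^esub> i"
    using kc G.c by (metis G.inv_equality G.inv_inv G.nat_pow_closed G.nat_pow_inv)
  have "p dvd i"
  proof (rule ccontr)
    assume "\<not> p dvd i"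
    moreover have "inv\<^bsub>G\<^esub> k \<otimes>\<^bsub>G\<^esub> c = c \<otimes>\<^bsub>G\<^esub> inv\<^bsub>G\<^esub> k"
      using G.commutes_inv[of c k] k(1) G.c by (auto simp: G.C_def)
    ultimately show False
      using prime_coprime_power_root[OF G.is_group G.p _ G.c _ _ ck] G.no_root kc by auto
  qed
  then obtain j where "i = p * j" by auto
  then have "r [^] i = E (c [^]\<^bsub>G\<^esub> j)" using r r_pow G.c by (simp add: E.hom_nat_pow flip: nat_pow_pow)
  then have "y = E (c [^]\<^bsub>G\<^esub> j \<otimes>\<^bsub>G\<^esub> k)" using k kc G.c by simp
  then show ?thesis using E_torsion_free[of "c [^]\<^bsub>G\<^esub> j \<otimes>\<^bsub>G\<^esub> k", OF _ y(2)] y(3) kc G.c by simp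
qed

lemma hyperbolic:
  assumes y: "y \<in> carrier K" "0 < len y" "\<And>n. len (y [^] (n::nat)) = n * len y"
  shows "hyperbolic_element K d y (2 * int (len y))"
proof unfold_locales
  show "d \<one> (y [^] n) = int n * (2 * int (len y))" for n :: nat
    using d_len[of "y [^] n"] y by simp
  show "e = \<one>" if e: "e \<in> carrier K" "e \<otimes> y = y \<otimes> e" "d \<one> e = 0" for e
  proof -
    obtain g where g: "g \<in> carrier G" "e = E g" using len_0[OF e(1)] d_len[OF e(1)] e(3) by auto
    \<comment> \<open>A nontrivial element that fixes the base vertex can fix its translate by
      \<open>x\<close> only if \<open>len x \<le> 1\<close>. As \<open>len y\<close> may be 1, the
      square of \<open>y\<close> is used.\<close>
    let ?z = "y [^] (2::nat)"
    have z: "?z \<in> carrier K" "\<not> len ?z \<le> 1" using y by auto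
    have "?z \<notin> E ` carrier G" using len_0[OF z(1)] z(2) by auto
    moreover have "E g \<otimes> ?z = ?z \<otimes> E g" using commutes_nat_pow[of e y 2] e y(1) g by simp
    ultimately show ?thesis using fixes_vertex[OF g(1) _ z(1) g(1)] z(2) g(2) by (cases "g = \<one>\<^bsub>G\<^esub>") auto
  qed
qed (use y in auto)

text \<open>An equation \<open>E e \<otimes> x = x \<otimes> E e'\<close> says that \<open>e\<close>
  fixes the translate of the base vertex by \<open>x\<close>. To fix another vertex besides the base
  vertex, \<open>e\<close> has to fix an edge there, and the stabilizers of these edges are the
  conjugates of \<open>C\<close> in \<open>G\<close>.\<close>

lemma fixes_one_vertex_or_conj_C:
  assumes "e \<in> carrier G"
  shows "(\<exists>t\<in>carrier G. \<exists>k\<in>G.C. e = t \<otimes>\<^bsub>G\<^esub> k \<otimes>\<^bsub>G\<^esub> inv\<^bsub>G\<^esub> t) \<or>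
    (\<forall>x\<in>carrier K. \<forall>e'\<in>carrier G. e \<noteq> \<one>\<^bsub>G\<^esub> \<longrightarrow> E e \<otimes> x = x \<otimes> E e' \<longrightarrow> x \<in> E ` carrier G)"
proof (cases "\<exists>t\<in>carrier G. \<exists>k\<in>G.C. e = t \<otimes>\<^bsub>G\<^esub> k \<otimes>\<^bsub>G\<^esub> inv\<^bsub>G\<^esub> t")
  case no: False
  have "inv\<^bsub>G\<^esub> t \<otimes>\<^bsub>G\<^esub> e \<otimes>\<^bsub>G\<^esub> t \<notin> G.C" if t: "t \<in> carrier G" for t
  proof
    assume C: "inv\<^bsub>G\<^esub> t \<otimes>\<^bsub>G\<^esub> e \<otimes>\<^bsub>G\<^esub> t \<in> G.C"
    have "t \<otimes>\<^bsub>G\<^esub> (inv\<^bsub>G\<^esub> t \<otimes>\<^bsub>G\<^esub> e \<otimes>\<^bsub>G\<^esub> t) \<otimes>\<^bsub>G\<^esub> inv\<^bsub>G\<^esub> t = e"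
      using G.conj_inv_conj[of "inv\<^bsub>G\<^esub> t" e] t assms by simp
    then show False using no t C by metis
  qed
  then have "\<forall>x\<in>carrier K. \<forall>e'\<in>carrier G. e \<noteq> \<one>\<^bsub>G\<^esub> \<longrightarrow> E e \<otimes> x = x \<otimes> E e' \<longrightarrow> x \<in> E ` carrier G"
    using fixes_vertex[OF assms] assms by (fastforce simp: G.C_def)
  then show ?thesis by (rule disjI2)
qed (rule disjI1)

text \<open>By malnormality the only edge at the base vertex that \<open>k\<close> fixes is the one
  with stabilizer \<open>C\<close>. So every translate of the base vertex fixed by \<open>k\<close>
  is a neighbour of the vertex with stabilizer \<open>D\<close>.\<close>

lemma fix_C:
  assumes k: "k \<in> G.C" "k \<noteq> \<one>\<^bsub>G\<^esub>" and x: "x \<in> carrier K" "e' \<in> carrier G" "E k \<otimes> x = x \<otimes> E e'"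
  shows "\<exists>i. \<exists>h\<in>carrier G. x = r [^] (i::nat) \<otimes> E h"
proof (cases "x \<in> E ` carrier G")
  case True
  then obtain h where "h \<in> carrier G" "x = E h" by auto
  then show ?thesis by (intro exI[of _ 0] bexI[of _ h]) auto
next
  case False
  obtain t i h where t: "t \<in> carrier G" "h \<in> carrier G" "x = E t \<otimes> r [^] (i::nat) \<otimes> E h"
    "inv\<^bsub>G\<^esub> t \<otimes>\<^bsub>G\<^esub> k \<otimes>\<^bsub>G\<^esub> t \<in> G.C"
    using fixes_vertex[OF G.C_carrier[OF k(1)] k(2) x False] G.C_carrier[OF k(1)] by (auto simp: G.C_def)
  have "t \<in> G.C" by (rule G.malnormal_C[OF k t(1,4)])
  then have "x = r [^] i \<otimes> E (t \<otimes>\<^bsub>G\<^esub> h)" using t r by (simp add: r_pow_comm m_assoc)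
  then show ?thesis using t by blast
qed

lemma r_pow_E_commute:
  assumes k: "k \<in> G.C" and h: "h \<in> carrier G" and eq: "(r [^] (i::nat) \<otimes> E h) \<otimes> E k = y \<otimes> (r [^] i \<otimes> E h)"
    and y: "y \<in> carrier K" "y \<otimes> r [^] i = r [^] i \<otimes> y"
  shows "E h \<otimes> E k = y \<otimes> E h"
proof -
  have "r [^] i \<otimes> (E h \<otimes> E k) = (y \<otimes> r [^] i) \<otimes> E h"
    using eq k h y(1) r G.C_carrier by (simp add: m_assoc)
  then have "r [^] i \<otimes> (E h \<otimes> E k) = r [^] i \<otimes> (y \<otimes> E h)"
    using y h r by (simp add: m_assoc)
  then show ?thesis using k h y r G.C_carrier by simp
qed

lemma centralizer_D:
  assumes k: "k \<in> G.C" "k \<noteq> \<one>\<^bsub>G\<^esub>" and x: "x \<in> carrier K" "E k \<otimes> x = x \<otimes> E k"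
  shows "x \<in> D"
proof -
  obtain i h where h: "h \<in> carrier G" "x = r [^] (i::nat) \<otimes> E h"
    using fix_C[OF k x(1) G.C_carrier[OF k(1)] x(2)] by auto
  have "E h \<otimes> E k = E k \<otimes> E h"
    by (rule r_pow_E_commute[OF k(1) h(1) x(2)[unfolded h(2), symmetric]])
      (use G.C_carrier[OF k(1)] r_pow_comm[OF k(1)] in auto)
  then have "E (h \<otimes>\<^bsub>G\<^esub> k) = E (k \<otimes>\<^bsub>G\<^esub> h)" using h k G.C_carrier by simp
  then have "h \<otimes>\<^bsub>G\<^esub> k = k \<otimes>\<^bsub>G\<^esub> h" using inj_onD[OF E_inj] h k G.C_carrier by auto
  then have "h \<in> G.C" using G.centralizer_C k h by auto
  then show ?thesis using h by (auto simp: D_def)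
qed

text \<open>The conjugate \<open>z\<close> of \<open>E k\<close> commutes with \<open>E k\<close>
  and so lies in \<open>D\<close>, though perhaps outside \<open>E\<close>
  C\<open>. Its\<close>p\<open>-th power is back in\<close>E \<open>C\<close> and nontrivial, which
  makes \<open>fix_C\<close> applicable to \<open>x\<close>. What remains after removing a power of
  \<open>r\<close> is a conjugation inside \<open>G\<close>.\<close>

lemma conj_centralizer_E_C:
  assumes k: "k \<in> G.C" "k \<noteq> \<one>\<^bsub>G\<^esub>" and x: "x \<in> conj_centralizer K (E k)"
  shows "x \<in> D"
proof -
  have xc: "x \<in> carrier K" using x by (simp add: conj_centralizer_def)
  have kc: "k \<in> carrier G" using k G.C_carrier by auto
  define z where "z = x \<otimes> E k \<otimes> inv x"
  have z: "z \<in> carrier K" "E k \<otimes> z = z \<otimes> E k"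
    using x kc by (auto simp: conj_centralizer_def z_def)
  then have zD: "z \<in> D" using centralizer_D[OF k] by auto
  obtain k' where k': "k' \<in> G.C" "z [^] p = E k'" using D_pow_p_C[OF zD] by auto
  have zp: "z [^] p = x \<otimes> E (k [^]\<^bsub>G\<^esub> p) \<otimes> inv x"
    using xc kc by (simp add: z_def nat_pow_conj E.hom_nat_pow)
  have "k' \<noteq> \<one>\<^bsub>G\<^esub>"
  proof
    assume "k' = \<one>\<^bsub>G\<^esub>"
    then have "E (k [^]\<^bsub>G\<^esub> p) = \<one>" using conj_eq_one[of x "E (k [^]\<^bsub>G\<^esub> p)"] zp k' xc kc by simp
    then show False using E_eq_one csa_torsion_free[OF G.csa kc G.p_pos] kc k by simp
  qed
  moreover have "E k' \<otimes> x = x \<otimes> E (k [^]\<^bsub>G\<^esub> p)"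
    using zp k' xc kc by (simp add: m_assoc)
  ultimately obtain i h where h: "h \<in> carrier G" "x = r [^] (i::nat) \<otimes> E h"
    using fix_C[OF k'(1) _ xc, of "k [^]\<^bsub>G\<^esub> p"] kc by auto
  have "r [^] i \<in> D"
    using G.c_C G.C_pow[of c 0] unfolding D_def by (intro CollectI exI[of _ i] exI[of _ "\<one>\<^bsub>G\<^esub>"]) (simp add: r)
  have "E h \<otimes> E k = z \<otimes> E h"
    by (rule r_pow_E_commute[OF k(1) h(1) _ z(1) D_comm[OF zD \<open>r [^] i \<in> D\<close>]])
      (use xc kc in \<open>simp add: z_def m_assoc flip: h(2)\<close>)
  then have "z = E (h \<otimes>\<^bsub>G\<^esub> k \<otimes>\<^bsub>G\<^esub> inv\<^bsub>G\<^esub> h)" using h(1) kc z(1) by (simp add: m_assoc)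
  then have "E ((h \<otimes>\<^bsub>G\<^esub> k \<otimes>\<^bsub>G\<^esub> inv\<^bsub>G\<^esub> h) \<otimes>\<^bsub>G\<^esub> k) = E (k \<otimes>\<^bsub>G\<^esub> (h \<otimes>\<^bsub>G\<^esub> k \<otimes>\<^bsub>G\<^esub> inv\<^bsub>G\<^esub> h))"
    using z(2) h(1) kc by simp
  then have "h \<in> conj_centralizer G k"
    using inj_onD[OF E_inj] h(1) kc by (simp add: conj_centralizer_def)
  then have "h \<in> G.C" by (rule G.conj_centralizer_C[OF k])
  then show ?thesis using h by (auto simp: D_def)
qed

lemma conj_centralizer_pow:
  assumes "y \<in> carrier K" "x \<in> conj_centralizer K y"
  shows "x \<in> conj_centralizer K (y [^] (n::nat))"
proof -
  have x: "x \<in> carrier K" using assms by (simp add: conj_centralizer_def)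
  define z where "z = x \<otimes> y \<otimes> inv x"
  have z: "z \<in> carrier K" "z \<otimes> y = y \<otimes> z" using assms x by (auto simp: conj_centralizer_def z_def)
  have "y [^] n \<otimes> z = z \<otimes> y [^] n" using commutes_nat_pow[OF z(1) assms(1) z(2)] by simp
  then have "y [^] n \<otimes> z [^] n = z [^] n \<otimes> y [^] n" using z assms by (intro commutes_nat_pow) auto
  then show ?thesis using x assms nat_pow_conj[OF x assms(1)] by (simp add: conj_centralizer_def z_def)
qed

lemma conj_centralizer_D_commute:
  assumes y: "y \<in> D" "y \<noteq> \<one>" and x: "x \<in> conj_centralizer K y" "x' \<in> conj_centralizer K y"
  shows "x \<otimes> x' = x' \<otimes> x"
proof -
  obtain k where k: "k \<in> G.C" "y [^] p = E k" using D_pow_p_C[OF y(1)] by auto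
  have "k \<noteq> \<one>\<^bsub>G\<^esub>" using D_torsion_free[OF y(1) G.p_pos] k y by auto
  then have "conj_centralizer K y \<subseteq> D"
    using conj_centralizer_E_C[OF k(1)] conj_centralizer_pow[OF D_carrier[OF y(1)], of _ p] k by auto
  then show ?thesis using D_comm x by blast
qed

text \<open>Here \<open>e\<close> fixes no translate of the base vertex but the base vertex itself.
  The element \<open>y\<close> obtained by conjugating \<open>E e\<close> with \<open>inv x\<close>
  commutes with \<open>E e\<close>, so it keeps this vertex and lies in the image of
  \<open>G\<close>. Then \<open>e\<close> also fixes the translate by \<open>x\<close>, so
  \<open>x\<close> lies in that image, and the claim descends to \<open>G\<close>.\<close>

lemma conj_centralizer_E_commute:
  assumes e: "e \<in> carrier G" "e \<noteq> \<one>\<^bsub>G\<^esub>" and no: "\<not> (\<exists>t\<in>carrier G. \<exists>k\<in>G.C. e = t \<otimes>\<^bsub>G\<^esub> k \<otimes>\<^bsub>G\<^esub> inv\<^bsub>G\<^esub> t)"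
    and x: "x \<in> conj_centralizer K (E e)" "x' \<in> conj_centralizer K (E e)"
  shows "x \<otimes> x' = x' \<otimes> x"
proof -
  have sub: "\<exists>g\<in>conj_centralizer G e. x = E g" if x: "x \<in> conj_centralizer K (E e)" for x
  proof -
    have fixed: "y \<in> E ` carrier G" if "y \<in> carrier K" "e' \<in> carrier G" "E e \<otimes> y = y \<otimes> E e'" for y e'
      using fixes_one_vertex_or_conj_C[OF e(1)] no e(2) that by blast
    have xc: "x \<in> carrier K" using x by (simp add: conj_centralizer_def)
    have Ee: "E e \<in> carrier K" using e by simp
    define y where "y = inv x \<otimes> E e \<otimes> x"
    have y: "y \<in> carrier K" using xc Ee by (simp add: y_def)
    have xyx: "x \<otimes> y \<otimes> inv x = E e" using conj_inv_conj[of "inv x" "E e"] xc Ee by (simp add: y_def)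
    have "(x \<otimes> E e \<otimes> inv x) \<otimes> E e = E e \<otimes> (x \<otimes> E e \<otimes> inv x)" using x by (simp add: conj_centralizer_def)
    then have "(x \<otimes> E e \<otimes> inv x) \<otimes> (x \<otimes> y \<otimes> inv x) = (x \<otimes> y \<otimes> inv x) \<otimes> (x \<otimes> E e \<otimes> inv x)"
      by (simp add: xyx)
    then have "x \<otimes> (E e \<otimes> y) \<otimes> inv x = x \<otimes> (y \<otimes> E e) \<otimes> inv x"
      by (simp add: conj_mult[OF xc Ee y] conj_mult[OF xc y Ee])
    then have "E e \<otimes> y = y \<otimes> E e" using xc y Ee by simp
    then obtain g' where g': "g' \<in> carrier G" "y = E g'" using fixed[OF y e(1)] by auto
    have "E e \<otimes> x = x \<otimes> E g'" using xyx xc y Ee unfolding g'(2)[symmetric] by (metis inv_solve_right' m_closed)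
    then obtain g where g: "g \<in> carrier G" "x = E g" using fixed[OF xc g'(1)] by auto
    have "E ((g \<otimes>\<^bsub>G\<^esub> e \<otimes>\<^bsub>G\<^esub> inv\<^bsub>G\<^esub> g) \<otimes>\<^bsub>G\<^esub> e) = E (e \<otimes>\<^bsub>G\<^esub> (g \<otimes>\<^bsub>G\<^esub> e \<otimes>\<^bsub>G\<^esub> inv\<^bsub>G\<^esub> g))"
      using x g e(1) by (simp add: conj_centralizer_def)
    then have "g \<in> conj_centralizer G e"
      using inj_onD[OF E_inj] g e(1) by (simp add: conj_centralizer_def)
    then show ?thesis using g by blast
  qed
  obtain g g' where g: "g \<in> conj_centralizer G e" "x = E g" "g' \<in> conj_centralizer G e" "x' = E g'"
    using sub x by meson
  have "g \<otimes>\<^bsub>G\<^esub> g' = g' \<otimes>\<^bsub>G\<^esub> g" by (rule csa_commute[OF G.csa e g(1,3)])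
  then show ?thesis using g by (auto simp: conj_centralizer_def simp flip: E.hom_mult)
qed

lemma torsion_free:
  assumes x: "x \<in> carrier K" "0 < n" "x [^] (n::nat) = \<one>"
  shows "x = \<one>"
proof -
  obtain g y where gy: "g \<in> carrier K" "y \<in> carrier K" "x = g \<otimes> y \<otimes> inv g"
    and cases: "y \<in> E ` carrier G \<or> (\<exists>i. \<exists>k\<in>carrier G. k \<otimes>\<^bsub>G\<^esub> c = c \<otimes>\<^bsub>G\<^esub> k \<and> y = r [^] (i::nat) \<otimes> E k) \<or>
      0 < len y \<and> (\<forall>n. len (y [^] n) = n * len y)"
    using classification[OF x(1)] by (elim bexE conjE) (rule that)
  have yn: "y [^] n = \<one>"
    using conj_eq_one[OF gy(1) nat_pow_closed[OF gy(2)]] x(3) nat_pow_conj[OF gy(1,2)] by (simp add: gy(3))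
  have "y = \<one>"
    using cases
  proof (elim disjE)
    assume "y \<in> E ` carrier G"
    then show ?thesis using E_torsion_free[OF _ x(2)] yn by auto
  next
    assume "\<exists>i. \<exists>k\<in>carrier G. k \<otimes>\<^bsub>G\<^esub> c = c \<otimes>\<^bsub>G\<^esub> k \<and> y = r [^] (i::nat) \<otimes> E k"
    then have "y \<in> D" by (auto simp: D_def G.C_def)
    then show ?thesis using D_torsion_free x(2) yn by blast
  next
    assume "0 < len y \<and> (\<forall>n. len (y [^] n) = n * len y)"
    moreover have "len \<one> = 0" using len_0[of \<one>] E.hom_one by (metis G.one_closed image_eqI one_closed)
    ultimately show ?thesis using x(2) yn by (metis mult_is_0 neq0_conv)
  qed
  then show ?thesis using gy by simp
qed

text \<open>Up to conjugation an element lies in the image of \<open>G\<close>, lies in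
  \<open>D\<close>, or is hyperbolic. Elements of \<open>G\<close> that are conjugate into
  \<open>C\<close> are treated as elements of \<open>D\<close>, since their conjugating centralizer
  need not stay inside the image of \<open>G\<close>.\<close>

lemma csa_extension: "csa K"
proof (rule csaI[OF torsion_free])
  fix x assume x: "x \<in> carrier K" "x \<noteq> \<one>"
  obtain g y where gy: "g \<in> carrier K" "y \<in> carrier K" "x = g \<otimes> y \<otimes> inv g"
    and cases: "y \<in> E ` carrier G \<or> (\<exists>i. \<exists>k\<in>carrier G. k \<otimes>\<^bsub>G\<^esub> c = c \<otimes>\<^bsub>G\<^esub> k \<and> y = r [^] (i::nat) \<otimes> E k) \<or>
      0 < len y \<and> (\<forall>n. len (y [^] n) = n * len y)"
    using classification[OF x(1)] by (elim bexE conjE) (rule that)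
  have y1: "y \<noteq> \<one>" using x(2) gy by auto
  have D: "\<exists>g\<in>carrier K. \<exists>y\<in>carrier K. x = g \<otimes> y \<otimes> inv g \<and>
      (\<forall>h\<in>conj_centralizer K y. \<forall>k\<in>conj_centralizer K y. h \<otimes> k = k \<otimes> h)"
    if "y \<in> D" "g \<in> carrier K" "x = g \<otimes> y \<otimes> inv g" for y g
  proof -
    have "y \<noteq> \<one>" using x(2) that by auto
    then show ?thesis using that conj_centralizer_D_commute D_carrier by blast
  qed
  show "\<exists>g\<in>carrier K. \<exists>y\<in>carrier K. x = g \<otimes> y \<otimes> inv g \<and>
      (\<forall>h\<in>conj_centralizer K y. \<forall>k\<in>conj_centralizer K y. h \<otimes> k = k \<otimes> h)"
    using cases
  proof (elim disjE)
    assume "y \<in> E ` carrier G"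
    then obtain e where e: "e \<in> carrier G" "y = E e" by auto
    have e1: "e \<noteq> \<one>\<^bsub>G\<^esub>" using y1 e by auto
    show ?thesis
    proof (cases "\<exists>t\<in>carrier G. \<exists>k\<in>G.C. e = t \<otimes>\<^bsub>G\<^esub> k \<otimes>\<^bsub>G\<^esub> inv\<^bsub>G\<^esub> t")
      case True
      then obtain t k where t: "t \<in> carrier G" "k \<in> G.C" "e = t \<otimes>\<^bsub>G\<^esub> k \<otimes>\<^bsub>G\<^esub> inv\<^bsub>G\<^esub> t" by auto
      show ?thesis
        by (rule D[of "E k" "g \<otimes> E t"])
          (use t gy e G.C_carrier[OF t(2)] E_C_D in \<open>auto simp: m_assoc inv_mult_group\<close>)
    next
      case False
      then show ?thesis using gy conj_centralizer_E_commute[OF e(1) e1 False] e(2) by blast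
    qed
  next
    assume "\<exists>i. \<exists>k\<in>carrier G. k \<otimes>\<^bsub>G\<^esub> c = c \<otimes>\<^bsub>G\<^esub> k \<and> y = r [^] (i::nat) \<otimes> E k"
    then have "y \<in> D" by (auto simp: D_def G.C_def)
    then show ?thesis using D gy by blast
  next
    assume "0 < len y \<and> (\<forall>n. len (y [^] n) = n * len y)"
    then interpret h: hyperbolic_element K d y "2 * int (len y)" using hyperbolic gy(2) by blast
    have "x \<in> carrier K \<and> x \<otimes> y = y \<otimes> x" if "x \<in> conj_centralizer K y" for x
      using h.conj_centralizer_commute[OF _ that] torsion_free that by (simp add: conj_centralizer_def)
    then have "\<forall>h\<in>conj_centralizer K y. \<forall>k\<in>conj_centralizer K y. h \<otimes> k = k \<otimes> h"
      using h.centralizer_commute by blast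
    then show ?thesis using gy by blast
  qed
qed

end

subsection \<open>Normal forms in the amalgam\<close>

text \<open>The coset \<open>C\<close> is represented by \<open>\<one>\<close>, so a power of
  \<open>r\<close> can be put in front of such a word without merging with its first
  syllable.\<close>

fun starts_outside :: "('a, 'm) monoid_scheme \<Rightarrow> ('a \<times> nat) list \<Rightarrow> bool" where
  "starts_outside G [] \<longleftrightarrow> True"
| "starts_outside G ((t, i) # w) \<longleftrightarrow> t \<noteq> \<one>\<^bsub>G\<^esub>"

text \<open>The word as a path from the base vertex in the Bass-Serre tree: every syllable
  contributes a step to a translate of the vertex of \<open>C \<langle>r\<rangle>\<close> and a step
  on to a translate of the base vertex. Hence the factor 2 between path length and number of
  syllables.\<close>

fun label :: "('a \<times> nat) list \<Rightarrow> ('a + nat) list" where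
  "label [] = []"
| "label ((t, i) # w) = Inl t # Inr i # label w"

lemma length_label: "length (label w) = 2 * length w"
  by (induction w rule: label.induct) auto

context rootless_element
begin

lemma one_C: "\<one> \<in> C"
  using c by (simp add: C_def)

lemma inv_C: "k \<in> C \<Longrightarrow> inv k \<in> C"
  using commutes_inv[of c k] c by (auto simp: C_def)

text \<open>The condition under \<open>SOME\<close> depends on \<open>g\<close> only through its
  left coset modulo \<open>C\<close>, so \<open>rep\<close> chooses one element of each coset; the
  coset \<open>C\<close> itself is given \<open>\<one>\<close>.\<close>

definition rep :: "'a \<Rightarrow> 'a" where
  "rep g = (if g \<in> C then \<one> else (SOME t. t \<in> carrier G \<and> inv t \<otimes> g \<in> C))"

definition rest :: "'a \<Rightarrow> 'a" where "rest g = inv (rep g) \<otimes> g"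

lemma rep_rest:
  assumes "g \<in> carrier G"
  shows "rep g \<in> carrier G" "rest g \<in> C"
proof -
  have "\<exists>t. t \<in> carrier G \<and> inv t \<otimes> g \<in> C" using assms one_C by (intro exI[of _ g]) simp
  from someI_ex[OF this] have "rep g \<in> carrier G \<and> rest g \<in> C"
    by (auto simp: rep_def rest_def C_carrier)
  then show "rep g \<in> carrier G" "rest g \<in> C" by auto
qed

lemma rep_mult_rest: "g \<in> carrier G \<Longrightarrow> rep g \<otimes> rest g = g"
  using rep_rest[of g] by (simp add: rest_def flip: m_assoc)

lemma C_mult_iff: "g \<in> carrier G \<Longrightarrow> k \<in> C \<Longrightarrow> g \<otimes> k \<in> C \<longleftrightarrow> g \<in> C"
proof
  assume "g \<in> carrier G" "k \<in> C" "g \<otimes> k \<in> C"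
  then show "g \<in> C" using C_mult[OF _ inv_C[of k], of "g \<otimes> k"] C_carrier by (simp add: m_assoc)
qed (rule C_mult)

lemma rep_mult_C:
  assumes "g \<in> carrier G" "k \<in> C"
  shows "rep (g \<otimes> k) = rep g"
proof -
  have "(t \<in> carrier G \<and> inv t \<otimes> (g \<otimes> k) \<in> C) = (t \<in> carrier G \<and> inv t \<otimes> g \<in> C)" for t
    using assms C_mult_iff[of "inv t \<otimes> g" k] C_carrier by (auto simp: m_assoc)
  then show ?thesis using assms by (simp add: rep_def C_mult_iff)
qed

lemma rep_eq_iff:
  assumes "g \<in> carrier G" "h \<in> carrier G"
  shows "rep g = rep h \<longleftrightarrow> inv g \<otimes> h \<in> C"
proof
  assume eq: "rep g = rep h"
  have "inv (rest g) \<otimes> rest h \<in> C" by (intro C_mult inv_C rep_rest assms)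
  moreover have "inv (rest g) \<otimes> rest h = inv g \<otimes> h"
  proof -
    define t where "t = rep h"
    have t: "t \<in> carrier G" using assms rep_rest by (simp add: t_def)
    have "rest g = inv t \<otimes> g" "rest h = inv t \<otimes> h" by (simp_all add: rest_def eq t_def)
    moreover have "t \<otimes> (inv t \<otimes> h) = h" using t assms by (simp flip: m_assoc)
    ultimately show ?thesis using t assms by (simp add: inv_mult_group m_assoc)
  qed
  ultimately show "inv g \<otimes> h \<in> C" by simp
next
  assume "inv g \<otimes> h \<in> C"
  then have "rep (g \<otimes> (inv g \<otimes> h)) = rep g" using rep_mult_C assms by blast
  then show "rep g = rep h" using assms by (simp flip: m_assoc)
qed

lemma rep_one_iff: "g \<in> carrier G \<Longrightarrow> rep g = \<one> \<longleftrightarrow> g \<in> C"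
proof
  assume "g \<in> carrier G" "rep g = \<one>"
  then show "g \<in> C" using rep_rest[of g] by (simp add: rest_def)
qed (simp add: rep_def)

lemma rep_rep: "g \<in> carrier G \<Longrightarrow> rep (rep g) = rep g"
  using rep_eq_iff[of "rep g" g] rep_rest by (simp add: rest_def)

lemma rest_rep: "t \<in> carrier G \<Longrightarrow> rep t = t \<Longrightarrow> rest t = \<one>"
  by (simp add: rest_def)

lemma rep_rest_of_C: "k \<in> C \<Longrightarrow> rep k = \<one>" "k \<in> C \<Longrightarrow> rest k = k"
  by (auto simp: rest_def rep_def C_carrier)

text \<open>The pair \<open>([(t\<^sub>1, i\<^sub>1), \<dots>, (t\<^sub>n, i\<^sub>n)], h)\<close> stands for \<open>t\<^sub>1 r\<^bsup>i\<^sub>1\<^esup> \<cdots> t\<^sub>n r\<^bsup>i\<^sub>n\<^esup> h\<close>.\<close>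

fun normal :: "('a \<times> nat) list \<Rightarrow> bool" where
  "normal [] \<longleftrightarrow> True"
| "normal ((t, i) # w) \<longleftrightarrow> t \<in> carrier G \<and> rep t = t \<and> 0 < i \<and> i < p \<and> starts_outside G w \<and> normal w"

definition forms :: "(('a \<times> nat) list \<times> 'a) set" where
  "forms = {(w, h). normal w \<and> h \<in> carrier G}"

lemma forms_iff [simp]: "(w, h) \<in> forms \<longleftrightarrow> normal w \<and> h \<in> carrier G"
  by (simp add: forms_def)

text \<open>Left multiplication by \<open>g\<close>. The factor \<open>rest (g \<otimes> t)\<close>
  lies in \<open>C\<close>, so it commutes with the power of \<open>r\<close> behind it and acts on
  the remaining word.\<close>

fun lact :: "'a \<Rightarrow> ('a \<times> nat) list \<times> 'a \<Rightarrow> ('a \<times> nat) list \<times> 'a" where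
  "lact g ([], h) = ([], g \<otimes> h)"
| "lact g ((t, i) # w, h) = apfst (Cons (rep (g \<otimes> t), i)) (lact (rest (g \<otimes> t)) (w, h))"

definition ract :: "('a \<times> nat) list \<times> 'a \<Rightarrow> ('a \<times> nat) list \<times> 'a" where
  "ract x = (case x of
      ((t, i) # w, h) \<Rightarrow>
        if t \<noteq> \<one> then ((\<one>, 1) # fst x, h)
        else if Suc i < p then ((\<one>, Suc i) # w, h)
        else lact c (w, h)
    | ([], h) \<Rightarrow> ([(\<one>, 1)], h))"

text \<open>The product of normal forms, again by van der Waerden's method: the left factor is read
  as a composite of the operators \<open>lact\<close> and \<open>ract\<close>. Associativity rests
  on three facts: \<open>lact\<close> is an action of \<open>G\<close>, \<open>ract\<close> commutes
  with the action of \<open>C\<close>, and the \<open>p\<close>-th iterate of \<open>ract\<close> is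
  the action of \<open>c\<close>.\<close>

fun act :: "('a \<times> nat) list \<times> 'a \<Rightarrow> ('a \<times> nat) list \<times> 'a \<Rightarrow> ('a \<times> nat) list \<times> 'a" where
  "act ([], g) x = lact g x"
| "act ((t, i) # w, g) x = lact t ((ract ^^ i) (act (w, g) x))"

lemma starts_outside_lact:
  assumes "k \<in> C" "normal (fst x)" "starts_outside G (fst x)"
  shows "starts_outside G (fst (lact k x))"
proof (cases "fst x")
  case (Cons a w)
  obtain t i where a: "a = (t, i)" by (cases a)
  obtain h where x: "x = ((t, i) # w, h)" using Cons a by (cases x) auto
  then have t: "t \<in> carrier G" "rep t = t" "t \<noteq> \<one>" using assms by auto
  then have "t \<notin> C" using rep_one_iff[of t] by simp
  have "k \<otimes> t \<notin> C"
  proof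
    assume "k \<otimes> t \<in> C"
    then have "inv k \<otimes> (k \<otimes> t) \<in> C" by (rule C_mult[OF inv_C[OF assms(1)]])
    then show False using \<open>t \<notin> C\<close> t C_carrier[OF assms(1)] by (simp flip: m_assoc)
  qed
  then show ?thesis using x t rep_one_iff C_carrier[OF assms(1)] by simp
qed (cases x; simp)

lemma lact_forms: "g \<in> carrier G \<Longrightarrow> x \<in> forms \<Longrightarrow> lact g x \<in> forms"
proof (induction g x rule: lact.induct)
  case (2 g t i w h)
  let ?k = "rest (g \<otimes> t)"
  have t: "t \<in> carrier G" "g \<otimes> t \<in> carrier G" using 2 by auto
  have k: "?k \<in> C" using rep_rest t by auto
  obtain w' h' where w': "lact ?k (w, h) = (w', h')" by (cases "lact ?k (w, h)")
  have "starts_outside G w'" using starts_outside_lact[OF k, of "(w, h)"] 2 w' by simp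
  then show ?case using 2 k t C_carrier w' rep_rest rep_rep by simp
qed auto

lemma length_lact: "length (fst (lact g x)) = length (fst x)"
  by (induction g x rule: lact.induct) auto

lemma lact_lact:
  "g \<in> carrier G \<Longrightarrow> h \<in> carrier G \<Longrightarrow> x \<in> forms \<Longrightarrow> lact g (lact h x) = lact (g \<otimes> h) x"
proof (induction h x arbitrary: g rule: lact.induct)
  case (1 h k)
  then show ?case by (simp add: m_assoc)
next
  case (2 h t i w k)
  let ?u = "h \<otimes> t"
  have t: "t \<in> carrier G" "?u \<in> carrier G" "g \<otimes> ?u \<in> carrier G" using 2 by auto
  have ru: "rep ?u \<in> carrier G" "rest ?u \<in> C" "rest ?u \<in> carrier G" using rep_rest t C_carrier by auto
  have e: "g \<otimes> ?u = (g \<otimes> rep ?u) \<otimes> rest ?u" using rep_mult_rest[OF t(2)] 2 ru by (simp add: m_assoc)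
  have r1: "rep (g \<otimes> rep ?u) = rep (g \<otimes> ?u)" using rep_mult_C[OF _ ru(2), of "g \<otimes> rep ?u"] e 2 ru by simp
  have r2: "rest (g \<otimes> rep ?u) \<otimes> rest ?u = rest (g \<otimes> ?u)"
    using r1 e 2 ru t rep_rest[OF t(3)] by (simp add: rest_def[of "g \<otimes> _"] m_assoc)
  have "rest (g \<otimes> rep ?u) \<in> carrier G" using rep_rest C_carrier ru 2 by blast
  then show ?case using 2 ru r1 r2 t by (simp add: m_assoc prod.case_eq_if apfst_def map_prod_def)
qed

lemma lact_one: "x \<in> forms \<Longrightarrow> lact \<one> x = x"
proof -
  have "normal w \<Longrightarrow> h \<in> carrier G \<Longrightarrow> lact \<one> (w, h) = (w, h)" for w h
    by (induction w rule: normal.induct) (auto simp: rest_rep)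
  then show "x \<in> forms \<Longrightarrow> lact \<one> x = x" by (cases x) simp
qed

lemma lact_mult_right:
  "g \<in> carrier G \<Longrightarrow> x \<in> forms \<Longrightarrow> k \<in> carrier G \<Longrightarrow>
    lact g (fst x, snd x \<otimes> k) = apsnd (\<lambda>h. h \<otimes> k) (lact g x)"
proof (induction g x rule: lact.induct)
  case (1 g h)
  then show ?case by (simp add: m_assoc)
next
  case (2 g t i w h)
  have "rest (g \<otimes> t) \<in> carrier G" using rep_rest C_carrier 2 by simp
  then show ?case using 2 by simp
qed

lemma p_ge_2: "2 \<le> p"
  using p by (rule prime_ge_2_nat)

lemma ract_simps:
  "ract ([], h) = ([(\<one>, 1)], h)"
  "t \<noteq> \<one> \<Longrightarrow> ract ((t, i) # w, h) = ((\<one>, 1) # (t, i) # w, h)"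
  "ract ((\<one>, i) # w, h) = (if Suc i < p then ((\<one>, Suc i) # w, h) else lact c (w, h))"
  by (simp_all add: ract_def)

lemma forms_cases [consumes 1, case_names Nil outside one]:
  assumes "x \<in> forms"
    "\<And>h. x = ([], h) \<Longrightarrow> h \<in> carrier G \<Longrightarrow> P"
    "\<And>t i w h. x = ((t, i) # w, h) \<Longrightarrow> t \<noteq> \<one> \<Longrightarrow> (w, h) \<in> forms \<Longrightarrow> P"
    "\<And>i w h. x = ((\<one>, i) # w, h) \<Longrightarrow> 0 < i \<Longrightarrow> i < p \<Longrightarrow> starts_outside G w \<Longrightarrow> (w, h) \<in> forms \<Longrightarrow> P"
  shows P
proof (cases x)
  case (Pair w h)
  show ?thesis
  proof (cases w)
    case (Cons a v)
    then show ?thesis using assms Pair by (cases a; cases "fst a = \<one>") auto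
  qed (use assms Pair in auto)
qed

lemma ract_forms: "x \<in> forms \<Longrightarrow> ract x \<in> forms"
  by (cases x rule: forms_cases)
    (use p_ge_2 c lact_forms in \<open>auto simp: ract_simps rep_rest_of_C one_C\<close>)

lemma ract_funpow_forms: "x \<in> forms \<Longrightarrow> (ract ^^ n) x \<in> forms"
  by (induction n) (auto intro: ract_forms)

lemma lact_C_one: "k \<in> C \<Longrightarrow> lact k ((\<one>, i) # w, h) = apfst (Cons (\<one>, i)) (lact k (w, h))"
  by (simp add: rep_rest_of_C C_carrier)

lemma ract_lact:
  assumes k: "k \<in> C" and x: "x \<in> forms"
  shows "ract (lact k x) = lact k (ract x)"
  using x
proof (cases x rule: forms_cases)
  case (Nil h)
  then show ?thesis using k C_carrier by (simp add: ract_simps lact_C_one del: lact.simps(2))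
next
  case (outside t i w h)
  have "rep (k \<otimes> t) \<noteq> \<one>"
    using starts_outside_lact[OF k, of x] outside x by auto
  then show ?thesis using outside k
    by (simp add: ract_simps lact_C_one prod.case_eq_if apfst_def map_prod_def rep_rest_of_C C_carrier)
next
  case (one i w h)
  have "lact k (lact c (w, h)) = lact c (lact k (w, h))"
    using lact_lact[OF _ _ one(5)] C_carrier[OF k] c C_comm[OF k c_C] by simp
  then show ?thesis using one k
    by (cases "lact k (w, h)") (simp add: ract_simps rep_rest_of_C C_carrier)
qed

lemma ract_funpow_lact:
  "k \<in> C \<Longrightarrow> x \<in> forms \<Longrightarrow> (ract ^^ n) (lact k x) = lact k ((ract ^^ n) x)"
  by (induction n) (auto simp: ract_lact ract_funpow_forms)

lemma ract_funpow_outside: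
  assumes "starts_outside G w"
  shows "Suc i < p \<Longrightarrow> (ract ^^ Suc i) (w, h) = ((\<one>, Suc i) # w, h)"
proof (induction i)
  case 0
  then show ?case using assms by (cases "(G, w)" rule: starts_outside.cases) (auto simp: ract_simps)
qed (simp add: ract_simps)

lemma ract_funpow_p_outside:
  assumes "starts_outside G w"
  shows "(ract ^^ p) (w, h) = lact c (w, h)"
proof -
  obtain j where j: "Suc (Suc j) = p" using p_ge_2 by (metis add_2_eq_Suc le_Suc_ex)
  have "(ract ^^ Suc (Suc j)) (w, h) = ract ((ract ^^ Suc j) (w, h))" by simp
  also have "(ract ^^ Suc j) (w, h) = ((\<one>, Suc j) # w, h)"
    using ract_funpow_outside[OF assms, of j h] j by simp
  also have "ract \<dots> = lact c (w, h)" using j by (simp add: ract_simps)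
  finally show ?thesis unfolding j .
qed

text \<open>A form whose first syllable is a power of \<open>r\<close> arises by iterating
  \<open>ract\<close> from a form that starts outside \<open>C\<close>. Iterates of
  \<open>ract\<close> commute with each other and with the action of \<open>c\<close>, so the latter
  forms decide.\<close>

lemma ract_funpow_p:
  assumes "x \<in> forms"
  shows "(ract ^^ p) x = lact c x"
  using assms
proof (cases x rule: forms_cases)
  case (one i w h)
  obtain j where j: "i = Suc j" using one by (cases i) auto
  have x: "x = (ract ^^ i) (w, h)" using ract_funpow_outside[OF one(4), of j] one j by simp
  have "(ract ^^ p) x = (ract ^^ i) ((ract ^^ p) (w, h))"
    unfolding x by (metis add.commute comp_apply funpow_add)
  then show ?thesis
    using ract_funpow_p_outside[OF one(4)] ract_funpow_lact[OF c_C one(5)] x by simp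
qed (use ract_funpow_p_outside in auto)

lemma act_forms: "a \<in> forms \<Longrightarrow> x \<in> forms \<Longrightarrow> act a x \<in> forms"
  by (induction a x rule: act.induct) (auto intro!: lact_forms ract_funpow_forms)

lemma lact_act: "g \<in> carrier G \<Longrightarrow> a \<in> forms \<Longrightarrow> x \<in> forms \<Longrightarrow> act (lact g a) x = lact g (act a x)"
proof (induction a x arbitrary: g rule: act.induct)
  case (1 h x)
  then show ?case by (simp add: lact_lact)
next
  case (2 t i w h x)
  let ?u = "g \<otimes> t"
  have u: "?u \<in> carrier G" "t \<in> carrier G" "(w, h) \<in> forms" using 2 by auto
  have ru: "rep ?u \<in> carrier G" "rest ?u \<in> C" "rest ?u \<in> carrier G" using rep_rest u C_carrier by auto
  have ax: "act (w, h) x \<in> forms" using act_forms u 2 by blast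
  let ?y = "(ract ^^ i) (act (w, h) x)"
  have "act (lact g ((t, i) # w, h)) x = lact (rep ?u) ((ract ^^ i) (act (lact (rest ?u) (w, h)) x))"
    by (cases "lact (rest ?u) (w, h)") simp
  also have "\<dots> = lact (rep ?u) (lact (rest ?u) ?y)"
    using 2 u ru ax by (simp add: ract_funpow_lact)
  also have "\<dots> = lact ?u ?y" using lact_lact ru ract_funpow_forms[OF ax] rep_mult_rest[OF u(1)] by simp
  also have "\<dots> = lact g (act ((t, i) # w, h) x)" using lact_lact 2 u ract_funpow_forms[OF ax] by simp
  finally show ?case .
qed

lemma ract_act:
  assumes "a \<in> forms" "x \<in> forms"
  shows "act (ract a) x = ract (act a x)"
  using assms(1)
proof (cases a rule: forms_cases)
  case (Nil h)
  then show ?thesis using assms by (simp add: ract_simps lact_one lact_forms ract_forms)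
next
  case (outside t i w h)
  then show ?thesis
    using assms act_forms[OF assms] by (simp add: ract_simps lact_one ract_forms)
next
  case (one i w h)
  have f: "act (w, h) x \<in> forms" using act_forms one assms by blast
  have a: "act a x = (ract ^^ i) (act (w, h) x)"
    using one f by (simp add: lact_one ract_funpow_forms)
  show ?thesis
  proof (cases "Suc i < p")
    case True
    have "act (ract a) x = (ract ^^ Suc i) (act (w, h) x)"
      unfolding one(1) ract_simps using True lact_one[OF ract_funpow_forms[OF f, of "Suc i"]] by simp
    then show ?thesis using a by simp
  next
    case False
    then have "p = Suc i" using one by simp
    then have "ract (act a x) = lact c (act (w, h) x)" using a ract_funpow_p[OF f] by simp
    then show ?thesis using False one lact_act[OF c one(5) assms(2)] by (simp add: ract_simps)
  qed
qed

lemma ract_funpow_act: "a \<in> forms \<Longrightarrow> x \<in> forms \<Longrightarrow> act ((ract ^^ n) a) x = (ract ^^ n) (act a x)"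
  by (induction n) (auto simp: ract_act ract_funpow_forms)

lemma act_act: "a \<in> forms \<Longrightarrow> b \<in> forms \<Longrightarrow> x \<in> forms \<Longrightarrow> act (act a b) x = act a (act b x)"
  by (induction a b rule: act.induct)
    (auto simp: lact_act ract_funpow_act act_forms ract_funpow_forms)

lemma act_one: "a \<in> forms \<Longrightarrow> act a ([], \<one>) = a"
proof (induction a "([], \<one>) :: ('a \<times> nat) list \<times> 'a" rule: act.induct)
  case (2 t i w h)
  obtain j where j: "i = Suc j" using 2 by (cases i) auto
  have "(ract ^^ i) (w, h) = ((\<one>, i) # w, h)" using ract_funpow_outside[of w j h] 2 j by simp
  then show ?case using 2 by (simp add: rest_rep lact_one)
qed simp

definition adjoined :: "(('a \<times> nat) list \<times> 'a) monoid" where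
  "adjoined = \<lparr>carrier = forms, monoid.mult = act, one = ([], \<one>)\<rparr>"

lemma adjoined_simps [simp]:
  "carrier adjoined = forms" "x \<otimes>\<^bsub>adjoined\<^esub> y = act x y" "\<one>\<^bsub>adjoined\<^esub> = ([], \<one>)"
  by (simp_all add: adjoined_def)

definition adj_root :: "('a \<times> nat) list \<times> 'a" where "adj_root = ([(\<one>, 1)], \<one>)"

lemma root_forms: "adj_root \<in> forms"
  using p_ge_2 one_C by (simp add: adj_root_def rep_rest_of_C)

lemma act_root: "x \<in> forms \<Longrightarrow> act adj_root x = ract x"
  by (simp add: adj_root_def lact_one ract_forms)

lemma act_left_inverse:
  assumes "x \<in> forms"
  shows "\<exists>y\<in>forms. act y x = ([], \<one>)"
proof -
  have "normal w \<Longrightarrow> h \<in> carrier G \<Longrightarrow> \<exists>y\<in>forms. act y (w, h) = ([], \<one>)" for w h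
  proof (induction w rule: normal.induct)
    case 1
    then show ?case by (intro bexI[of _ "([], inv h)"]) auto
  next
    case (2 t i w)
    then obtain y where y: "y \<in> forms" "act y (w, h) = ([], \<one>)" by auto
    have wf: "(w, h) \<in> forms" and t: "t \<in> carrier G" using 2 by auto
    obtain j where j: "i = Suc j" using 2 by (cases i) auto
    have ri: "(ract ^^ i) (w, h) = ((\<one>, i) # w, h)" using ract_funpow_outside[of w j h] 2 j by simp
    let ?x = "((t, i) # w, h)" and ?s = "([], inv c \<otimes> inv t)"
    have x: "?x = lact t ((ract ^^ i) (w, h))" using 2 ri by (simp add: rest_rep lact_one)
    have xf: "?x \<in> forms" and sf: "?s \<in> forms" using 2 c by auto
    \<comment> \<open>The inverse of \<open>t\<close> times the \<open>i\<close>-th power of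
      \<open>r\<close>: because the \<open>p\<close>-th power of \<open>r\<close> is
      \<open>c\<close>, the inverse of that power is its \<open>(p - i)\<close>-th power times
      \<open>inv c\<close>.\<close>
    let ?z = "(ract ^^ (p - i)) ?s"
    have zf: "?z \<in> forms" using ract_funpow_forms sf by blast
    have "act ?z ?x = (ract ^^ (p - i)) (lact (inv c \<otimes> inv t) ?x)" using ract_funpow_act[OF sf xf] by simp
    also have "lact (inv c \<otimes> inv t) ?x = lact (inv c) ((ract ^^ i) (w, h))"
      unfolding x using lact_lact[OF _ t ract_funpow_forms[OF wf]] c t by (simp add: m_assoc)
    also have "\<dots> = (ract ^^ i) (lact (inv c) (w, h))" using ract_funpow_lact[OF inv_C[OF c_C] wf] by simp
    also have "(ract ^^ (p - i)) \<dots> = (ract ^^ p) (lact (inv c) (w, h))"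
      using 2 by (simp flip: funpow_add[THEN fun_cong, unfolded comp_apply])
    also have "\<dots> = lact c (lact (inv c) (w, h))" using ract_funpow_p lact_forms wf c by simp
    also have "\<dots> = (w, h)" using lact_lact[OF c _ wf] lact_one[OF wf] c by simp
    finally have "act (act y ?z) ?x = ([], \<one>)" using act_act[OF y(1) zf xf] y by simp
    then show ?case using act_forms[OF y(1) zf] by blast
  qed
  then show ?thesis using assms by (cases x) auto
qed

lemma group_adjoined: "group adjoined"
  by (rule groupI) (auto simp: act_forms act_act lact_one intro: act_left_inverse[simplified])

lemma root_pow: "adj_root [^]\<^bsub>adjoined\<^esub> n = (ract ^^ n) ([], \<one>)"
proof -
  interpret K: group adjoined by (rule group_adjoined)
  show ?thesis
  proof (induction n)
    case (Suc n)
    have "adj_root [^]\<^bsub>adjoined\<^esub> Suc n = adj_root \<otimes>\<^bsub>adjoined\<^esub> adj_root [^]\<^bsub>adjoined\<^esub> n"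
      by (rule K.nat_pow_Suc2) (use root_forms in simp)
    then show ?case using Suc act_root[OF ract_funpow_forms[of "([], \<one>)" n]] by simp
  qed simp
qed

lemma act_root_pow: "x \<in> forms \<Longrightarrow> act (adj_root [^]\<^bsub>adjoined\<^esub> n) x = (ract ^^ n) x"
  unfolding root_pow by (simp add: ract_funpow_act lact_one)

lemma embed_hom: "(\<lambda>g. ([], g)) \<in> hom G adjoined"
  by (auto simp: hom_def)

section \<open>The tree metric on normal forms\<close>

lemma lcp_label_lact:
  "g \<in> carrier G \<Longrightarrow> x \<in> forms \<Longrightarrow> y \<in> forms \<Longrightarrow>
    lcp (label (fst (lact g x))) (label (fst (lact g y))) = lcp (label (fst x)) (label (fst y))"
proof (induction g x arbitrary: y rule: lact.induct)
  case (2 g t i w h)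
  have t: "t \<in> carrier G" "rep t = t" "g \<in> carrier G" using 2 by auto
  show ?case
  proof (cases "fst y")
    case (Cons a v)
    obtain s j where a: "a = (s, j)" by (cases a)
    obtain k where y: "y = ((s, j) # v, k)" using Cons a by (cases y) auto
    have s: "s \<in> carrier G" "rep s = s" "(v, k) \<in> forms" using 2 y by auto
    have "inv g \<otimes> (g \<otimes> s) = s" using t s by (simp flip: m_assoc)
    then have "inv (g \<otimes> t) \<otimes> (g \<otimes> s) = inv t \<otimes> s"
      using t s by (simp add: inv_mult_group m_assoc)
    then have "rep (g \<otimes> t) = rep (g \<otimes> s) \<longleftrightarrow> t = s"
      using rep_eq_iff[of "g \<otimes> t" "g \<otimes> s"] rep_eq_iff[of t s] t s by simp
    moreover have "rest (g \<otimes> t) \<in> carrier G" using rep_rest C_carrier t by simp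
    ultimately show ?thesis using 2 y s by auto
  qed (cases y; simp)
qed simp

definition dist :: "('a \<times> nat) list \<times> 'a \<Rightarrow> ('a \<times> nat) list \<times> 'a \<Rightarrow> int" where
  "dist x y = tree_dist (label (fst x)) (label (fst y))"

lemma dist_lact: "g \<in> carrier G \<Longrightarrow> x \<in> forms \<Longrightarrow> y \<in> forms \<Longrightarrow> dist (lact g x) (lact g y) = dist x y"
  by (simp add: dist_def tree_dist_def lcp_label_lact length_label length_lact)

lemma lcp_label_outside:
  assumes "starts_outside G w"
  shows "lcp (label w) (Inl \<one> # u) = 0" "lcp (Inl \<one> # u) (label w) = 0"
  using assms by (cases "(G, w)" rule: starts_outside.cases; auto)+

lemma forms_outside_cases:
  assumes "x \<in> forms"
  obtains (outside) "starts_outside G (fst x)" "ract x = ((\<one>, 1) # fst x, snd x)"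
    | (one) i w h where "x = ((\<one>, i) # w, h)" "0 < i" "i < p" "starts_outside G w" "(w, h) \<in> forms"
  using assms by (cases x rule: forms_cases) (auto simp: ract_simps)

text \<open>In the mixed case one form gains a syllable beginning with \<open>\<one>\<close>. The
  other either keeps its first entry \<open>\<one>\<close> with a raised exponent, so that exactly
  this entry becomes common, or reaches the exponent \<open>p\<close> and loses a syllable. Both
  changes balance.\<close>

lemma dist_ract:
  assumes x: "x \<in> forms" and y: "y \<in> forms"
  shows "dist (ract x) (ract y) = dist x y"
proof -
  have mixed: "dist (ract x) (ract y) = dist x y"
    if x: "starts_outside G (fst x)" "ract x = ((\<one>, 1) # fst x, snd x)"
      and y: "y = ((\<one>, i) # w, h)" "0 < i" "starts_outside G w" "(w, h) \<in> forms" for x y i w h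
  proof (cases "Suc i < p")
    case True
    then show ?thesis using x y
      by (simp add: dist_def tree_dist_def ract_simps length_label lcp_label_outside)
  next
    case False
    have "starts_outside G (fst (lact c (w, h)))" by (rule starts_outside_lact[OF c_C]) (use y in auto)
    then show ?thesis using x y False
      by (simp add: dist_def tree_dist_def ract_simps length_label length_lact lcp_label_outside)
  qed
  show ?thesis
    using x
  proof (cases rule: forms_outside_cases)
    case outside
    note X = this
    show ?thesis using y
    proof (cases rule: forms_outside_cases)
      case outside
      then show ?thesis using X by (simp add: dist_def tree_dist_def)
    next
      case one
      then show ?thesis using mixed X by blast
    qed
  next
    case (one i w h)
    note X = this
    show ?thesis using y
    proof (cases rule: forms_outside_cases)
      case outside
      then show ?thesis using mixed[OF outside X(1,2,4,5)] by (simp add: dist_def tree_dist_commute)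
    next
      case (one j v k)
      have o: "starts_outside G (fst (lact c (w, h)))" "starts_outside G (fst (lact c (v, k)))"
        by (rule starts_outside_lact[OF c_C]; use X one in simp)+
      show ?thesis
        using X one o lcp_label_lact[OF c X(5) one(5)]
        by (auto simp: dist_def tree_dist_def ract_simps length_label length_lact lcp_label_outside)
    qed
  qed
qed

lemma dist_ract_funpow: "x \<in> forms \<Longrightarrow> y \<in> forms \<Longrightarrow> dist ((ract ^^ n) x) ((ract ^^ n) y) = dist x y"
  by (induction n) (auto simp: dist_ract ract_funpow_forms)

lemma dist_act: "a \<in> forms \<Longrightarrow> x \<in> forms \<Longrightarrow> y \<in> forms \<Longrightarrow> dist (act a x) (act a y) = dist x y"
  by (induction a x rule: act.induct)
    (auto simp: dist_lact dist_ract_funpow act_forms ract_funpow_forms)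

lemma tree_group_adjoined: "tree_group adjoined dist"
proof -
  interpret K: group adjoined by (rule group_adjoined)
  show ?thesis
    by unfold_locales
      (auto simp: dist_act[unfolded dist_def] dist_def tree_dist_self intro: tree_dist_commute tree_dist_four_point)
qed

lemma ract_mult_right:
  assumes "x \<in> forms" "k \<in> carrier G"
  shows "ract (fst x, snd x \<otimes> k) = apsnd (\<lambda>h. h \<otimes> k) (ract x)"
  using assms(1)
proof (cases x rule: forms_cases)
  case (one i w h)
  then show ?thesis using lact_mult_right[OF c one(5) assms(2)] by (simp add: ract_simps)
qed (auto simp: ract_simps)

lemma ract_funpow_mult_right:
  assumes "x \<in> forms" "k \<in> carrier G"
  shows "(ract ^^ n) (fst x, snd x \<otimes> k) = apsnd (\<lambda>h. h \<otimes> k) ((ract ^^ n) x)"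
proof (induction n)
  case (Suc n)
  have "apsnd (\<lambda>h. h \<otimes> k) ((ract ^^ n) x) = (fst ((ract ^^ n) x), snd ((ract ^^ n) x) \<otimes> k)"
    by (simp add: prod_eq_iff)
  then show ?case using Suc ract_mult_right[OF ract_funpow_forms[OF assms(1)] assms(2)] by simp
qed (simp add: prod_eq_iff)

lemma act_mult_right:
  "a \<in> forms \<Longrightarrow> x \<in> forms \<Longrightarrow> k \<in> carrier G \<Longrightarrow> act a (fst x, snd x \<otimes> k) = apsnd (\<lambda>h. h \<otimes> k) (act a x)"
proof (induction a x rule: act.induct)
  case (1 g x)
  then show ?case by (simp add: lact_mult_right)
next
  case (2 t i w g x)
  define y where "y = act (w, g) x"
  have y: "y \<in> forms" using 2 act_forms by (simp add: y_def)
  define z where "z = (ract ^^ i) y"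
  have z: "z \<in> forms" using ract_funpow_forms y by (simp add: z_def)
  have eta: "apsnd (\<lambda>h. h \<otimes> k) u = (fst u, snd u \<otimes> k)" for u :: "('a \<times> nat) list \<times> 'a"
    by (simp add: prod_eq_iff)
  have "act ((t, i) # w, g) (fst x, snd x \<otimes> k) = lact t ((ract ^^ i) (fst y, snd y \<otimes> k))"
    using 2 by (simp add: y_def eta)
  also have "\<dots> = lact t (fst z, snd z \<otimes> k)"
    using ract_funpow_mult_right[OF y 2(4)] by (simp add: z_def eta)
  also have "\<dots> = apsnd (\<lambda>h. h \<otimes> k) (lact t z)" using lact_mult_right[OF _ z 2(4)] 2 by simp
  finally show ?case by (simp add: y_def z_def)
qed

text \<open>So the first component of a form encodes its coset modulo \<open>G\<close>, that is, the
  translate of the base vertex.\<close>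

lemma act_embed:
  assumes "x \<in> forms" "k \<in> carrier G"
  shows "act x ([], k) = (fst x, snd x \<otimes> k)"
  using act_mult_right[OF assms(1) _ assms(2), of "([], \<one>)"] act_one[OF assms(1)] assms
  by (simp add: prod_eq_iff)

lemma form_decomposition:
  assumes "((t, i) # w, h) \<in> forms"
  shows "((t, i) # w, h) = ([], t) \<otimes>\<^bsub>adjoined\<^esub> (adj_root [^]\<^bsub>adjoined\<^esub> i \<otimes>\<^bsub>adjoined\<^esub> (w, h))"
proof -
  obtain j where j: "i = Suc j" using assms by (cases i) auto
  have "(ract ^^ i) (w, h) = ((\<one>, i) # w, h)" using ract_funpow_outside[of w j h] assms j by simp
  then show ?thesis using assms act_root_pow[of "(w, h)" i] by (simp add: rest_rep lact_one)
qed

text \<open>After the first syllable \<open>e\<close> acts as the element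
  \<open>rest (e \<otimes> t)\<close> of \<open>C\<close>, a nontrivial conjugate of
  \<open>e\<close>. If a further syllable with representative \<open>s\<close> were kept,
  \<open>s\<close> would conjugate this element into \<open>C\<close>, and malnormality would give
  \<open>s \<in> C\<close>, although only the first representative of a normal form may be
  \<open>\<one>\<close>.\<close>

lemma fixes_vertex_form:
  assumes e: "e \<in> carrier G" "e \<noteq> \<one>" and x: "((t, i) # w, h) \<in> forms"
    and fix_w: "fst (lact e ((t, i) # w, h)) = (t, i) # w"
  shows "w = []" "inv t \<otimes> e \<otimes> t \<in> C"
proof -
  have t: "t \<in> carrier G" "rep t = t" using x by auto
  let ?k = "rest (e \<otimes> t)"
  have "rep (e \<otimes> t) = t" using fix_w by simp
  then have k: "?k = inv t \<otimes> e \<otimes> t" using t e by (simp add: rest_def m_assoc)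
  have kC: "?k \<in> C" using rep_rest t e by simp
  then show "inv t \<otimes> e \<otimes> t \<in> C" using k by simp
  have k1: "?k \<noteq> \<one>"
  proof
    assume "?k = \<one>"
    then have "inv t \<otimes> e \<otimes> inv (inv t) = \<one>" using k t by simp
    then show False using conj_eq_one[of "inv t" e] e t by simp
  qed
  show "w = []"
  proof (rule ccontr)
    assume "w \<noteq> []"
    then obtain s j v where w: "w = (s, j) # v" by (cases w) auto
    have s: "s \<in> carrier G" "rep s = s" "s \<noteq> \<one>" using x w by auto
    have "rep (?k \<otimes> s) = s" using fix_w w by (simp add: prod_eq_iff)
    then have "rest (?k \<otimes> s) = inv s \<otimes> ?k \<otimes> s" using s C_carrier[OF kC] by (simp add: rest_def[of "?k \<otimes> s"] m_assoc)
    then have "inv s \<otimes> ?k \<otimes> s \<in> C" using rep_rest[of "?k \<otimes> s"] s C_carrier[OF kC] by simp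
    then have "s \<in> C" by (rule malnormal_C[OF kC k1 s(1)])
    then show False using rep_one_iff[OF s(1)] s by simp
  qed
qed

section \<open>Cyclic reduction in the amalgam\<close>

lemma syllable_outside:
  assumes g: "g \<in> carrier G" "g \<notin> C" and i: "0 < i" "i < p"
    and x: "x \<in> forms" "starts_outside G (fst x)"
  shows "starts_outside G (fst (lact g ((ract ^^ i) x)))"
    "length (fst (lact g ((ract ^^ i) x))) = Suc (length (fst x))"
proof -
  obtain j where j: "i = Suc j" using i by (cases i) auto
  have "(ract ^^ i) x = ((\<one>, i) # fst x, snd x)"
    using ract_funpow_outside[OF x(2), of j "snd x"] i j by simp
  then show "starts_outside G (fst (lact g ((ract ^^ i) x)))"
    "length (fst (lact g ((ract ^^ i) x))) = Suc (length (fst x))"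
    using g rep_one_iff by (auto simp: length_lact)
qed

text \<open>No two powers of \<open>r\<close> become adjacent, so syllables add up. This gives the
  linear growth of the powers of a cyclically reduced form.\<close>

lemma act_outside:
  "normal w \<Longrightarrow> starts_outside G w \<Longrightarrow> x \<in> forms \<Longrightarrow> starts_outside G (fst x) \<Longrightarrow>
    starts_outside G (fst (act (w, \<one>) x)) \<and> length (fst (act (w, \<one>) x)) = length w + length (fst x)"
proof (induction w rule: normal.induct)
  case (2 t i w)
  have t: "t \<in> carrier G" "t \<notin> C" using 2 rep_one_iff[of t] by auto
  have "act (w, \<one>) x \<in> forms" using act_forms 2 by simp
  then show ?case using 2 syllable_outside[OF t, of i "act (w, \<one>) x"] by simp
qed (simp add: lact_one)

lemma act_append: "normal (u @ v) \<Longrightarrow> h \<in> carrier G \<Longrightarrow> x \<in> forms \<Longrightarrow> act (u @ v, h) x = act (u, \<one>) (act (v, h) x)"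
proof (induction u)
  case Nil
  then show ?case using act_forms[of "(v, h)" x] by (simp add: lact_one)
next
  case (Cons a u)
  then show ?case by (cases a) simp
qed

lemma normal_append: "normal (u @ v) \<Longrightarrow> normal u \<and> normal v"
proof (induction u)
  case (Cons a u)
  obtain t i where a: "a = (t, i)" by (cases a)
  have "starts_outside G (u @ v) \<Longrightarrow> starts_outside G u" by (cases u) auto
  then show ?case using Cons a by auto
qed simp

lemma length_act: "a \<in> forms \<Longrightarrow> x \<in> forms \<Longrightarrow> length (fst (act a x)) \<le> length (fst a) + length (fst x)"
proof -
  interpret tree_group adjoined dist by (rule tree_group_adjoined)
  show "a \<in> forms \<Longrightarrow> x \<in> forms \<Longrightarrow> ?thesis"
    using d_mult[of a x] by (simp add: dist_def tree_dist_def length_label)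
qed

lemma ract_funpow_reduce:
  assumes "k \<in> C"
  shows "length (fst ((ract ^^ n) ([], k))) \<le> 1"
proof (induction n rule: less_induct)
  case (less n)
  have k: "([], k) \<in> forms" using assms C_carrier by simp
  consider "n = 0" | j where "n = Suc j" "n < p" | "p \<le> n" by (cases n; cases "p \<le> n") auto
  then show ?case
  proof cases
    case 2
    then show ?thesis using ract_funpow_outside[of "[]" j k] by simp
  next
    case 3
    have "(ract ^^ n) ([], k) = (ract ^^ (n - p)) ((ract ^^ p) ([], k))"
      using 3 by (metis comp_apply funpow_add le_add_diff_inverse2)
    also have "\<dots> = lact c ((ract ^^ (n - p)) ([], k))"
      using ract_funpow_p[OF k] ract_funpow_lact[OF c_C k] by simp
    finally show ?thesis using less[of "n - p"] 3 p_pos by (simp add: length_lact)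
  qed simp
qed

abbreviation (input) emb :: "'a \<Rightarrow> ('a \<times> nat) list \<times> 'a" where "emb g \<equiv> ([], g)"

text \<open>Conjugation moves the first representative \<open>t\<close> to the end, where it meets
  \<open>h\<close>. If \<open>h \<otimes> t\<close> is outside \<open>C\<close>, moving it back to
  the front gives a cyclically reduced element, whose powers grow linearly. If it is in
  \<open>C\<close>, either nothing but a power of \<open>r\<close> and an element of
  \<open>C\<close> is left, or conjugation by the first power of \<open>r\<close> merges it with the
  last one and saves a syllable.\<close>

lemma classification_step:
  assumes x: "((t, i) # w, h) \<in> forms"
  shows "(\<exists>g\<in>forms. \<exists>y\<in>forms. ((t, i) # w, h) = g \<otimes>\<^bsub>adjoined\<^esub> y \<otimes>\<^bsub>adjoined\<^esub> inv\<^bsub>adjoined\<^esub> g \<and>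
      ((\<exists>k\<in>C. y = adj_root [^]\<^bsub>adjoined\<^esub> i \<otimes>\<^bsub>adjoined\<^esub> emb k) \<or>
       0 < length (fst y) \<and> (\<forall>n. length (fst (y [^]\<^bsub>adjoined\<^esub> n)) = n * length (fst y)) \<or>
       length (fst y) \<le> length w))"
proof -
  interpret K: tree_group adjoined dist by (rule tree_group_adjoined)
  let ?K = adjoined
  have c_simps: "carrier ?K = forms" by simp
  have t: "t \<in> carrier G" "rep t = t" "0 < i" "i < p" and wh: "(w, h) \<in> forms" "(w, \<one>) \<in> forms" "h \<in> carrier G"
    and w: "normal w" "starts_outside G w" using x by auto
  let ?r = "adj_root [^]\<^bsub>?K\<^esub> i"
  have rf: "adj_root \<in> carrier ?K" using root_forms by simp
  then have ri: "?r \<in> carrier ?K" by (rule K.nat_pow_closed)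
  have et: "emb t \<in> carrier ?K" using t by simp
  define z where "z = ?r \<otimes>\<^bsub>?K\<^esub> (w, h \<otimes> t)"
  have wht: "(w, h \<otimes> t) \<in> carrier ?K" using wh t by simp
  have z: "z \<in> carrier ?K" unfolding z_def using ri wht by (rule K.m_closed)
  have "(w, h) \<otimes>\<^bsub>?K\<^esub> emb t = (w, h \<otimes> t)" using act_embed[OF wh(1) t(1)] by simp
  then have wh_eq: "(w, h) = (w, h \<otimes> t) \<otimes>\<^bsub>?K\<^esub> inv\<^bsub>?K\<^esub> (emb t)"
    using K.inv_solve_right[OF _ wht et, of "(w, h)"] wh(1) by simp
  have xz: "((t, i) # w, h) = emb t \<otimes>\<^bsub>?K\<^esub> z \<otimes>\<^bsub>?K\<^esub> inv\<^bsub>?K\<^esub> (emb t)"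
    using K.m_assoc et ri wht K.inv_closed[OF et] unfolding form_decomposition[OF x] z_def
    by (subst wh_eq) (simp only: K.m_assoc K.m_closed)
  show ?thesis
  proof (cases "h \<otimes> t \<in> C")
    case False
    let ?g = "h \<otimes> t"
    have gt: "?g \<in> carrier G" using wh t by simp
    have eg: "emb ?g \<in> carrier ?K" using gt by simp
    define y where "y = emb ?g \<otimes>\<^bsub>?K\<^esub> (?r \<otimes>\<^bsub>?K\<^esub> (w, \<one>))"
    have w1: "(w, \<one>) \<in> carrier ?K" using wh by simp
    have y: "y \<in> carrier ?K" unfolding y_def using eg ri w1 by (intro K.m_closed)
    have "(w, \<one>) \<otimes>\<^bsub>?K\<^esub> emb ?g = (w, ?g)" using act_embed[OF wh(2) gt] gt by simp
    then have "z = inv\<^bsub>?K\<^esub> (emb ?g) \<otimes>\<^bsub>?K\<^esub> y \<otimes>\<^bsub>?K\<^esub> emb ?g"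
      unfolding z_def y_def using eg ri w1 by (metis K.inv_solve_left K.m_assoc K.m_closed K.inv_closed)
    then have "((t, i) # w, h) = (emb t \<otimes>\<^bsub>?K\<^esub> inv\<^bsub>?K\<^esub> (emb ?g)) \<otimes>\<^bsub>?K\<^esub> y \<otimes>\<^bsub>?K\<^esub> inv\<^bsub>?K\<^esub> (emb t \<otimes>\<^bsub>?K\<^esub> inv\<^bsub>?K\<^esub> (emb ?g))"
      unfolding xz using et eg y
      by (simp only: K.inv_mult_group K.inv_inv K.m_assoc K.m_closed K.inv_closed)
    moreover have act_y: "y \<otimes>\<^bsub>?K\<^esub> u = lact ?g ((ract ^^ i) (act (w, \<one>) u))" if "u \<in> forms" for u
    proof -
      have uc: "u \<in> carrier ?K" "act (w, \<one>) u \<in> forms" using that act_forms wh by auto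
      have "y \<otimes>\<^bsub>?K\<^esub> u = emb ?g \<otimes>\<^bsub>?K\<^esub> (?r \<otimes>\<^bsub>?K\<^esub> ((w, \<one>) \<otimes>\<^bsub>?K\<^esub> u))"
        unfolding y_def using eg ri w1 uc(1) by (simp only: K.m_assoc K.m_closed)
      then show ?thesis using act_root_pow[OF uc(2)] by simp
    qed
    have grow: "starts_outside G (fst (y \<otimes>\<^bsub>?K\<^esub> u)) \<and> length (fst (y \<otimes>\<^bsub>?K\<^esub> u)) = Suc (length w) + length (fst u)"
      if "u \<in> forms" "starts_outside G (fst u)" for u
    proof -
      have f: "act (w, \<one>) u \<in> forms" using act_forms wh that by blast
      show ?thesis
        using syllable_outside[OF gt False t(3,4) f] act_outside[OF w that] act_y[OF that(1)] by simp
    qed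
    have pow: "starts_outside G (fst (y [^]\<^bsub>?K\<^esub> n)) \<and> length (fst (y [^]\<^bsub>?K\<^esub> n)) = n * Suc (length w)" for n :: nat
    proof (induction n)
      case (Suc n)
      have "y [^]\<^bsub>?K\<^esub> n \<in> forms" using K.nat_pow_closed[OF y] by simp
      then show ?case using grow[of "y [^]\<^bsub>?K\<^esub> n"] Suc unfolding K.nat_pow_Suc2[OF y] by simp
    qed simp
    have "y [^]\<^bsub>?K\<^esub> (1::nat) = y"
      unfolding One_nat_def K.nat_pow_Suc K.nat_pow_0 using y by (rule K.l_one)
    then have "length (fst y) = Suc (length w)" using pow[of 1] by simp
    ultimately show ?thesis
      using pow y K.m_closed[OF et K.inv_closed[OF eg]] unfolding c_simps
      by (intro bexI[of _ "emb t \<otimes>\<^bsub>?K\<^esub> inv\<^bsub>?K\<^esub> (emb ?g)"] bexI[of _ y] conjI disjI2 disjI1) auto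
  next
    case True
    show ?thesis
    proof (cases "w = []")
      case True
      then show ?thesis using xz et z \<open>h \<otimes> t \<in> C\<close> unfolding c_simps z_def
        by (intro bexI[of _ "emb t"] bexI[of _ z] conjI disjI1) (auto simp: z_def)
    next
      case False
      then obtain v s j where v: "w = v @ [(s, j)]" by (metis prod.exhaust rev_exhaust)
      let ?k = "h \<otimes> t"
      have nv: "normal v" "s \<in> carrier G" using normal_append[of v "[(s, j)]"] w v by auto
      define y where "y = (w, ?k) \<otimes>\<^bsub>?K\<^esub> ?r"
      have y: "y \<in> carrier ?K" unfolding y_def using wht ri by (rule K.m_closed)
      have "z = ?r \<otimes>\<^bsub>?K\<^esub> y \<otimes>\<^bsub>?K\<^esub> inv\<^bsub>?K\<^esub> ?r"
        unfolding z_def y_def using ri wht K.inv_closed[OF ri] K.r_inv[OF ri] K.r_one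
        by (simp only: K.m_assoc K.m_closed)
      then have conj: "((t, i) # w, h) = (emb t \<otimes>\<^bsub>?K\<^esub> ?r) \<otimes>\<^bsub>?K\<^esub> y \<otimes>\<^bsub>?K\<^esub> inv\<^bsub>?K\<^esub> (emb t \<otimes>\<^bsub>?K\<^esub> ?r)"
        unfolding xz using et ri y
        by (simp only: K.inv_mult_group K.m_assoc K.m_closed K.inv_closed)
      have "([], ?k) \<in> forms" "([], \<one>) \<in> forms" using C_carrier[OF True] by auto
      have rif: "?r \<in> forms" using ri by simp
      have "y = act (v, \<one>) (act ([(s, j)], ?k) ?r)"
        unfolding y_def using act_append[of v "[(s, j)]" ?k ?r] w v C_carrier[OF True] rif by simp
      also have "act ([(s, j)], ?k) ?r = lact s ((ract ^^ j) (lact ?k ((ract ^^ i) ([], \<one>))))"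
        by (simp add: root_pow)
      also have "\<dots> = lact s ((ract ^^ (j + i)) ([], ?k))"
        using ract_funpow_lact[OF True, of "([], \<one>)" i] C_carrier[OF True] by (simp add: funpow_add)
      finally have y_eq: "y = act (v, \<one>) (lact s ((ract ^^ (j + i)) ([], ?k)))" .
      have "lact s ((ract ^^ (j + i)) ([], ?k)) \<in> forms"
        by (intro lact_forms ract_funpow_forms nv) (use C_carrier[OF True] in simp)
      then have "length (fst y) \<le> length v + 1"
        using length_act[of "(v, \<one>)"] nv ract_funpow_reduce[OF True, of "j + i"] unfolding y_eq
        by (fastforce simp: length_lact)
      then show ?thesis
        using conj y v K.m_closed[OF et ri] unfolding c_simps
        by (intro bexI[of _ "emb t \<otimes>\<^bsub>?K\<^esub> ?r"] bexI[of _ y] conjI disjI2) auto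
    qed
  qed
qed

end

section \<open>Characters\<close>

definition character :: "('a, 'm) monoid_scheme \<Rightarrow> ('a \<Rightarrow> complex) \<Rightarrow> bool" where
  "character G f \<longleftrightarrow> (\<forall>x\<in>carrier G. f x \<noteq> 0) \<and>
     (\<forall>x\<in>carrier G. \<forall>y\<in>carrier G. f (x \<otimes>\<^bsub>G\<^esub> y) = f x * f y)"

lemma characterD:
  "character G f \<Longrightarrow> x \<in> carrier G \<Longrightarrow> f x \<noteq> 0"
  "character G f \<Longrightarrow> x \<in> carrier G \<Longrightarrow> y \<in> carrier G \<Longrightarrow> f (x \<otimes>\<^bsub>G\<^esub> y) = f x * f y"
  by (auto simp: character_def)

fun extend_character :: "('a \<Rightarrow> complex) \<Rightarrow> complex \<Rightarrow> ('a \<times> nat) list \<times> 'a \<Rightarrow> complex" where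
  "extend_character f \<rho> ([], h) = f h"
| "extend_character f \<rho> ((t, i) # w, h) = f t * \<rho> ^ i * extend_character f \<rho> (w, h)"

context rootless_element
begin

lemma classification:
  assumes "x \<in> forms"
  shows "\<exists>g\<in>forms. \<exists>y\<in>forms. x = g \<otimes>\<^bsub>adjoined\<^esub> y \<otimes>\<^bsub>adjoined\<^esub> inv\<^bsub>adjoined\<^esub> g \<and>
      (fst y = [] \<or> (\<exists>i. \<exists>k\<in>C. y = adj_root [^]\<^bsub>adjoined\<^esub> (i::nat) \<otimes>\<^bsub>adjoined\<^esub> emb k) \<or>
       0 < length (fst y) \<and> (\<forall>n. length (fst (y [^]\<^bsub>adjoined\<^esub> (n::nat))) = n * length (fst y)))"
  using assms
proof (induction "length (fst x)" arbitrary: x rule: less_induct)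
  case less
  interpret K: tree_group adjoined dist by (rule tree_group_adjoined)
  let ?K = adjoined
  have c_simps: "forms = carrier ?K" by simp
  show ?case
  proof (cases "fst x")
    case Nil
    have "x = \<one>\<^bsub>?K\<^esub> \<otimes>\<^bsub>?K\<^esub> x \<otimes>\<^bsub>?K\<^esub> inv\<^bsub>?K\<^esub> \<one>\<^bsub>?K\<^esub>" 
      using less.prems unfolding c_simps by (simp only: K.inv_one K.r_one K.l_one)
    then show ?thesis using Nil less.prems unfolding c_simps by (intro bexI[of _ "\<one>\<^bsub>?K\<^esub>"] bexI[of _ x]) (auto simp del: adjoined_simps)
  next
    case (Cons a w)
    obtain t i where a: "a = (t, i)" by (cases a)
    obtain h where x: "x = ((t, i) # w, h)" using Cons a by (cases x) auto
    obtain g y where g: "g \<in> forms" and y: "y \<in> forms" and xg: "x = g \<otimes>\<^bsub>?K\<^esub> y \<otimes>\<^bsub>?K\<^esub> inv\<^bsub>?K\<^esub> g" and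
      cases: "(\<exists>k\<in>C. y = adj_root [^]\<^bsub>?K\<^esub> i \<otimes>\<^bsub>?K\<^esub> emb k) \<or>
       (0 < length (fst y) \<and> (\<forall>n. length (fst (y [^]\<^bsub>?K\<^esub> n)) = n * length (fst y))) \<or>
       length (fst y) \<le> length w"
      using classification_step[of t i w h] less.prems x by blast
    show ?thesis
    proof (cases "length (fst y) \<le> length w")
      case True
      have "\<exists>g'\<in>forms. \<exists>y'\<in>forms. y = g' \<otimes>\<^bsub>?K\<^esub> y' \<otimes>\<^bsub>?K\<^esub> inv\<^bsub>?K\<^esub> g' \<and>
        (fst y' = [] \<or> (\<exists>i. \<exists>k\<in>C. y' = adj_root [^]\<^bsub>?K\<^esub> (i::nat) \<otimes>\<^bsub>?K\<^esub> emb k) \<or>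
          0 < length (fst y') \<and> (\<forall>n. length (fst (y' [^]\<^bsub>?K\<^esub> (n::nat))) = n * length (fst y')))"
        by (rule less.hyps) (use True x y in auto)
      then obtain g' y' where g': "g' \<in> forms" "y' \<in> forms" "y = g' \<otimes>\<^bsub>?K\<^esub> y' \<otimes>\<^bsub>?K\<^esub> inv\<^bsub>?K\<^esub> g'"
        and y': "fst y' = [] \<or> (\<exists>i. \<exists>k\<in>C. y' = adj_root [^]\<^bsub>?K\<^esub> (i::nat) \<otimes>\<^bsub>?K\<^esub> emb k) \<or>
          0 < length (fst y') \<and> (\<forall>n. length (fst (y' [^]\<^bsub>?K\<^esub> (n::nat))) = n * length (fst y'))"
        by blast
      have "x = (g \<otimes>\<^bsub>?K\<^esub> g') \<otimes>\<^bsub>?K\<^esub> y' \<otimes>\<^bsub>?K\<^esub> inv\<^bsub>?K\<^esub> (g \<otimes>\<^bsub>?K\<^esub> g')"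
        unfolding xg g'(3) using g g' unfolding c_simps
        by (simp only: K.inv_mult_group K.m_assoc K.m_closed K.inv_closed)
      moreover have "g \<otimes>\<^bsub>?K\<^esub> g' \<in> forms" using g g' unfolding c_simps by (intro K.m_closed)
      ultimately show ?thesis using y' g'(2) by blast
    next
      case False
      then show ?thesis using g y xg cases by blast
    qed
  qed
qed

lemma root_extension_adjoined:
  "root_extension adjoined dist G emb p c adj_root (\<lambda>x. length (fst x))"
proof (intro root_extension.intro root_extension_axioms.intro)
  show "tree_group adjoined dist" by (rule tree_group_adjoined)
  show "rootless_element G p c" by (rule rootless_element_axioms)
  show "emb \<in> hom G adjoined" by (rule embed_hom)
  show "inj_on emb (carrier G)" by (auto intro: inj_onI)
  show "adj_root \<in> carrier adjoined" using root_forms by simp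
  show "adj_root [^]\<^bsub>adjoined\<^esub> p = emb c" using c by (simp add: root_pow ract_funpow_p)
  show "adj_root \<otimes>\<^bsub>adjoined\<^esub> emb k = emb k \<otimes>\<^bsub>adjoined\<^esub> adj_root" if "k \<in> carrier G" "k \<otimes> c = c \<otimes> k" for k
  proof -
    have k: "k \<in> C" using that by (simp add: C_def)
    have "ract (lact k ([], \<one>)) = lact k (ract ([], \<one>))" by (rule ract_lact[OF k]) simp
    moreover have "ract ([], \<one>) = adj_root" by (simp add: ract_simps adj_root_def)
    ultimately show ?thesis using that by (simp add: act_root)
  qed
  show "dist \<one>\<^bsub>adjoined\<^esub> x = 2 * int (length (fst x))" for x
    by (simp add: dist_def tree_dist_def length_label)
  show "length (fst x) = 0 \<longleftrightarrow> x \<in> emb ` carrier G" if "x \<in> carrier adjoined" for x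
    using that by (cases x) auto
  show "length (fst x) \<le> 1 \<and> (\<exists>t\<in>carrier G. \<exists>i. \<exists>h\<in>carrier G.
        x = emb t \<otimes>\<^bsub>adjoined\<^esub> adj_root [^]\<^bsub>adjoined\<^esub> (i::nat) \<otimes>\<^bsub>adjoined\<^esub> emb h \<and>
        (inv t \<otimes> e \<otimes> t) \<otimes> c = c \<otimes> (inv t \<otimes> e \<otimes> t))"
    if e: "e \<in> carrier G" "e \<noteq> \<one>" and x: "x \<in> carrier adjoined" and e': "e' \<in> carrier G"
      and eq: "emb e \<otimes>\<^bsub>adjoined\<^esub> x = x \<otimes>\<^bsub>adjoined\<^esub> emb e'" and nx: "x \<notin> emb ` carrier G" for e x e'
  proof -
    interpret K: group adjoined by (rule group_adjoined)
    have xf: "x \<in> forms" using x by simp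
    obtain t i w h where xw: "x = ((t, i) # w, h)"
      using nx xf by (metis emptyE fst_conv forms_iff image_eqI list.exhaust surj_pair)
    \<comment> \<open>Multiplication by \<open>emb e'\<close> on the right does not change the first
      component, so \<open>e\<close> fixes the path of \<open>x\<close>.\<close>
    have "fst (lact e x) = fst x" using eq act_embed[OF xf e'] by simp
    then have w: "w = []" "inv t \<otimes> e \<otimes> t \<in> C"
      using fixes_vertex_form[OF e] xf unfolding xw by auto
    have th: "t \<in> carrier G" "h \<in> carrier G" using xf xw by auto
    have "x = emb t \<otimes>\<^bsub>adjoined\<^esub> (adj_root [^]\<^bsub>adjoined\<^esub> i \<otimes>\<^bsub>adjoined\<^esub> emb h)"
      using form_decomposition xf unfolding xw w by blast
    also have "\<dots> = emb t \<otimes>\<^bsub>adjoined\<^esub> adj_root [^]\<^bsub>adjoined\<^esub> i \<otimes>\<^bsub>adjoined\<^esub> emb h"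
      by (rule K.m_assoc[symmetric]) (use th root_forms K.nat_pow_closed in auto)
    finally have "x = emb t \<otimes>\<^bsub>adjoined\<^esub> adj_root [^]\<^bsub>adjoined\<^esub> i \<otimes>\<^bsub>adjoined\<^esub> emb h" .
    moreover have "length (fst x) \<le> 1" using xw w by simp
    ultimately show ?thesis using th w(2) unfolding C_def by blast
  qed
  show "\<exists>g\<in>carrier adjoined. \<exists>y\<in>carrier adjoined. x = g \<otimes>\<^bsub>adjoined\<^esub> y \<otimes>\<^bsub>adjoined\<^esub> inv\<^bsub>adjoined\<^esub> g \<and>
      (y \<in> emb ` carrier G \<or>
       (\<exists>i. \<exists>k\<in>carrier G. k \<otimes> c = c \<otimes> k \<and> y = adj_root [^]\<^bsub>adjoined\<^esub> (i::nat) \<otimes>\<^bsub>adjoined\<^esub> emb k) \<or>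
       0 < length (fst y) \<and> (\<forall>n. length (fst (y [^]\<^bsub>adjoined\<^esub> (n::nat))) = n * length (fst y)))"
    if x: "x \<in> carrier adjoined" for x
  proof -
    have f: "y \<in> emb ` carrier G" if "y \<in> forms" "fst y = []" for y using that by (cases y) auto
    obtain g y where "g \<in> forms" "y \<in> forms" "x = g \<otimes>\<^bsub>adjoined\<^esub> y \<otimes>\<^bsub>adjoined\<^esub> inv\<^bsub>adjoined\<^esub> g" and
      "fst y = [] \<or> (\<exists>i. \<exists>k\<in>C. y = adj_root [^]\<^bsub>adjoined\<^esub> (i::nat) \<otimes>\<^bsub>adjoined\<^esub> emb k) \<or>
       0 < length (fst y) \<and> (\<forall>n. length (fst (y [^]\<^bsub>adjoined\<^esub> (n::nat))) = n * length (fst y))"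
      using classification[OF x[simplified]] by blast
    then show ?thesis using f[of y] unfolding C_def adjoined_simps(1) by blast
  qed
qed

lemma csa_adjoined: "csa adjoined"
  by (rule root_extension.csa_extension[OF root_extension_adjoined])

context
  fixes f and \<rho> :: complex
  assumes f: "character G f" and \<rho>: "\<rho> ^ p = f c"
begin

lemma extend_character_lact:
  "g \<in> carrier G \<Longrightarrow> x \<in> forms \<Longrightarrow> extend_character f \<rho> (lact g x) = f g * extend_character f \<rho> x"
proof (induction g x rule: lact.induct)
  case (2 g t i w h)
  have u: "g \<otimes> t \<in> carrier G" "t \<in> carrier G" using 2 by auto
  have ru: "rep (g \<otimes> t) \<in> carrier G" "rest (g \<otimes> t) \<in> carrier G" using rep_rest u C_carrier by auto
  have "f (rep (g \<otimes> t)) * f (rest (g \<otimes> t)) = f g * f t"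
    using characterD(2)[OF f ru] characterD(2)[OF f 2(2) u(2)] rep_mult_rest[OF u(1)] by simp
  then show ?case using 2 ru by (cases "lact (rest (g \<otimes> t)) (w, h)") (simp add: algebra_simps)
qed (auto simp: characterD[OF f])

lemma character_one: "f \<one> = 1"
  using characterD[OF f, of \<one>] characterD(2)[OF f, of \<one> \<one>] by simp

text \<open>The value of \<open>\<rho>\<close> matters where the exponent of \<open>r\<close>
  reaches \<open>p\<close>: there the power of \<open>r\<close> turns into \<open>c\<close>, in
  agreement with \<open>\<rho> ^ p = f c\<close>.\<close>

lemma extend_character_ract:
  assumes "x \<in> forms"
  shows "extend_character f \<rho> (ract x) = \<rho> * extend_character f \<rho> x"
  using assms
proof (cases x rule: forms_cases)
  case (one i w h)
  show ?thesis
  proof (cases "Suc i < p")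
    case False
    then have "p = Suc i" using one by simp
    then have "f c = \<rho> * \<rho> ^ i" using \<rho> by (metis power_Suc)
    then show ?thesis using False one extend_character_lact[OF c one(5)] character_one by (simp add: ract_simps)
  qed (use one character_one in \<open>simp add: ract_simps\<close>)
qed (auto simp: ract_simps character_one)

lemma extend_character_ract_funpow:
  "x \<in> forms \<Longrightarrow> extend_character f \<rho> ((ract ^^ n) x) = \<rho> ^ n * extend_character f \<rho> x"
  by (induction n) (auto simp: extend_character_ract ract_funpow_forms)

lemma extend_character_act:
  "a \<in> forms \<Longrightarrow> x \<in> forms \<Longrightarrow>
    extend_character f \<rho> (act a x) = extend_character f \<rho> a * extend_character f \<rho> x"
  by (induction a x rule: act.induct)
    (auto simp: extend_character_lact extend_character_ract_funpow act_forms ract_funpow_forms)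

lemma character_adjoined: "character adjoined (extend_character f \<rho>)"
proof -
  have "\<rho> \<noteq> 0" using \<rho> characterD(1)[OF f c] p_pos by (metis zero_power)
  then have "normal w \<Longrightarrow> h \<in> carrier G \<Longrightarrow> extend_character f \<rho> (w, h) \<noteq> 0" for w h
    by (induction w rule: normal.induct) (auto simp: characterD[OF f])
  then show ?thesis by (auto simp: character_def extend_character_act)
qed

end

end

section \<open>Transport of countable groups to the natural numbers\<close>

lemma csa_inj_hom:
  assumes H: "group H" and \<psi>: "\<psi> \<in> hom H G" "inj_on \<psi> (carrier H)" and G: "csa G"
  shows "csa H"
proof -
  interpret H: group H by fact
  interpret G: group G by (rule csa_group[OF G])
  interpret group_hom H G \<psi> by unfold_locales (rule \<psi>)
  have cc: "\<psi> g \<in> conj_centralizer G (\<psi> x)" if "g \<in> conj_centralizer H x" "x \<in> carrier H" for g x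
    using that by (simp add: conj_centralizer_def flip: hom_mult hom_inv)
  show ?thesis
    unfolding csa_def
  proof (intro conjI ballI allI impI H)
    fix x n assume x: "x \<in> carrier H" "0 < n" "x [^]\<^bsub>H\<^esub> (n::nat) = \<one>\<^bsub>H\<^esub>"
    then have "\<psi> x [^]\<^bsub>G\<^esub> n = \<one>\<^bsub>G\<^esub>" by (simp flip: hom_nat_pow)
    then have "\<psi> x = \<psi> \<one>\<^bsub>H\<^esub>" using csa_torsion_free[OF G _ x(2)] x by simp
    then show "x = \<one>\<^bsub>H\<^esub>" using inj_onD[OF \<psi>(2)] x by blast
  next
    fix x g h assume x: "x \<in> carrier H - {\<one>\<^bsub>H\<^esub>}" and g: "g \<in> conj_centralizer H x" and h: "h \<in> conj_centralizer H x"
    have gh: "g \<in> carrier H" "h \<in> carrier H" using g h by (auto simp: conj_centralizer_def)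
    have "\<psi> x \<noteq> \<psi> \<one>\<^bsub>H\<^esub>" using inj_onD[OF \<psi>(2), of x "\<one>\<^bsub>H\<^esub>"] x by auto
    then have "\<psi> g \<otimes>\<^bsub>G\<^esub> \<psi> h = \<psi> h \<otimes>\<^bsub>G\<^esub> \<psi> g"
      using csa_commute[OF G _ _ cc[OF g] cc[OF h]] x by simp
    then show "g \<otimes>\<^bsub>H\<^esub> h = h \<otimes>\<^bsub>H\<^esub> g" using inj_onD[OF \<psi>(2)] gh by (simp flip: hom_mult)
  qed
qed

lemma csa_image_group:
  assumes G: "csa G" and h: "inj_on h (carrier G)"
  shows "csa (image_group h G)" "h \<in> hom G (image_group h G)"
    "inv_into (carrier G) h \<in> hom (image_group h G) G"
proof -
  interpret group G by (rule csa_group[OF G])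
  have iso: "h \<in> iso G (image_group h G)" using h by (rule inj_imp_image_group_iso)
  then show "h \<in> hom G (image_group h G)" by (simp add: iso_def)
  have inv: "inv_into (carrier G) h \<in> iso (image_group h G) G" by (rule iso_set_sym[OF iso])
  then show hom: "inv_into (carrier G) h \<in> hom (image_group h G) G" by (simp add: iso_def)
  have "group (image_group h G)"
    using iso_imp_img_group[OF iso] by (simp add: image_group_def)
  then show "csa (image_group h G)"
    by (rule csa_inj_hom[OF _ hom _ G]) (use inv in \<open>simp add: iso_def bij_betw_def\<close>)
qed

text \<open>Normal forms over a countable group are countable. Coding them by natural numbers keeps
  all groups on one type, so that the step can be iterated.\<close>

lemma adjoin_root_nat:
  fixes G :: "nat monoid"
  assumes "csa G" "character G f" "prime p" "c \<in> carrier G" "\<And>y. y \<in> carrier G \<Longrightarrow> y [^]\<^bsub>G\<^esub> p \<noteq> c" "\<rho> ^ p = f c"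
  shows "\<exists>(G' :: nat monoid) f' \<iota> r. csa G' \<and> character G' f' \<and> \<iota> \<in> hom G G' \<and> (\<forall>x\<in>carrier G. f' (\<iota> x) = f x) \<and>
    r \<in> carrier G' \<and> r [^]\<^bsub>G'\<^esub> p = \<iota> c \<and> f' r = \<rho>"
proof -
  interpret rootless_element G p c
    by (intro rootless_element.intro rootless_element_axioms.intro csa_group assms)
  have inj: "inj_on to_nat (carrier adjoined)" by (rule inj_on_subset[OF inj_to_nat]) simp
  note im = csa_image_group[OF csa_adjoined inj]
  let ?G = "image_group to_nat adjoined" and ?i = "inv_into (carrier adjoined) to_nat"
  let ?F = "extend_character f \<rho>"
  have F: "character adjoined ?F" using character_adjoined assms by blast
  interpret K: group adjoined by (rule group_adjoined)
  interpret h: group_hom adjoined ?G to_nat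
    by (intro group_hom.intro group_hom_axioms.intro group_adjoined csa_group im)
  have ii: "?i (to_nat x) = x" if "x \<in> forms" for x using inv_into_f_f[OF inj] that by simp
  have "character ?G (?F \<circ> ?i)"
    unfolding character_def using im(3) characterD[OF F] by (auto simp: hom_def Pi_iff)
  moreover have "to_nat \<circ> emb \<in> hom G ?G" by (rule Group.hom_compose[OF embed_hom im(2)])
  moreover have "to_nat adj_root [^]\<^bsub>?G\<^esub> p = to_nat (emb c)"
  proof -
    have "to_nat adj_root [^]\<^bsub>?G\<^esub> p = to_nat (adj_root [^]\<^bsub>adjoined\<^esub> p)"
      using h.hom_nat_pow root_forms by simp
    then show ?thesis using c by (simp add: root_pow ract_funpow_p)
  qed
  moreover have "(?F \<circ> ?i) (to_nat adj_root) = \<rho>"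
    using ii[OF root_forms] character_one[OF assms(2,6)] by (simp add: adj_root_def)
  moreover have "to_nat adj_root \<in> carrier ?G" using h.hom_closed root_forms by simp
  ultimately show ?thesis using im(1) ii
    by (intro exI[of _ ?G] exI[of _ "?F \<circ> ?i"] exI[of _ "to_nat \<circ> emb"] exI[of _ "to_nat adj_root"]) auto
qed

section \<open>Sequential colimits\<close>

context
  fixes G :: "nat \<Rightarrow> 'a monoid" and f :: "nat \<Rightarrow> 'a \<Rightarrow> 'a"
  assumes G: "\<And>k. group (G k)" and f: "\<And>k. f k \<in> hom (G k) (G (Suc k))"
begin

interpretation G: group "G k" for k by (rule G)

lemmas colim_group = group_seq_colimit[of G f, OF G f]
  and colim_hom = colim_class_hom[of G f, OF G f]
  and colim_bond = colim_bond_hom[of G f, OF G f]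
  and colim_mult = colim_class_mult[of G f, OF G f]
  and colim_one = one_seq_colimit[of G f, OF G f]
  and colim_shift = colim_class_bond[of G f, OF G f]
  and colim_eq = colim_class_eq_iff[of G f, OF G f]
  and colim_lift = colim_class_lift[of G f, OF G f]

interpretation K: group "seq_colimit G f" by (rule colim_group)

lemma colim_group_hom: "group_hom (G k) (seq_colimit G f) (colim_class G f k)"
  by (intro group_hom.intro group_hom_axioms.intro G.is_group colim_group colim_hom)

lemma bond_group_hom: "k \<le> m \<Longrightarrow> group_hom (G k) (G m) (fold f [k..<m])"
  by (intro group_hom.intro group_hom_axioms.intro G.is_group colim_bond)

lemma colim_eq_stage:
  assumes "a \<in> carrier (G k)" "b \<in> carrier (G k)" "colim_class G f k a = colim_class G f k b"
  obtains m where "k \<le> m" "fold f [k..<m] a = fold f [k..<m] b"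
  using colim_eq[OF assms(2), of k a] assms(3) by auto

text \<open>The target is just a set of values, so the lemma serves homomorphisms and complex
  characters alike.\<close>

lemma seq_colimit_lift:
  assumes compat: "\<And>k x. x \<in> carrier (G k) \<Longrightarrow> \<chi> (Suc k) (f k x) = \<chi> k x"
  shows "\<exists>\<psi>. \<forall>k. \<forall>a\<in>carrier (G k). \<psi> (colim_class G f k a) = \<chi> k a"
proof -
  have bond: "\<chi> m (fold f [k..<m] a) = \<chi> k a" if "k \<le> m" "a \<in> carrier (G k)" for k m a
    using that(1)
  proof (induction m rule: dec_induct)
    case (step m)
    interpret b: group_hom "G k" "G m" "fold f [k..<m]" by (rule bond_group_hom[OF step(1)])
    show ?case using step compat that(2) by simp
  qed simp
  have wd: "\<chi> k a = \<chi> l b" if "a \<in> carrier (G k)" "b \<in> carrier (G l)" "colim_class G f k a = colim_class G f l b" for k l a b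
    using colim_eq[OF that(2), of k a] that bond by (metis max.bounded_iff)
  define \<psi> where "\<psi> A = (SOME z. \<exists>k. \<exists>a\<in>carrier (G k). A = colim_class G f k a \<and> z = \<chi> k a)" for A
  have \<psi>: "\<psi> (colim_class G f k a) = \<chi> k a" if "a \<in> carrier (G k)" for k a
    unfolding \<psi>_def by (rule some_equality) (use that wd in blast)+
  then show ?thesis by blast
qed

lemma colim_pair:
  assumes A: "A \<in> carrier (seq_colimit G f)" and B: "B \<in> carrier (seq_colimit G f)"
  obtains k a b where "a \<in> carrier (G k)" "A = colim_class G f k a" "b \<in> carrier (G k)" "B = colim_class G f k b"
proof -
  obtain k1 where k1: "\<forall>k\<ge>k1. \<exists>a\<in>carrier (G k). A = colim_class G f k a" using colim_lift A by blast
  obtain k2 where k2: "\<forall>k\<ge>k2. \<exists>a\<in>carrier (G k). B = colim_class G f k a" using colim_lift B by blast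
  have "k1 \<le> max k1 k2" "k2 \<le> max k1 k2" by auto
  then show ?thesis using k1 k2 that by metis
qed

lemma hom_seq_colimit:
  assumes g: "\<And>k. g k \<in> hom (G k) H" and compat: "\<And>k x. x \<in> carrier (G k) \<Longrightarrow> g (Suc k) (f k x) = g k x"
  shows "\<exists>\<theta>\<in>hom (seq_colimit G f) H. \<forall>k. \<forall>a\<in>carrier (G k). \<theta> (colim_class G f k a) = g k a"
proof -
  obtain \<theta> where \<theta>: "\<And>k a. a \<in> carrier (G k) \<Longrightarrow> \<theta> (colim_class G f k a) = g k a"
    using seq_colimit_lift[of g, OF compat] by blast
  have "\<theta> \<in> hom (seq_colimit G f) H"
  proof (rule homI)
    fix A B assume "A \<in> carrier (seq_colimit G f)" "B \<in> carrier (seq_colimit G f)"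
    then obtain k a b where "a \<in> carrier (G k)" "A = colim_class G f k a" "b \<in> carrier (G k)" "B = colim_class G f k b"
      by (rule colim_pair)
    then show "\<theta> A \<in> carrier H" "\<theta> (A \<otimes>\<^bsub>seq_colimit G f\<^esub> B) = \<theta> A \<otimes>\<^bsub>H\<^esub> \<theta> B"
      using colim_mult[of a k b] \<theta> hom_mult[OF g] hom_in_carrier[OF g] by simp_all
  qed
  then show ?thesis using \<theta> by blast
qed

lemma character_seq_colimit:
  assumes ch: "\<And>k. character (G k) (\<chi> k)" and compat: "\<And>k x. x \<in> carrier (G k) \<Longrightarrow> \<chi> (Suc k) (f k x) = \<chi> k x"
  shows "\<exists>\<psi>. character (seq_colimit G f) \<psi> \<and> (\<forall>k. \<forall>a\<in>carrier (G k). \<psi> (colim_class G f k a) = \<chi> k a)"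
proof -
  obtain \<psi> where \<psi>: "\<And>k a. a \<in> carrier (G k) \<Longrightarrow> \<psi> (colim_class G f k a) = \<chi> k a"
    using seq_colimit_lift[of \<chi>, OF compat] by blast
  have "\<psi> A \<noteq> 0 \<and> \<psi> (A \<otimes>\<^bsub>seq_colimit G f\<^esub> B) = \<psi> A * \<psi> B"
    if "A \<in> carrier (seq_colimit G f)" "B \<in> carrier (seq_colimit G f)" for A B
  proof -
    obtain k a b where "a \<in> carrier (G k)" "A = colim_class G f k a" "b \<in> carrier (G k)" "B = colim_class G f k b"
      using colim_pair \<open>A \<in> _\<close> \<open>B \<in> _\<close> .
    then show ?thesis using colim_mult[of a k b] \<psi> characterD[OF ch] by simp
  qed
  then have "character (seq_colimit G f) \<psi>" by (auto simp: character_def)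
  then show ?thesis using \<psi> by blast
qed

end

context
  fixes G :: "nat \<Rightarrow> 'a monoid" and f :: "nat \<Rightarrow> 'a \<Rightarrow> 'a"
  assumes csa: "\<And>k. csa (G k)" and f: "\<And>k. f k \<in> hom (G k) (G (Suc k))"
begin

interpretation G: group "G k" for k by (rule csa_group[OF csa])

lemmas csa_colim_group = colim_group[of G f, OF G.is_group f]
  and csa_colim_group_hom = colim_group_hom[of G f, OF G.is_group f]
  and csa_bond_group_hom = bond_group_hom[of G f, OF G.is_group f]
  and csa_colim_eq_stage = colim_eq_stage[of G f, OF G.is_group f]
  and csa_colim_one = colim_one[of G f, OF G.is_group f]
  and csa_colim_shift = colim_shift[of G f, OF G.is_group f]
  and csa_colim_lift = colim_lift[of G f, OF G.is_group f]

interpretation K: group "seq_colimit G f" by (rule csa_colim_group)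

text \<open>Each condition concerns finitely many elements and equations, which are realized at a
  finite stage. The equation that expresses membership in a conjugating centralizer persists at all
  later stages, so both memberships hold at a common stage, where the image of \<open>a\<close> is
  still nontrivial.\<close>

lemma csa_seq_colimit: "csa (seq_colimit G f)"
  unfolding csa_def
proof (intro conjI ballI allI impI csa_colim_group)
  fix A n assume A: "A \<in> carrier (seq_colimit G f)" "0 < n" "A [^]\<^bsub>seq_colimit G f\<^esub> (n::nat) = \<one>\<^bsub>seq_colimit G f\<^esub>"
  obtain k a where a: "a \<in> carrier (G k)" "A = colim_class G f k a" using csa_colim_lift[OF A(1)] by blast
  interpret h: group_hom "G k" "seq_colimit G f" "colim_class G f k" by (rule csa_colim_group_hom)
  have "colim_class G f k (a [^]\<^bsub>G k\<^esub> n) = colim_class G f k \<one>\<^bsub>G k\<^esub>"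
    using A a by (simp add: h.hom_nat_pow)
  then obtain m where m: "k \<le> m" "fold f [k..<m] (a [^]\<^bsub>G k\<^esub> n) = fold f [k..<m] \<one>\<^bsub>G k\<^esub>"
    using csa_colim_eq_stage[of "a [^]\<^bsub>G k\<^esub> n" k "\<one>\<^bsub>G k\<^esub>"] a by auto
  interpret b: group_hom "G k" "G m" "fold f [k..<m]" by (rule csa_bond_group_hom[OF m(1)])
  have "fold f [k..<m] a = \<one>\<^bsub>G m\<^esub>"
    using csa_torsion_free[OF csa _ A(2), of "fold f [k..<m] a" m] m(2) a(1) by (simp add: b.hom_nat_pow)
  then show "A = \<one>\<^bsub>seq_colimit G f\<^esub>"
    using csa_colim_shift[OF m(1), of a] a csa_colim_one[of m] by simp
next
  fix A B B'
  assume A: "A \<in> carrier (seq_colimit G f) - {\<one>\<^bsub>seq_colimit G f\<^esub>}"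
    and B: "B \<in> conj_centralizer (seq_colimit G f) A" "B' \<in> conj_centralizer (seq_colimit G f) A"
  have BK: "B \<in> carrier (seq_colimit G f)" "B' \<in> carrier (seq_colimit G f)"
    using B by (auto simp: conj_centralizer_def)
  obtain k1 where k1: "\<forall>k\<ge>k1. \<exists>a\<in>carrier (G k). A = colim_class G f k a" using csa_colim_lift A by blast
  obtain k2 where k2: "\<forall>k\<ge>k2. \<exists>a\<in>carrier (G k). B = colim_class G f k a" using csa_colim_lift BK by blast
  obtain k3 where k3: "\<forall>k\<ge>k3. \<exists>a\<in>carrier (G k). B' = colim_class G f k a" using csa_colim_lift BK by blast
  define k where "k = max k1 (max k2 k3)"
  have "k1 \<le> k" "k2 \<le> k" "k3 \<le> k" by (auto simp: k_def)
  then obtain a b b' where a: "a \<in> carrier (G k)" "A = colim_class G f k a" and b: "b \<in> carrier (G k)" "B = colim_class G f k b"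
    and b': "b' \<in> carrier (G k)" "B' = colim_class G f k b'"
    using k1 k2 k3 by metis
  interpret h: group_hom "G k" "seq_colimit G f" "colim_class G f k" by (rule csa_colim_group_hom)
  have ex: "\<exists>m\<ge>k. \<forall>n\<ge>m. fold f [k..<n] b \<in> conj_centralizer (G n) (fold f [k..<n] a)"
    if b: "b \<in> carrier (G k)" "colim_class G f k b \<in> conj_centralizer (seq_colimit G f) A" for b
  proof -
    let ?l = "b \<otimes>\<^bsub>G k\<^esub> a \<otimes>\<^bsub>G k\<^esub> inv\<^bsub>G k\<^esub> b \<otimes>\<^bsub>G k\<^esub> a" and ?r = "a \<otimes>\<^bsub>G k\<^esub> (b \<otimes>\<^bsub>G k\<^esub> a \<otimes>\<^bsub>G k\<^esub> inv\<^bsub>G k\<^esub> b)"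
    have "colim_class G f k ?l = colim_class G f k ?r"
      using b a by (simp add: conj_centralizer_def)
    then obtain m where m: "k \<le> m" "fold f [k..<m] ?l = fold f [k..<m] ?r"
      using csa_colim_eq_stage[of ?l k ?r] a b by auto
    have "fold f [k..<n] b \<in> conj_centralizer (G n) (fold f [k..<n] a)" if n: "m \<le> n" for n
    proof -
      interpret b: group_hom "G k" "G n" "fold f [k..<n]" by (rule csa_bond_group_hom) (use n m in simp)
      have "fold f [k..<n] ?l = fold f [k..<n] ?r"
        using fold_upt_split[OF m(1) n, of f] m(2) by metis
      then show ?thesis using a(1) b by (simp add: conj_centralizer_def)
    qed
    then show ?thesis using m(1) by blast
  qed
  obtain m m' where m: "k \<le> m" "\<And>n. m \<le> n \<Longrightarrow> fold f [k..<n] b \<in> conj_centralizer (G n) (fold f [k..<n] a)"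
    and m': "k \<le> m'" "\<And>n. m' \<le> n \<Longrightarrow> fold f [k..<n] b' \<in> conj_centralizer (G n) (fold f [k..<n] a)"
    using ex[OF b(1)] ex[OF b'(1)] B b b' by metis
  define n where "n = max m m'"
  have n: "m \<le> n" "m' \<le> n" "k \<le> n" using m(1) by (auto simp: n_def)
  interpret b: group_hom "G k" "G n" "fold f [k..<n]" by (rule csa_bond_group_hom[OF n(3)])
  have "fold f [k..<n] a \<noteq> \<one>\<^bsub>G n\<^esub>"
    using A a csa_colim_shift[OF n(3), of a] csa_colim_one[of n] by auto
  then have eq: "fold f [k..<n] (b \<otimes>\<^bsub>G k\<^esub> b') = fold f [k..<n] (b' \<otimes>\<^bsub>G k\<^esub> b)"
    using csa_commute[OF csa _ _ m(2)[OF n(1)] m'(2)[OF n(2)]] a b b' by simp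
  have "colim_class G f k (b \<otimes>\<^bsub>G k\<^esub> b') = colim_class G f k (b' \<otimes>\<^bsub>G k\<^esub> b)"
    using csa_colim_shift[OF n(3)] eq by metis
  then show "B \<otimes>\<^bsub>seq_colimit G f\<^esub> B' = B' \<otimes>\<^bsub>seq_colimit G f\<^esub> B"
    using b b' by simp
qed

lemma P_local_seq_colimit:
  assumes p: "0 < p"
    and roots: "\<And>m a. a \<in> carrier (G m) \<Longrightarrow> \<exists>n\<ge>m. \<exists>r\<in>carrier (G n). r [^]\<^bsub>G n\<^esub> p = fold f [m..<n] a"
  shows "P_local p (seq_colimit G f)"
  unfolding P_local_def bij_betw_def
proof (intro conjI csa_colim_group)
  show "inj_on (\<lambda>x. x [^]\<^bsub>seq_colimit G f\<^esub> p) (carrier (seq_colimit G f))"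
    by (rule inj_onI) (rule K.csa_unique_root[OF csa_seq_colimit p])
  have "\<exists>B\<in>carrier (seq_colimit G f). A = B [^]\<^bsub>seq_colimit G f\<^esub> p" if A: "A \<in> carrier (seq_colimit G f)" for A
  proof -
    obtain m a where a: "a \<in> carrier (G m)" "A = colim_class G f m a" using csa_colim_lift[OF A] by blast
    obtain n r where r: "m \<le> n" "r \<in> carrier (G n)" "r [^]\<^bsub>G n\<^esub> p = fold f [m..<n] a"
      using roots[OF a(1)] by blast
    interpret h: group_hom "G n" "seq_colimit G f" "colim_class G f n" by (rule csa_colim_group_hom)
    have "colim_class G f n r [^]\<^bsub>seq_colimit G f\<^esub> p = A"
      using r a csa_colim_shift[OF r(1), of a] h.hom_nat_pow[OF r(2), of p] by simp
    then show ?thesis using h.hom_closed[OF r(2)] by blast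
  qed
  then show "(\<lambda>x. x [^]\<^bsub>seq_colimit G f\<^esub> p) ` carrier (seq_colimit G f) = carrier (seq_colimit G f)"
    by auto
qed

end

lemma complex_root_exists: "0 < n \<Longrightarrow> \<exists>w :: complex. w ^ n = z"
proof -
  assume n: "0 < n"
  have "complex_of_real (root n (cmod z)) ^ n = of_real (cmod z)"
    using real_root_pow_pos2[OF n, of "cmod z"] by (simp flip: of_real_power)
  then have "(of_real (root n (cmod z)) * cis (Arg z / n)) ^ n = of_real (cmod z) * cis (Arg z)"
    using n by (simp add: power_mult_distrib DeMoivre)
  also have "of_real (cmod z) * cis (Arg z) = z" using rcis_cmod_Arg[of z] by (simp add: rcis_def)
  finally show ?thesis by blast
qed

lemma character_P_local_extension:
  fixes G :: "nat monoid"
  assumes G: "csa G" and p: "prime p" and c: "c \<in> carrier G" "\<And>y. y \<in> carrier G \<Longrightarrow> y [^]\<^bsub>G\<^esub> p \<noteq> c"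
  shows "\<exists>(K :: (nat \<times> nat) set monoid) \<psi> \<theta> r. P_local p K \<and> character K \<psi> \<and> \<theta> \<in> hom G K \<and>
    r \<in> carrier K \<and> r [^]\<^bsub>K\<^esub> p = \<theta> c \<and> \<psi> r \<noteq> 1"
proof -
  have p2: "2 \<le> p" using p by (rule prime_ge_2_nat)
  \<comment> \<open>A primitive \<open>p\<close>-th root of unity: the construction starts from the
    trivial character, so any \<open>p\<close>-th root of 1 is an admissible value at the first
    adjoined root.\<close>
  define \<rho> where "\<rho> = cis (2 * pi / p)"
  have "\<rho> ^ p = 1" using p2 by (simp add: \<rho>_def DeMoivre)
  have "\<rho> \<noteq> 1"
  proof
    assume "\<rho> = 1"
    then have "cos (2 * pi / p) = 1" by (simp add: \<rho>_def complex_eq_iff)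
    then obtain n :: int where n: "2 * pi / p = n * 2 * pi" using cos_one_2pi_int by auto
    then have "1 = real_of_int n * p" using p2 by (simp add: field_simps)
    then have "1 = n * int p" by (metis of_int_1 of_int_eq_iff of_int_mult of_int_of_nat_eq)
    then show False using p2 by (metis abs_of_nat dvd_triv_right numeral_le_one_iff of_nat_1_eq_iff semiring_norm(69) zdvd1_eq)
  qed
  have "character G (\<lambda>_. 1)" by (simp add: character_def)
  then obtain G0 :: "nat monoid" and \<chi>0 \<iota>0 r0 where G0: "csa G0" "character G0 \<chi>0" "\<iota>0 \<in> hom G G0"
    "r0 \<in> carrier G0" "r0 [^]\<^bsub>G0\<^esub> p = \<iota>0 c" "\<chi>0 r0 = \<rho>"
    using adjoin_root_nat[OF G _ p c] \<open>\<rho> ^ p = 1\<close> by metis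
  \<comment> \<open>In the state \<open>(A, \<chi>, h)\<close> at time \<open>n\<close>, \<open>h m a\<close> is the image in \<open>A\<close> of the element \<open>a\<close> of the group at time \<open>m\<close>.
    The step adjoins a root of this image if \<open>n\<close> is the code of \<open>(m, a)\<close>.\<close>
  define P where "P = (\<lambda>(n::nat) (x :: nat monoid \<times> (nat \<Rightarrow> complex) \<times> (nat \<Rightarrow> nat \<Rightarrow> nat)).
    csa (fst x) \<and> character (fst x) (fst (snd x)) \<and> (n = 0 \<longrightarrow> x = (G0, \<chi>0, \<lambda>_ a. a)))"
  define Q where "Q = (\<lambda>n (x :: nat monoid \<times> (nat \<Rightarrow> complex) \<times> (nat \<Rightarrow> nat \<Rightarrow> nat)) (y :: nat monoid \<times> (nat \<Rightarrow> complex) \<times> (nat \<Rightarrow> nat \<Rightarrow> nat)).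
    \<exists>\<iota>. \<iota> \<in> hom (fst x) (fst y) \<and> (\<forall>a\<in>carrier (fst x). fst (snd y) (\<iota> a) = fst (snd x) a) \<and>
      (\<forall>m a. snd (snd y) m a = (if m \<le> n then \<iota> (snd (snd x) m a) else a)) \<and>
      (let b = snd (snd x) (fst (prod_decode n)) (snd (prod_decode n)) in
        b \<in> carrier (fst x) \<longrightarrow> (\<exists>r\<in>carrier (fst y). r [^]\<^bsub>fst y\<^esub> p = \<iota> b)))"
  have "\<exists>F. \<forall>n. P n (F n) \<and> Q n (F n) (F (Suc n))"
  proof (rule dependent_nat_choice)
    show "\<exists>x. P 0 x" using G0 by (auto simp: P_def)
    fix x n assume x: "P n x"
    obtain H \<chi> h where xH: "x = (H, \<chi>, h)" by (cases x)
    have H: "csa H" "character H \<chi>" using x xH by (auto simp: P_def)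
    let ?b = "h (fst (prod_decode n)) (snd (prod_decode n))"
    have "\<exists>(H' :: nat monoid) \<chi>' \<iota>. csa H' \<and> character H' \<chi>' \<and> \<iota> \<in> hom H H' \<and> (\<forall>a\<in>carrier H. \<chi>' (\<iota> a) = \<chi> a) \<and>
        (?b \<in> carrier H \<longrightarrow> (\<exists>r\<in>carrier H'. r [^]\<^bsub>H'\<^esub> p = \<iota> ?b))"
    proof (cases "?b \<in> carrier H \<and> (\<forall>y\<in>carrier H. y [^]\<^bsub>H\<^esub> p \<noteq> ?b)")
      case True
      obtain \<sigma> where "\<sigma> ^ p = \<chi> ?b" using complex_root_exists[of p "\<chi> ?b"] p2 by auto
      then show ?thesis using adjoin_root_nat[OF H p, of ?b \<sigma>] True by metis
    next
      \<comment> \<open>Either the code does not denote an element of the current group or the root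
        is already present; the group is kept.\<close>
      case False
      then show ?thesis using H by (intro exI[of _ H] exI[of _ \<chi>] exI[of _ "\<lambda>x. x"]) (auto simp: hom_def)
    qed
    then obtain H' :: "nat monoid" and \<chi>' \<iota> where *: "csa H'" "character H' \<chi>'" "\<iota> \<in> hom H H'" "\<forall>a\<in>carrier H. \<chi>' (\<iota> a) = \<chi> a"
      "?b \<in> carrier H \<longrightarrow> (\<exists>r\<in>carrier H'. r [^]\<^bsub>H'\<^esub> p = \<iota> ?b)" by blast
    show "\<exists>y. P (Suc n) y \<and> Q n x y"
      using * by (intro exI[of _ "(H', \<chi>', \<lambda>m a. if m \<le> n then \<iota> (h m a) else a)"] conjI)
        (auto simp: P_def Q_def xH Let_def intro!: exI[of _ \<iota>])
  qed
  then obtain F where F: "\<And>n. P n (F n)" "\<And>n. Q n (F n) (F (Suc n))" by blast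
  define A where "A n = fst (F n)" for n
  define \<chi> where "\<chi> n = fst (snd (F n))" for n
  define h where "h n = snd (snd (F n))" for n
  have A: "csa (A n)" "character (A n) (\<chi> n)" for n using F(1)[of n] by (auto simp: P_def A_def \<chi>_def)
  have A0: "A 0 = G0" "\<chi> 0 = \<chi>0" "h 0 = (\<lambda>_ a. a)" using F(1)[of 0] by (auto simp: P_def A_def \<chi>_def h_def)
  have "\<exists>\<iota>. \<forall>n. \<iota> n \<in> hom (A n) (A (Suc n)) \<and> (\<forall>a\<in>carrier (A n). \<chi> (Suc n) (\<iota> n a) = \<chi> n a) \<and>
      (\<forall>m a. h (Suc n) m a = (if m \<le> n then \<iota> n (h n m a) else a)) \<and>
      (h n (fst (prod_decode n)) (snd (prod_decode n)) \<in> carrier (A n) \<longrightarrow>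
        (\<exists>r\<in>carrier (A (Suc n)). r [^]\<^bsub>A (Suc n)\<^esub> p = \<iota> n (h n (fst (prod_decode n)) (snd (prod_decode n)))))"
    by (intro choice allI) (rule F(2)[unfolded Q_def Let_def, folded A_def \<chi>_def h_def])
  then obtain \<iota> where \<iota>: "\<And>n. \<iota> n \<in> hom (A n) (A (Suc n))" "\<And>n a. a \<in> carrier (A n) \<Longrightarrow> \<chi> (Suc n) (\<iota> n a) = \<chi> n a"
    and h: "\<And>n m a. h (Suc n) m a = (if m \<le> n then \<iota> n (h n m a) else a)"
    and roots: "\<And>n. h n (fst (prod_decode n)) (snd (prod_decode n)) \<in> carrier (A n) \<Longrightarrow>
        \<exists>r\<in>carrier (A (Suc n)). r [^]\<^bsub>A (Suc n)\<^esub> p = \<iota> n (h n (fst (prod_decode n)) (snd (prod_decode n)))"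
    by metis
  have grp: "group (A n)" for n using A(1) by (rule csa_group)
  have hm: "h n n a = a" for n a by (cases n) (simp_all add: A0 h)
  have hf: "m \<le> n \<Longrightarrow> h n m a = fold \<iota> [m..<n] a" for m n a
    by (induction n rule: dec_induct) (simp_all add: hm h)
  let ?K = "seq_colimit A \<iota>"
  have "P_local p ?K"
  proof (rule P_local_seq_colimit[of A \<iota>, OF A(1) \<iota>(1)])
    show "0 < p" using p2 by simp
    fix m a assume a: "a \<in> carrier (A m)"
    \<comment> \<open>The code of \<open>(m, a)\<close> is at least \<open>m\<close>, so the element
      \<open>a\<close> already exists when its turn comes, and its image has a root at time
      \<open>Suc n\<close>.\<close>
    define n where "n = prod_encode (m, a)"
    have mn: "m \<le> n" unfolding n_def by (rule le_prod_encode_1)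
    have e: "h n (fst (prod_decode n)) (snd (prod_decode n)) = fold \<iota> [m..<n] a"
      using hf[OF mn] by (simp add: n_def)
    have "fold \<iota> [m..<n] a \<in> carrier (A n)"
      using colim_bond_closed[of A \<iota>, OF grp \<iota>(1) mn a] .
    then show "\<exists>n\<ge>m. \<exists>r\<in>carrier (A n). r [^]\<^bsub>A n\<^esub> p = fold \<iota> [m..<n] a"
      using roots[of n] mn unfolding e by (intro exI[of _ "Suc n"]) auto
  qed
  moreover obtain \<psi> where \<psi>: "character ?K \<psi>" "\<And>k a. a \<in> carrier (A k) \<Longrightarrow> \<psi> (colim_class A \<iota> k a) = \<chi> k a"
    using character_seq_colimit[of A \<iota> \<chi>, OF grp \<iota>(1) A(2) \<iota>(2)] by blast
  moreover interpret k: group_hom "A 0" ?K "colim_class A \<iota> 0"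
    by (rule colim_group_hom[of A \<iota>, OF grp \<iota>(1)])
  have "colim_class A \<iota> 0 \<circ> \<iota>0 \<in> hom G ?K"
    using G0(3) k.homh unfolding A0(1)[symmetric] by (rule Group.hom_compose)
  moreover have "colim_class A \<iota> 0 r0 [^]\<^bsub>?K\<^esub> p = (colim_class A \<iota> 0 \<circ> \<iota>0) c"
    using k.hom_nat_pow[of r0 p] G0(4,5) A0(1) by simp
  moreover have "\<psi> (colim_class A \<iota> 0 r0) \<noteq> 1" using \<psi>(2)[of r0 0] G0(4,6) A0 \<open>\<rho> \<noteq> 1\<close> by simp
  moreover have "colim_class A \<iota> 0 r0 \<in> carrier ?K" using k.hom_closed G0(4) A0(1) by simp
  ultimately show ?thesis by blast
qed

section \<open>Homomorphisms from \<open>\<H>\<close> and \<open>\<F>\<close>\<close>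

definition group_commutator :: "('a, 'm) monoid_scheme \<Rightarrow> 'a \<Rightarrow> 'a \<Rightarrow> 'a" where
  "group_commutator G x y = x \<otimes>\<^bsub>G\<^esub> y \<otimes>\<^bsub>G\<^esub> inv\<^bsub>G\<^esub> x \<otimes>\<^bsub>G\<^esub> inv\<^bsub>G\<^esub> y"

lemma (in group_hom) hom_group_commutator:
  "x \<in> carrier G \<Longrightarrow> y \<in> carrier G \<Longrightarrow> h (group_commutator G x y) = group_commutator H (h x) (h y)"
  by (simp add: group_commutator_def)

text \<open>The entries at positive indices satisfy the defining relations of \<open>group_H\<close>
  and so define a homomorphism from it. They also define one from
  \<open>group_F_seq (\<lambda>_. 1)\<close>.\<close>

definition commutator_tower :: "('a, 'm) monoid_scheme \<Rightarrow> (nat \<Rightarrow> 'a) \<Rightarrow> bool" where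
  "commutator_tower G x \<longleftrightarrow> (\<forall>i. x i \<in> carrier G) \<and>
     (\<forall>i\<ge>1. x i = group_commutator G (x (2 * i)) (x (2 * i + 1)))"

lemma commutator_towerD:
  assumes "commutator_tower G x"
  shows "x i \<in> carrier G" "1 \<le> i \<Longrightarrow> group_commutator G (x (2 * i)) (x (2 * i + 1)) = x i"
  by (rule assms[unfolded commutator_tower_def, THEN conjunct1, rule_format],
      rule assms[unfolded commutator_tower_def, THEN conjunct2, rule_format, symmetric])

lemma commutator_tower_hom:
  assumes "group G" "group H" "h \<in> hom G H" "commutator_tower G x"
  shows "commutator_tower H (h \<circ> x)"
proof -
  interpret group_hom G H h using assms by (intro group_hom.intro group_hom_axioms.intro)
  note x = commutator_towerD[OF assms(4)]
  have "h (x i) = group_commutator H (h (x (2 * i))) (h (x (2 * i + 1)))" if "1 \<le> i" for i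
    by (simp only: x(1) x(2)[OF that] flip: hom_group_commutator)
  then show ?thesis
    unfolding commutator_tower_def comp_apply by (intro conjI allI impI hom_closed x(1))
qed

text \<open>The integer part of the binary logarithm, with value 0 at 0: the stage of the colimit at
  which the generator of index \<open>i\<close> appears.\<close>

fun level :: "nat \<Rightarrow> nat" where
  "level i = (if i \<le> 1 then 0 else Suc (level (i div 2)))"

declare level.simps [simp del]

lemma level_double: "1 \<le> i \<Longrightarrow> level (2 * i) = Suc (level i)" "1 \<le> i \<Longrightarrow> level (2 * i + 1) = Suc (level i)"
  by (simp_all add: level.simps[of "2 * i"] level.simps[of "Suc (2 * i)"])

lemma fold_const_funpow: "k \<le> m \<Longrightarrow> fold (\<lambda>_. g) [k..<m] = g ^^ (m - k)"
  by (induction m rule: dec_induct) (auto simp: Suc_diff_le)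

text \<open>Every stage is the free group on all natural numbers, with \<open>comm_subst\<close> as
  the map to the next one. Placing the letter \<open>i\<close> at stage \<open>level i\<close> makes
  \<open>x i\<close> the commutator of its two successors, which live one stage later.\<close>

lemma csa_commutator_tower:
  "\<exists>(G :: nat monoid) x. csa G \<and> commutator_tower G x \<and>
    (\<forall>p z. prime p \<longrightarrow> z \<in> carrier G \<longrightarrow> z [^]\<^bsub>G\<^esub> (p::nat) \<noteq> x 1)"
proof -
  let ?F = "reduced_words :: nat word monoid"
  let ?G = "\<lambda>_::nat. ?F" and ?f = "\<lambda>_::nat. comm_subst"
  let ?cl = "colim_class ?G ?f" and ?B = "seq_colimit ?G ?f"
  note grp = group_reduced_words[where 'a = nat]
  interpret F: group ?F by (rule grp)
  have B: "csa ?B" by (rule csa_seq_colimit[of ?G ?f, OF csa_reduced_words comm_subst_hom])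
  interpret B: group ?B by (rule csa_group[OF B])
  have hom: "group_hom ?F ?B (?cl k)" for k by (rule colim_group_hom[of ?G ?f, OF grp comm_subst_hom])
  define x where "x i = ?cl (level i) [(True, i)]" for i
  have "commutator_tower ?B x"
    unfolding commutator_tower_def
  proof (intro conjI allI impI)
    fix i
    interpret h: group_hom ?F ?B "?cl (level i)" by (rule hom)
    show "x i \<in> carrier ?B" using h.hom_closed[of "[(True, i)]"] by (simp add: x_def)
  next
    fix i :: nat assume i: "1 \<le> i"
    let ?k = "Suc (level i)"
    interpret h: group_hom ?F ?B "?cl ?k" by (rule hom)
    have "group_commutator ?F [(True, 2 * i)] [(True, 2 * i + 1)] = comm_word (2 * i) (2 * i + 1)"
      by (simp add: group_commutator_def inv_reduced_words push_def comm_word_def)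
    then have "group_commutator ?B (?cl ?k [(True, 2 * i)]) (?cl ?k [(True, 2 * i + 1)]) = ?cl ?k (comm_subst [(True, i)])"
      using h.hom_group_commutator[of "[(True, 2 * i)]" "[(True, 2 * i + 1)]"] by simp
    also have "\<dots> = ?cl (level i) [(True, i)]"
      using colim_shift[of ?G ?f, OF grp comm_subst_hom, of "level i" ?k "[(True, i)]"] by simp
    finally show "x i = group_commutator ?B (x (2 * i)) (x (2 * i + 1))"
      using level_double[OF i] by (simp add: x_def)
  qed
  have no_root: "z [^]\<^bsub>?B\<^esub> p \<noteq> x 1" if p: "prime p" and z: "z \<in> carrier ?B" for p :: nat and z
  proof
    assume eq: "z [^]\<^bsub>?B\<^esub> p = x 1"
    obtain k a where a: "a \<in> carrier ?F" "z = ?cl k a"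
      using colim_lift[of ?G ?f, OF grp comm_subst_hom z] by blast
    interpret h: group_hom ?F ?B "?cl k" by (rule hom)
    have "?cl k (a [^]\<^bsub>?F\<^esub> p) = ?cl 0 [(True, 1)]"
      using eq a h.hom_nat_pow[OF a(1), of p] by (simp add: x_def level.simps)
    \<comment> \<open>The equation already holds at some stage \<open>m\<close>, where
      \<open>x 1\<close> has become the \<open>m\<close>-fold iterated commutator of a single
      letter.\<close>
    then obtain m where m: "k \<le> m" "fold ?f [k..<m] (a [^]\<^bsub>?F\<^esub> p) = fold ?f [0..<m] [(True, 1)]"
      using colim_eq[of ?G ?f, OF grp comm_subst_hom, where a = "a [^]\<^bsub>?F\<^esub> p" and k = k and b = "[(True, 1)]" and l = 0] by auto
    interpret s: group_hom ?F ?F "fold ?f [k..<m]" by (rule bond_group_hom[of ?G ?f, OF grp comm_subst_hom m(1)])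
    have "fold ?f [k..<m] a [^]\<^bsub>?F\<^esub> p = (comm_subst ^^ m) [(True, 1)]"
      using m a(1) s.hom_nat_pow by (simp add: fold_const_funpow)
    then show False
      using iterated_commutator_not_power[OF p, of "fold ?f [k..<m] a" m] s.hom_closed[OF a(1)] by simp
  qed
  have "carrier ?B = (\<lambda>(k, a). ?cl k a) ` (UNIV \<times> carrier ?F)"
    using carrier_seq_colimit[of ?G ?f, OF grp comm_subst_hom] by auto
  then have "countable (carrier ?B)" by (metis countable_image countableI_type)
  then have inj: "inj_on (to_nat_on (carrier ?B)) (carrier ?B)" by (rule inj_on_to_nat_on)
  let ?h = "to_nat_on (carrier ?B)"
  let ?N = "image_group ?h ?B"
  note im = csa_image_group[OF B inj]
  have N: "group ?N" by (rule csa_group[OF im(1)])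
  interpret h: group_hom ?B ?N ?h using N im(2) by (intro group_hom.intro group_hom_axioms.intro B.is_group)
  have "commutator_tower ?N (?h \<circ> x)"
    by (rule commutator_tower_hom[OF B.is_group N im(2) \<open>commutator_tower ?B x\<close>])
  moreover have "z [^]\<^bsub>?N\<^esub> p \<noteq> (?h \<circ> x) 1" if p: "prime p" and z: "z \<in> carrier ?N" for p :: nat and z
  proof
    assume eq: "z [^]\<^bsub>?N\<^esub> p = (?h \<circ> x) 1"
    obtain y where y: "y \<in> carrier ?B" "z = ?h y" using z by (auto simp: image_group_carrier)
    have "?h (y [^]\<^bsub>?B\<^esub> p) = ?h (x 1)" using eq y(2) h.hom_nat_pow[OF y(1), of p] by simp
    moreover have "x 1 \<in> carrier ?B"
      by (rule commutator_towerD[OF \<open>commutator_tower ?B x\<close>])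
    ultimately have "y [^]\<^bsub>?B\<^esub> p = x 1" by (rule inj_onD[OF inj _ B.nat_pow_closed[OF y(1)]])
    then show False using no_root[OF p y(1)] by contradiction
  qed
  ultimately show ?thesis using im(1) by blast
qed

lemma P_local_commutator_tower:
  assumes p: "prime p"
  shows "\<exists>(K :: (nat \<times> nat) set monoid) \<psi> y r. P_local p K \<and> character K \<psi> \<and> commutator_tower K y \<and>
    r \<in> carrier K \<and> r [^]\<^bsub>K\<^esub> p = y 1 \<and> \<psi> r \<noteq> 1"
proof -
  obtain G :: "nat monoid" and x where G: "csa G" "commutator_tower G x"
    and nr: "\<forall>p z. prime p \<longrightarrow> z \<in> carrier G \<longrightarrow> z [^]\<^bsub>G\<^esub> (p::nat) \<noteq> x 1"
    using csa_commutator_tower by (elim exE conjE) (rule that)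
  have nr: "z [^]\<^bsub>G\<^esub> p \<noteq> x 1" if "z \<in> carrier G" for z using nr p that by blast
  have "x 1 \<in> carrier G" by (rule commutator_towerD[OF G(2)])
  then obtain K :: "(nat \<times> nat) set monoid" and \<psi> \<theta> r where K: "P_local p K" "character K \<psi>" "\<theta> \<in> hom G K"
    "r \<in> carrier K" "r [^]\<^bsub>K\<^esub> p = \<theta> (x 1)" "\<psi> r \<noteq> 1"
    using character_P_local_extension[OF G(1) p _ nr] by blast
  have "commutator_tower K (\<theta> \<circ> x)"
    using commutator_tower_hom[OF csa_group[OF G(1)] _ K(3) G(2)] K(1) by (simp add: P_local_def)
  then show ?thesis using K by (intro exI[of _ K] exI[of _ \<psi>] exI[of _ "\<theta> \<circ> x"] exI[of _ r]) auto
qed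

section \<open>Characters of perfect groups and of localizations\<close>

lemma character_trivial_on_perfect:
  assumes L: "perfect L" and \<chi>: "character L \<chi>" and x: "x \<in> carrier L"
  shows "\<chi> x = 1"
proof -
  interpret group L using L by (simp add: perfect_def)
  have one: "\<chi> \<one>\<^bsub>L\<^esub> = 1"
    using characterD(1)[OF \<chi>, of "\<one>\<^bsub>L\<^esub>"] characterD(2)[OF \<chi>, of "\<one>\<^bsub>L\<^esub>" "\<one>\<^bsub>L\<^esub>"] by simp
  have inv: "\<chi> a * \<chi> (inv\<^bsub>L\<^esub> a) = 1" if "a \<in> carrier L" for a
    using characterD(2)[OF \<chi> that, of "inv\<^bsub>L\<^esub> a"] that one by simp
  have "\<chi> (a \<otimes>\<^bsub>L\<^esub> b \<otimes>\<^bsub>L\<^esub> inv\<^bsub>L\<^esub> a \<otimes>\<^bsub>L\<^esub> inv\<^bsub>L\<^esub> b) = (\<chi> a * \<chi> (inv\<^bsub>L\<^esub> a)) * (\<chi> b * \<chi> (inv\<^bsub>L\<^esub> b))"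
    if "a \<in> carrier L" "b \<in> carrier L" for a b
    using that by (simp add: characterD(2)[OF \<chi>])
  then have comm: "\<chi> y = 1" if "y \<in> derived_set L (carrier L)" for y using that inv by auto
  have "x \<in> generate L (derived_set L (carrier L))" using L x by (simp add: perfect_def derived_def)
  then have "x \<in> carrier L \<and> \<chi> x = 1"
  proof (induction rule: generate.induct)
    case (inv h)
    then have "h \<in> carrier L" using derived_set_in_carrier[of "carrier L"] by blast
    then show ?case using inv[THEN comm] \<open>\<And>a. a \<in> carrier L \<Longrightarrow> \<chi> a * \<chi> (inv\<^bsub>L\<^esub> a) = 1\<close>[of h] by simp
  next
    case (incl h)
    then show ?case using derived_set_in_carrier[of "carrier L"] comm by blast
  qed (auto simp: one characterD(2)[OF \<chi>])
  then show ?thesis by simp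
qed

lemma localization_not_perfect:
  assumes G: "group G" and loc: "P_localization p G L \<eta>" and K: "P_local p K" and \<psi>: "character K \<psi>"
    and \<theta>: "\<theta> \<in> hom G K" and g: "g \<in> carrier G" and r: "r \<in> carrier K" "r [^]\<^bsub>K\<^esub> p = \<theta> g" "\<psi> r \<noteq> 1"
  shows "\<not> perfect L"
proof
  assume L: "perfect L"
  have PL: "P_local p L" and \<eta>: "\<eta> \<in> hom G L" using loc by (simp_all add: P_localization_def)
  \<comment> \<open>\<open>K\<close> may live on a type other than those over which
    \<open>P_localization\<close> quantifies, hence the passage through
    \<open>P_localization_universal\<close>.\<close>
  obtain \<phi> where \<phi>: "\<phi> \<in> hom L K" "\<And>g. g \<in> carrier G \<Longrightarrow> \<phi> (\<eta> g) = \<theta> g"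
    using uniquely_factorsE[OF P_localization_universal[OF G loc K] \<theta>] by blast
  interpret group_hom L K \<phi>
    using PL K \<phi>(1) by (intro group_hom.intro group_hom_axioms.intro) (simp_all add: P_local_def)
  obtain y where y: "y \<in> carrier L" "y [^]\<^bsub>L\<^esub> p = \<eta> g"
    using P_local_root[OF G PL hom_in_carrier[OF \<eta> g]] by blast
  have "\<phi> y [^]\<^bsub>K\<^esub> p = r [^]\<^bsub>K\<^esub> p" using y \<phi>(2)[OF g] r(2) by (simp flip: hom_nat_pow)
  moreover have "inj_on (\<lambda>x. x [^]\<^bsub>K\<^esub> p) (carrier K)" using K by (simp add: P_local_def bij_betw_def)
  ultimately have "\<phi> y = r" using y(1) r(1) by (auto dest: inj_onD)
  moreover have "character L (\<psi> \<circ> \<phi>)" using characterD[OF \<psi>] by (auto simp: character_def)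
  then have "(\<psi> \<circ> \<phi>) y = 1" using y(1) by (rule character_trivial_on_perfect[OF L])
  ultimately show False using r(3) by simp
qed

section \<open>Homomorphisms out of presented groups and colimits\<close>

lemma (in group) eval_word_comm_word:
  "f x \<in> carrier G \<Longrightarrow> f y \<in> carrier G \<Longrightarrow> eval_word G f (comm_word x y) = group_commutator G (f x) (f y)"
  by (simp add: eval_word_def comm_word_def group_commutator_def m_assoc)

lemma hom_group_H:
  assumes "group K" "commutator_tower K y"
  shows "\<exists>\<theta>\<in>hom group_H K. \<exists>g\<in>carrier group_H. \<theta> g = y 1"
proof -
  interpret group K by fact
  note y = commutator_towerD(1)[OF assms(2)]
  have rel: "eval_word K y l = eval_word K y r"
    if "(l, r) \<in> {([(True, i)], comm_word (2 * i) (2 * i + 1)) | i. 1 \<le> i}" for l r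
  proof -
    obtain i where i: "1 \<le> i" "l = [(True, i)]" "r = comm_word (2 * i) (2 * i + 1)" using \<open>(l, r) \<in> _\<close> by blast
    have "eval_word K y l = y i" using i y by (simp add: eval_word_def)
    also have "\<dots> = eval_word K y r"
      using eval_word_comm_word[of y "2 * i" "2 * i + 1", OF y y] commutator_towerD(2)[OF assms(2) i(1)] i(3) by simp
    finally show ?thesis .
  qed
  have f: "y \<in> {i. 1 \<le> i} \<rightarrow> carrier K" using y by auto
  note h = pres_lift_hom[OF f rel] and gen = pres_lift_generator[OF f rel, where x = 1]
  have "pres_lift K y \<in> hom group_H K" unfolding group_H_def by (rule h)
  moreover have "word_class {i. 1 \<le> i} {([(True, i)], comm_word (2 * i) (2 * i + 1)) | i. 1 \<le> i} [(True, 1)] \<in> carrier group_H"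
    by (auto simp: group_H_def carrier_presented_group)
  moreover have "pres_lift K y (word_class {i. 1 \<le> i} {([(True, i)], comm_word (2 * i) (2 * i + 1)) | i. 1 \<le> i} [(True, 1)]) = y 1"
    by (rule gen) simp_all
  ultimately show ?thesis by blast
qed

lemma word_class_inverse_letter:
  assumes "x \<in> X"
  shows "inv\<^bsub>presented_group X R\<^esub> word_class X R [(True, x)] = word_class X R [(False, x)]"
proof -
  interpret group "presented_group X R" by (rule group_presented_group)
  have "word_eq X R [(False, x), (True, x)] []"
    using word_eq.cancel[of "[]" X "[]" x R False] assms by simp
  then show ?thesis using assms
    by (intro inv_equality)
      (auto simp: word_class_mult one_presented_group word_class_eq_iff carrier_presented_group)
qed

lemma hom_presented_group_eval:
  assumes K: "group K" and \<phi>: "\<phi> \<in> hom (presented_group X R) K"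
  shows "w \<in> words X \<Longrightarrow> \<phi> (word_class X R w) = eval_word K (\<lambda>x. \<phi> (word_class X R [(True, x)])) w"
proof (induction w)
  case Nil
  show ?case using hom_one[OF \<phi> group_presented_group K] by (simp add: one_presented_group eval_word_def)
next
  case (Cons l w)
  interpret group_hom "presented_group X R" K \<phi>
    by (intro group_hom.intro group_hom_axioms.intro group_presented_group K \<phi>)
  obtain b x where l: "l = (b, x)" by (cases l)
  have x: "x \<in> X" "w \<in> words X" using Cons l by auto
  have c: "word_class X R v \<in> carrier (presented_group X R)" if "v \<in> words X" for v
    using that by (simp add: carrier_presented_group)
  have "word_class X R (l # w) = word_class X R [l] \<otimes>\<^bsub>presented_group X R\<^esub> word_class X R w"
    using x l by (simp add: word_class_mult)
  then have "\<phi> (word_class X R (l # w)) = \<phi> (word_class X R [l]) \<otimes>\<^bsub>K\<^esub> \<phi> (word_class X R w)"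
    using c x l by simp
  moreover have "\<phi> (word_class X R [l]) =
      (if b then \<phi> (word_class X R [(True, x)]) else inv\<^bsub>K\<^esub> (\<phi> (word_class X R [(True, x)])))"
    using x c by (auto simp: l simp flip: word_class_inverse_letter)
  ultimately show ?case using Cons.IH[OF x(2)] by (simp add: l eval_word_def)
qed

lemma eval_word_cong_generators:
  "(\<And>x. x \<in> X \<Longrightarrow> f x = g x) \<Longrightarrow> w \<in> words X \<Longrightarrow> eval_word K f w = eval_word K g w"
  by (induction w) (auto simp: eval_word_def)

lemma hom_presented_group_eqI:
  assumes K: "group K" and \<phi>: "\<phi> \<in> hom (presented_group X R) K" "\<phi>' \<in> hom (presented_group X R) K"
    and eq: "\<And>x. x \<in> X \<Longrightarrow> \<phi> (word_class X R [(True, x)]) = \<phi>' (word_class X R [(True, x)])"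
    and A: "A \<in> carrier (presented_group X R)"
  shows "\<phi> A = \<phi>' A"
proof -
  obtain w where w: "w \<in> words X" "A = word_class X R w" using A by (auto simp: carrier_presented_group)
  then show ?thesis
    using hom_presented_group_eval[OF K \<phi>(1) w(1)] hom_presented_group_eval[OF K \<phi>(2) w(1)]
      eval_word_cong_generators[OF eq w(1)] by simp
qed

text \<open>Identifies the generators of the stages for the sequence (1, 1, ...), where
  \<open>j\<close> is always 1, with those of \<open>group_H\<close>: \<open>Base\<close> is the
  first generator, and \<open>Y\<close> and \<open>Z\<close> produce the two successors of an
  index.\<close>

primrec symb_index :: "symb \<Rightarrow> nat" where
  "symb_index Base = 1"
| "symb_index (Y x j) = 2 * symb_index x"
| "symb_index (Z x j) = 2 * symb_index x + 1"

lemma symb_index_pos: "1 \<le> symb_index x"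
  by (induction x) auto

lemma hom_group_F_seq_one:
  assumes "group K" "commutator_tower K y"
  shows "\<exists>\<theta>\<in>hom (group_F_seq (\<lambda>_. 1)) K. \<exists>g\<in>carrier (group_F_seq (\<lambda>_. 1)). \<theta> g = y 1"
proof -
  interpret group K by fact
  let ?n = "\<lambda>_::nat. 1::nat"
  note y = commutator_towerD(1)[OF assms(2)]
  \<comment> \<open>\<open>pres_lift\<close> evaluates words without reference to the set of
    generators, so a single function serves all stages.\<close>
  define g where "g = pres_lift K (y \<circ> symb_index)"
  have f: "y \<circ> symb_index \<in> X \<rightarrow> carrier K" for X using y by auto
  have gh: "g \<in> hom (stage ?n k) K" for k
    unfolding g_def stage_def free_group_def by (rule pres_lift_hom[OF f]) auto
  have gw: "g (word_class X {} w) = eval_word K (y \<circ> symb_index) w" if "w \<in> words X" for X w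
    unfolding g_def by (rule pres_lift_class[OF f _ that]) auto
  have compat: "g (stage_map ?n k A) = g A" if A: "A \<in> carrier (stage ?n k)" for k A
  proof -
    have h: "g \<circ> stage_map ?n k \<in> hom (presented_group (stage_gens ?n k) {}) K"
      using Group.hom_compose[OF stage_map_hom gh] by (simp add: stage_def free_group_def)
    have "(g \<circ> stage_map ?n k) A = g A"
    proof (rule hom_presented_group_eqI[OF \<open>group K\<close> h, of g])
      show "g \<in> hom (presented_group (stage_gens ?n k) {}) K"
        using gh by (simp add: stage_def free_group_def)
      show "A \<in> carrier (presented_group (stage_gens ?n k) {})"
        using A by (simp add: stage_def free_group_def)
      fix x assume x: "x \<in> stage_gens ?n k"
      have w: "comm_word (Y x 1) (Z x 1) \<in> words (stage_gens ?n (Suc k))"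
        using stage_relator_words[OF x] by simp
      have "(g \<circ> stage_map ?n k) (word_class (stage_gens ?n k) {} [(True, x)])
          = g (word_class (stage_gens ?n (Suc k)) {} (comm_word (Y x 1) (Z x 1)))"
        using stage_map_generator[OF x] by simp
      also have "\<dots> = group_commutator K (y (2 * symb_index x)) (y (2 * symb_index x + 1))"
        using gw[OF w] eval_word_comm_word[of "y \<circ> symb_index" "Y x 1" "Z x 1"] y by simp
      also have "\<dots> = y (symb_index x)"
        by (rule commutator_towerD(2)[OF assms(2) symb_index_pos])
      also have "\<dots> = g (word_class (stage_gens ?n k) {} [(True, x)])"
        using gw[of "[(True, x)]" "stage_gens ?n k"] x y by (simp add: eval_word_def)
      finally show "(g \<circ> stage_map ?n k) (word_class (stage_gens ?n k) {} [(True, x)]) = g (word_class (stage_gens ?n k) {} [(True, x)])" .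
    qed
    then show ?thesis by simp
  qed
  let ?cl = "colim_class (stage ?n) (stage_map ?n)"
  obtain \<theta> where \<theta>: "\<theta> \<in> hom (group_F_seq ?n) K" "\<And>k a. a \<in> carrier (stage ?n k) \<Longrightarrow> \<theta> (?cl k a) = g a"
    using hom_seq_colimit[of "stage ?n" "stage_map ?n" "\<lambda>_. g" K, OF group_stage stage_map_hom gh compat]
    unfolding group_F_seq_def by blast
  let ?b = "word_class (stage_gens ?n 0) {} [(True, Base)]"
  have b: "?b \<in> carrier (stage ?n 0)"
    by (auto simp: stage_def free_group_def carrier_presented_group)
  have "g ?b = y 1" using gw[of "[(True, Base)]" "stage_gens ?n 0"] y by (simp add: eval_word_def)
  moreover have "?cl 0 ?b \<in> carrier (group_F_seq ?n)"
    using hom_in_carrier[OF colim_hom[of "stage ?n" "stage_map ?n", OF group_stage stage_map_hom] b]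
    by (simp add: group_F_seq_def)
  ultimately show ?thesis using \<theta> b by metis
qed

lemma hom_group_F:
  assumes "group K" "commutator_tower K y"
  shows "\<exists>\<theta>\<in>hom group_F K. \<exists>g\<in>carrier group_F. \<theta> g = y 1"
proof -
  interpret group K by fact
  let ?n = "\<lambda>_::nat. 1::nat"
  obtain \<theta> g where \<theta>: "\<theta> \<in> hom (group_F_seq ?n) K" and g: "g \<in> carrier (group_F_seq ?n)" "\<theta> g = y 1"
    using hom_group_F_seq_one[OF assms] by blast
  let ?I = "{n :: nat \<Rightarrow> nat. mono n \<and> (\<forall>k. 1 \<le> n k)}"
  have n: "?n \<in> ?I" by (simp add: mono_def)
  let ?X = "SIGMA i:?I. carrier (group_F_seq i)"
  let ?R = "{([(True, i, a), (True, i, b)], [(True, i, a \<otimes>\<^bsub>group_F_seq i\<^esub> b)]) | i a b.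
        i \<in> ?I \<and> a \<in> carrier (group_F_seq i) \<and> b \<in> carrier (group_F_seq i)}"
  \<comment> \<open>The map is \<open>\<theta>\<close> on the free factor of the constant sequence 1
    and trivial on all other factors.\<close>
  define f where "f = (\<lambda>(i, a). if i = ?n then \<theta> a else \<one>\<^bsub>K\<^esub>)"
  have f: "f \<in> ?X \<rightarrow> carrier K" using hom_in_carrier[OF \<theta>] by (auto simp: f_def)
  have rel: "eval_word K f l = eval_word K f r" if lr: "(l, r) \<in> ?R" for l r
  proof -
    obtain i a b where "i \<in> ?I" "a \<in> carrier (group_F_seq i)" "b \<in> carrier (group_F_seq i)"
      "l = [(True, i, a), (True, i, b)]" "r = [(True, i, a \<otimes>\<^bsub>group_F_seq i\<^esub> b)]" using lr by blast
    then show ?thesis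
      using hom_mult[OF \<theta>] hom_in_carrier[OF \<theta>] by (auto simp: eval_word_def f_def)
  qed
  have eq: "group_F = presented_group ?X ?R" by (simp add: group_F_def free_product_def)
  have "pres_lift K f \<in> hom group_F K" unfolding eq by (rule pres_lift_hom[OF f rel])
  moreover have "word_class ?X ?R [(True, ?n, g)] \<in> carrier group_F"
    unfolding eq carrier_presented_group by (intro imageI) (use n g in auto)
  moreover have "pres_lift K f (word_class ?X ?R [(True, ?n, g)]) = f (?n, g)"
    by (rule pres_lift_generator[OF f rel]) (use n g in auto)
  then have "pres_lift K f (word_class ?X ?R [(True, ?n, g)]) = y 1" using g(2) by (simp add: f_def)
  ultimately show ?thesis by blast
qed

section \<open>Perfectness of \<open>group_H\<close> and the conclusion\<close>

lemma perfect_group_H: "perfect group_H"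
proof -
  let ?X = "{i::nat. 1 \<le> i}" and ?R = "{([(True, i)], comm_word (2 * i) (2 * i + 1)) | i. 1 \<le> (i::nat)}"
  define cls where "cls = word_class ?X ?R"
  have eq: "group_H = presented_group ?X ?R" by (simp add: group_H_def)
  interpret H: group group_H by (rule group_group_H)
  have cl: "cls w \<in> carrier group_H" if "w \<in> words ?X" for w
    unfolding eq cls_def carrier_presented_group using that by blast
  have mult: "cls u \<otimes>\<^bsub>group_H\<^esub> cls v = cls (u @ v)" if "u \<in> words ?X" "v \<in> words ?X" for u v
    unfolding eq cls_def by (rule word_class_mult[OF that])
  let ?D = "derived group_H (carrier group_H)"
  interpret D: subgroup ?D group_H by (rule H.derived_is_subgroup) simp
  have gen: "cls [(True, i)] \<in> ?D" if i: "1 \<le> i" for i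
  proof -
    have w: "[(True, 2 * i)] \<in> words ?X" "[(True, 2 * i + 1)] \<in> words ?X" "comm_word (2 * i) (2 * i + 1) \<in> words ?X"
      using i by (auto simp: comm_word_def)
    have inv: "inv\<^bsub>group_H\<^esub> cls [(True, j)] = cls [(False, j)]" if "1 \<le> j" for j
      unfolding eq cls_def by (rule word_class_inverse_letter) (use that in simp)
    have "word_eq ?X ?R ([] @ [(True, i)] @ []) ([] @ comm_word (2 * i) (2 * i + 1) @ [])"
      by (rule word_eq.rel) (use i w in auto)
    then have "cls [(True, i)] = cls (comm_word (2 * i) (2 * i + 1))"
      using word_class_eq_iff[of "[(True, i)]" ?X ?R] i by (simp add: cls_def)
    also have "\<dots> = cls [(True, 2 * i)] \<otimes>\<^bsub>group_H\<^esub> cls [(True, 2 * i + 1)]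
        \<otimes>\<^bsub>group_H\<^esub> inv\<^bsub>group_H\<^esub> cls [(True, 2 * i)] \<otimes>\<^bsub>group_H\<^esub> inv\<^bsub>group_H\<^esub> cls [(True, 2 * i + 1)]"
      using i by (simp add: inv mult comm_word_def)
    also have "\<dots> \<in> ?D"
      unfolding derived_def by (rule generate.incl) (use cl[OF w(1)] cl[OF w(2)] in blast)
    finally show ?thesis .
  qed
  have "cls w \<in> ?D" if "w \<in> words ?X" for w
    using that
  proof (induction w)
    case Nil
    have "cls [] = \<one>\<^bsub>group_H\<^esub>" unfolding eq cls_def one_presented_group ..
    then show ?case by simp
  next
    case (Cons l w)
    obtain b i where l: "l = (b, i)" by (cases l)
    have i: "1 \<le> i" "w \<in> words ?X" using Cons.prems l by auto
    have "cls [(False, i)] = inv\<^bsub>group_H\<^esub> cls [(True, i)]"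
      unfolding eq cls_def by (rule word_class_inverse_letter[symmetric]) (use i in simp)
    then have "cls [l] \<in> ?D" using gen[OF i(1)] l by (cases b) simp_all
    then have "cls [l] \<otimes>\<^bsub>group_H\<^esub> cls w \<in> ?D" by (rule D.m_closed[OF _ Cons.IH[OF i(2)]])
    then show ?case using mult[of "[l]" w] i l by simp
  qed
  moreover have "carrier group_H = cls ` words ?X" unfolding cls_def eq by (rule carrier_presented_group)
  ultimately have "carrier group_H \<subseteq> ?D" by auto
  then show ?thesis
    using D.subset by (auto simp: perfect_def intro: group_group_H)
qed

theorem theorem4p5:
  fixes p :: nat
  assumes "prime p"
  shows "perfect group_H \<and>
    (\<forall>(L :: 'a monoid) \<eta>. P_localization p group_H L \<eta> \<longrightarrow> \<not> perfect L) \<and>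
    (\<forall>(L :: 'b monoid) \<eta>. P_localization p group_F L \<eta> \<longrightarrow> \<not> perfect L)"
proof -
  obtain K :: "(nat \<times> nat) set monoid" and \<psi> y r where K: "P_local p K" "character K \<psi>" "commutator_tower K y"
    "r \<in> carrier K" "r [^]\<^bsub>K\<^esub> p = y 1" "\<psi> r \<noteq> 1"
    using P_local_commutator_tower[OF assms] by blast
  have gK: "group K" using K(1) by (simp add: P_local_def)
  obtain \<theta> g where H: "\<theta> \<in> hom group_H K" "g \<in> carrier group_H" "\<theta> g = y 1"
    using hom_group_H[OF gK K(3)] by blast
  obtain \<theta>' g' where F: "\<theta>' \<in> hom group_F K" "g' \<in> carrier group_F" "\<theta>' g' = y 1"
    using hom_group_F[OF gK K(3)] by blast
  have "\<not> perfect L" if "P_localization p group_H L \<eta>" for L :: "'a monoid" and \<eta>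
    by (rule localization_not_perfect[OF group_group_H that K(1,2) H(1,2) K(4) _ K(6)]) (simp add: K H)
  moreover have "\<not> perfect L" if "P_localization p group_F L \<eta>" for L :: "'b monoid" and \<eta>
    by (rule localization_not_perfect[OF group_group_F that K(1,2) F(1,2) K(4) _ K(6)]) (simp add: K F)
  ultimately show ?thesis using perfect_group_H by blast
qed

end
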